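(* Assume the tree matrix is transient. Consider the symmetric kernel $$p(t,\xi,\eta)=\sum_{n=0}^{|\xi\wedge\eta|}\frac{e^{-t/G_n(\xi)}-e^{-t/G_{n+1}(\xi)}}{\mu(C^n(\xi))},\qquad(\xi,\eta)\in\partial_\infty^{reg}\times\partial_\infty^{reg},\ t>0.$$ This kernel is sub-Markovian with total mass $e^{-t/G_0}=\int p(t,\xi,\eta)\,\mu(d\eta)$, and it is also a Feller transition kernel. The sub-Markov semigroup $P^W_tf(\xi)=\int p(t,\xi,\eta)f(\eta)\,\mu(d\eta)$ induced by this kernel in $L^2(\mu)$ verifies $$P^W_tf=\sum_{n\ge0}e^{-t/G_n}\Big(\mathbb E_\mu(f|\mathcal F_n)-\mathbb E_\mu(f|\mathcal F_{n-1})\Big).$$ The infinitesimal generator of this semigroup is an extension of $-W^{-1}$ defined on $\mathcal D$, and its potential is $W$. Moreover the Green kernel of this semigroup is $U$, that is $$U_{\xi\eta}=\int_0^\infty p(t,\xi,\eta)\,dt\qquad\text{for }\xi,\eta\in\partial_\infty^{reg}.$$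
   Context: Tree and matrix. $(I,\mathcal T)$ is a connected, locally finite, non-oriented tree with countably infinite set of sites $I$ and root $r$, every branch being infinite (each site has at least one successor). $|i|$ is the distance from $i$ to $r$; $i^-$ ($i\ne r$) is the neighbour of $i$ closer to $r$; $S_i=\{j:j^-=i\}$. $w:\mathbb N=\{0,1,\dots\}\to(0,\infty)$ is strictly increasing, $w_{-1}=0$, $\Delta_n(w)=w_n-w_{n-1}$ for $n\ge0$. The tree matrix is $U_{ij}=w_{|i\wedge j|}$, $i\wedge j$ being the common vertex, farthest from $r$, of the geodesics from $r$ to $i$ and $j$. The matrix $Q$ is: $Q_{ii^-}=Q_{i^-i}=(w_{|i|}-w_{|i|-1})^{-1}$ for $i\neq r$, $Q_{ii}=-\big((w_{|i|}-w_{|i|-1})^{-1}+|S_i|(w_{|i|+1}-w_{|i|})^{-1}\big)$, and $0$ otherwise. Boundary. $\partial_\infty$ is the set of infinite geodesic rays $\xi=(\xi(n))_{n\ge0}$ with $\xi(0)=r$, $\xi(n+1)\in S_{\xi(n)}$, with the compact topology generated by the sets $\partial_\infty(i)=\{\xi:\xi(|i|)=i\}$; $C^n(\xi)=\partial_\infty(\xi(n))$. For $\xi\ne\eta$, $|\xi\wedge\eta|=\max\{n:\xi(n)=\eta(n)\}$ and $U_{\xi\eta}=w_{|\xi\wedge\eta|}$; $|\xi\wedge\xi|=\infty$, $U_{\xi\xi}=\lim_nw_n\in(0,\infty]$. Process in the tree. $X$ is the minimal continuous-time Markov chain on $I$ with $q$-matrix $Q$, absorbed from $r$ at rate $1/w_0$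 in an extra state $\partial_r$ (absorption time $T_{\partial_r}$); $\zeta$ is its lifetime (minimum of absorption and explosion times). $X_\zeta=\partial_r$ if absorption occurs, and otherwise $X_\zeta\in\partial_\infty$ is the a.s. existing limit of $X_t$ as $t\uparrow\zeta$. Transient means $\mathbb P_r\{X_\zeta\in\partial_\infty\}>0$; $\mu(\cdot)=\mathbb P_r\{X_\zeta\in\cdot\mid X_\zeta\in\partial_\infty\}$. A point $\eta\in\partial_\infty$ is regular if $\lim_{j\to\eta}\mathbb P_j\{T_{\partial_r}<\infty\}=0$; $\partial_\infty^{reg}$ is the set of regular points; it has full $\mu$-measure, and $\mu(C^n(\xi))>0$ for $\xi$ regular. Operator. $\mathcal F_n$ is the finite $\sigma$-field on $\partial_\infty$ generated by $\{\partial_\infty(i):|i|=n\}$; $\mathbb E_\mu(\cdot|\mathcal F_{-1})=0$; $\mathcal D=\bigcup_nL^2(\mathcal F_n,\mu)$. $G_n(\xi)=\sum_{k\ge n}\Delta_k(w)\mu(C^k(\xi))$; on $\partial^{reg}_\infty$ it is positive, $G_0$ is constant and $G_n(\xi)$ depends only on $\xi(n-1)$ for $n\ge1$. $Wf(\eta)=\int U_{\eta\xi}f(\xi)\mu(d\xi)$ is a bounded injective self-adjoint operator on $L^2(\mu)$ whose image contains $\mathcal D$; $W^{-1}$ is its inverse. The potential of $P^W$ is $\int_0^\infty P^W_t\,dt$. Feller means here that $P^W_t$ maps the class of restrictions to $\partial_\infty^{reg}$ of continuous functions on $\partial_\infty$ into itself, and $P^W_tf\to f$ as $t\to0$ for $f$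 in this class. *)

theory Defs
  imports "HOL-Probability.Probability"
begin

section \<open>Rooted trees\<close>

record 'v rtree =
  sites :: "'v set"
  adj :: "'v \<Rightarrow> 'v \<Rightarrow> bool"
  root :: 'v

definition simple_path :: "'v rtree \<Rightarrow> 'v \<Rightarrow> 'v list \<Rightarrow> 'v \<Rightarrow> bool" where
  "simple_path T i p j \<longleftrightarrow>
     p \<noteq> [] \<and> hd p = i \<and> last p = j \<and> set p \<subseteq> sites T \<and> distinct p \<and> successively (adj T) p"

definition geodesic :: "'v rtree \<Rightarrow> 'v \<Rightarrow> 'v \<Rightarrow> 'v list" where
  "geodesic T i j = (THE p. simple_path T i p j)"

definition level :: "'v rtree \<Rightarrow> 'v \<Rightarrow> nat" where
  "level T i = length (geodesic T (root T) i) - 1"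

definition parent :: "'v rtree \<Rightarrow> 'v \<Rightarrow> 'v" where
  "parent T i = (THE j. adj T i j \<and> level T j < level T i)"

definition succs :: "'v rtree \<Rightarrow> 'v \<Rightarrow> 'v set" where
  "succs T i = {j \<in> sites T. j \<noteq> root T \<and> parent T j = i}"

definition subtree :: "'v rtree \<Rightarrow> 'v \<Rightarrow> 'v set" where
  "subtree T i = {j \<in> sites T. i \<in> set (geodesic T (root T) j)}"

text \<open>A tree is a graph in which any two vertices are joined by exactly one simple path.\<close>

definition infinite_tree :: "'v rtree \<Rightarrow> bool" where
  "infinite_tree T \<longleftrightarrow>
     countable (sites T) \<and> infinite (sites T) \<and> root T \<in> sites T
     \<and> (\<forall>i j. adj T i j \<longrightarrow> i \<in> sites T \<and> j \<in> sites T \<and> i \<noteq> j \<and> adj T j i)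
     \<and> (\<forall>i\<in>sites T. \<forall>j\<in>sites T. \<exists>!p. simple_path T i p j)
     \<and> (\<forall>i\<in>sites T. finite {j. adj T i j})
     \<and> (\<forall>i\<in>sites T. succs T i \<noteq> {})"

section \<open>The $q$-matrix\<close>

definition delta :: "(nat \<Rightarrow> real) \<Rightarrow> nat \<Rightarrow> real" where
  "delta w n = w n - (if n = 0 then 0 else w (n - 1))"

definition Qmat :: "'v rtree \<Rightarrow> (nat \<Rightarrow> real) \<Rightarrow> 'v \<Rightarrow> 'v \<Rightarrow> real" where
  "Qmat T w i j =
     (if i = j then - (1 / delta w (level T i)
                       + real (card (succs T i)) / delta w (level T i + 1))
      else if i \<noteq> root T \<and> j = parent T i then 1 / delta w (level T i)
      else if j \<noteq> root T \<and> i = parent T j then 1 / delta w (level T j)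
      else 0)"

text \<open>\<open>Absorbed\<close> is the extra state reached from the root at rate \<open>1 / w 0\<close>, which is the
  row defect of \<^const>\<open>Qmat\<close> at the root (the other rows sum to zero).  \<open>Cemetery\<close> is the
  position of the minimal chain from its explosion time on.\<close>

datatype 'v state = Site 'v | Absorbed | Cemetery

fun Qext :: "'v rtree \<Rightarrow> (nat \<Rightarrow> real) \<Rightarrow> 'v state \<Rightarrow> 'v state \<Rightarrow> real" where
  "Qext T w (Site i) (Site j) = Qmat T w i j"
| "Qext T w (Site i) Absorbed = (if i = root T then 1 / w 0 else 0)"
| "Qext T w _ _ = 0"

section \<open>The minimal chain\<close>

definition jump_prob :: "('s \<Rightarrow> 's \<Rightarrow> real) \<Rightarrow> 's \<Rightarrow> 's \<Rightarrow> real" where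
  "jump_prob q x y =
     (if q x x = 0 then of_bool (x = y) else if x = y then 0 else q x y / (- q x x))"

text \<open>Jump chain and holding times: \<open>Y\<close> is a Markov chain with transition matrix
  \<^const>\<open>jump_prob\<close> and, given \<open>Y\<close>, the holding times \<open>S\<close> are independent, exponential
  with rates \<open>- q (Y n) (Y n)\<close>.  The displayed probabilities determine the joint law of
  \<open>(Y, S)\<close>; a state of rate \<open>0\<close> has almost surely infinite holding time.  The path
  \<open>X\<close> sits at \<open>Y n\<close> between the \<open>n\<close>-th and the next jump time; only times \<open>t \<ge> 0\<close> matter.
  \<open>P i\<close> is the law of the process started from site \<open>i\<close>.\<close>

definition minimal_chain ::
  "'v rtree \<Rightarrow> (nat \<Rightarrow> real) \<Rightarrow> ('v \<Rightarrow> 'o measure) \<Rightarrow> (real \<Rightarrow> 'o \<Rightarrow> 'v state) \<Rightarrow> bool" where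
  "minimal_chain T w P X \<longleftrightarrow>
    (\<exists>(Y :: nat \<Rightarrow> 'o \<Rightarrow> 'v state) (S :: nat \<Rightarrow> 'o \<Rightarrow> ennreal). \<forall>i\<in>sites T.
       prob_space (P i)
       \<and> (\<forall>n. Y n \<in> measurable (P i) (count_space (insert Absorbed (Site ` sites T))))
       \<and> (\<forall>n. S n \<in> borel_measurable (P i))
       \<and> (\<forall>n. \<forall>\<omega>\<in>space (P i). 0 < S n \<omega>)
       \<and> (\<forall>n (y :: nat \<Rightarrow> 'v state) (s :: nat \<Rightarrow> real).
            (\<forall>k\<le>n. y k \<in> insert Absorbed (Site ` sites T) \<and> 0 \<le> s k) \<longrightarrow>
            measure (P i) {\<omega> \<in> space (P i). \<forall>k\<le>n. Y k \<omega> = y k \<and> ennreal (s k) < S k \<omega>}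
            = of_bool (y 0 = Site i)
              * (\<Prod>k<n. jump_prob (Qext T w) (y k) (y (Suc k)))
              * (\<Prod>k\<le>n. exp (Qext T w (y k) (y k) * s k)))
       \<and> (\<forall>\<omega>\<in>space (P i). \<forall>t\<ge>0.
            (\<forall>n. (\<Sum>k<n. S k \<omega>) \<le> ennreal t \<and> ennreal t < (\<Sum>k<Suc n. S k \<omega>)
                 \<longrightarrow> X t \<omega> = Y n \<omega>)
            \<and> ((\<Sum>k. S k \<omega>) \<le> ennreal t \<longrightarrow> X t \<omega> = Cemetery)))"

definition absorption_time :: "(real \<Rightarrow> 'o \<Rightarrow> 'v state) \<Rightarrow> 'o \<Rightarrow> ennreal" where
  "absorption_time X \<omega> = Inf (ennreal ` {t. 0 \<le> t \<and> X t \<omega> = Absorbed})"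

definition explosion_time :: "(real \<Rightarrow> 'o \<Rightarrow> 'v state) \<Rightarrow> 'o \<Rightarrow> ennreal" where
  "explosion_time X \<omega> = Inf (ennreal ` {t. 0 \<le> t \<and> X t \<omega> = Cemetery})"

definition lifetime :: "(real \<Rightarrow> 'o \<Rightarrow> 'v state) \<Rightarrow> 'o \<Rightarrow> ennreal" where
  "lifetime X \<omega> = min (absorption_time X \<omega>) (explosion_time X \<omega>)"

section \<open>The boundary\<close>

definition boundary :: "'v rtree \<Rightarrow> (nat \<Rightarrow> 'v) set" where
  "boundary T = {\<xi>. \<xi> 0 = root T \<and> (\<forall>n. \<xi> (Suc n) \<in> succs T (\<xi> n))}"

definition cyl :: "'v rtree \<Rightarrow> 'v \<Rightarrow> (nat \<Rightarrow> 'v) set" where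
  "cyl T i = {\<xi> \<in> boundary T. \<xi> (level T i) = i}"

definition boundary_top :: "'v rtree \<Rightarrow> (nat \<Rightarrow> 'v) topology" where
  "boundary_top T = topology_generated_by (cyl T ` sites T)"

text \<open>The cylinders form a countable base, so this is the Borel $\sigma$-field of
  \<^const>\<open>boundary_top\<close>.\<close>

definition boundary_sigma :: "'v rtree \<Rightarrow> (nat \<Rightarrow> 'v) measure" where
  "boundary_sigma T = sigma (boundary T) (cyl T ` sites T)"

definition level_sigma :: "'v rtree \<Rightarrow> nat \<Rightarrow> (nat \<Rightarrow> 'v) measure" where
  "level_sigma T n = sigma (boundary T) (cyl T ` {i \<in> sites T. level T i = n})"

text \<open>Convergence of sites to a boundary point: \<open>j \<rightarrow> \<eta>\<close>.\<close>

definition to_boundary :: "'v rtree \<Rightarrow> (nat \<Rightarrow> 'v) \<Rightarrow> 'v filter" where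
  "to_boundary T \<eta> = (INF n. principal (subtree T (\<eta> n)))"

definition meet_level :: "(nat \<Rightarrow> 'v) \<Rightarrow> (nat \<Rightarrow> 'v) \<Rightarrow> enat" where
  "meet_level \<xi> \<eta> = (if \<xi> = \<eta> then \<infinity> else enat (Max {n. \<xi> n = \<eta> n}))"

definition Ubd :: "(nat \<Rightarrow> real) \<Rightarrow> (nat \<Rightarrow> 'v) \<Rightarrow> (nat \<Rightarrow> 'v) \<Rightarrow> ennreal" where
  "Ubd w \<xi> \<eta> =
     (if \<xi> = \<eta> then lim (\<lambda>n. ennreal (w n)) else ennreal (w (the_enat (meet_level \<xi> \<eta>))))"

section \<open>Exit from the tree, regular points\<close>

definition exits_at ::
  "'v rtree \<Rightarrow> (real \<Rightarrow> 'o \<Rightarrow> 'v state) \<Rightarrow> 'o \<Rightarrow> (nat \<Rightarrow> 'v) \<Rightarrow> bool" where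
  "exits_at T X \<omega> \<xi> \<longleftrightarrow>
     \<xi> \<in> boundary T \<and> absorption_time X \<omega> = \<infinity>
     \<and> filterlim (\<lambda>t. X (enn2real t) \<omega>) (filtermap Site (to_boundary T \<xi>))
         (at_left (lifetime X \<omega>))"

definition escape_event ::
  "'v rtree \<Rightarrow> ('v \<Rightarrow> 'o measure) \<Rightarrow> (real \<Rightarrow> 'o \<Rightarrow> 'v state) \<Rightarrow> 'o set" where
  "escape_event T P X = {\<omega> \<in> space (P (root T)). \<exists>\<xi>. exits_at T X \<omega> \<xi>}"

definition transient ::
  "'v rtree \<Rightarrow> ('v \<Rightarrow> 'o measure) \<Rightarrow> (real \<Rightarrow> 'o \<Rightarrow> 'v state) \<Rightarrow> bool" where
  "transient T P X \<longleftrightarrow> measure (P (root T)) (escape_event T P X) > 0"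

text \<open>The value outside \<^const>\<open>escape_event\<close> is irrelevant: \<open>exit_law\<close> conditions on that
  event.\<close>

definition exit_point ::
  "'v rtree \<Rightarrow> (real \<Rightarrow> 'o \<Rightarrow> 'v state) \<Rightarrow> 'o \<Rightarrow> (nat \<Rightarrow> 'v)" where
  "exit_point T X \<omega> =
     (if \<exists>\<xi>. exits_at T X \<omega> \<xi> then THE \<xi>. exits_at T X \<omega> \<xi> else SOME \<xi>. \<xi> \<in> boundary T)"

definition exit_law ::
  "'v rtree \<Rightarrow> ('v \<Rightarrow> 'o measure) \<Rightarrow> (real \<Rightarrow> 'o \<Rightarrow> 'v state) \<Rightarrow> (nat \<Rightarrow> 'v) measure" where
  "exit_law T P X =
     distr (uniform_measure (P (root T)) (escape_event T P X)) (boundary_sigma T) (exit_point T X)"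

definition regular_points ::
  "'v rtree \<Rightarrow> ('v \<Rightarrow> 'o measure) \<Rightarrow> (real \<Rightarrow> 'o \<Rightarrow> 'v state) \<Rightarrow> (nat \<Rightarrow> 'v) set" where
  "regular_points T P X =
     {\<eta> \<in> boundary T.
        ((\<lambda>j. measure (P j) {\<omega> \<in> space (P j). absorption_time X \<omega> < \<infinity>}) \<longlongrightarrow> 0)
          (to_boundary T \<eta>)}"

section \<open>The space $L^2$\<close>

text \<open>Real-valued functions, identified when almost everywhere equal.\<close>

definition L2 :: "'a measure \<Rightarrow> ('a \<Rightarrow> real) \<Rightarrow> bool" where
  "L2 M f \<longleftrightarrow> f \<in> borel_measurable M \<and> integrable M (\<lambda>x. (f x)\<^sup>2)"

definition L2_norm :: "'a measure \<Rightarrow> ('a \<Rightarrow> real) \<Rightarrow> real" where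
  "L2_norm M f = sqrt (\<integral>x. (f x)\<^sup>2 \<partial>M)"

definition L2_tendsto ::
  "'a measure \<Rightarrow> ('i \<Rightarrow> 'a \<Rightarrow> real) \<Rightarrow> ('a \<Rightarrow> real) \<Rightarrow> 'i filter \<Rightarrow> bool" where
  "L2_tendsto M u v F \<longleftrightarrow>
     (\<forall>\<^sub>F t in F. L2 M (u t)) \<and> L2 M v
     \<and> ((\<lambda>t. L2_norm M (\<lambda>x. u t x - v x)) \<longlongrightarrow> 0) F"

definition L2_sub_markov_semigroup ::
  "'a measure \<Rightarrow> (real \<Rightarrow> ('a \<Rightarrow> real) \<Rightarrow> 'a \<Rightarrow> real) \<Rightarrow> bool" where
  "L2_sub_markov_semigroup M P \<longleftrightarrow>
     (\<forall>t>0. \<forall>f. L2 M f \<longrightarrow> L2 M (P t f) \<and> L2_norm M (P t f) \<le> L2_norm M f)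
     \<and> (\<forall>t>0. \<forall>f g a b. L2 M f \<and> L2 M g \<longrightarrow>
          (AE x in M. P t (\<lambda>y. a * f y + b * g y) x = a * P t f x + b * P t g x))
     \<and> (\<forall>s>0. \<forall>t>0. \<forall>f. L2 M f \<longrightarrow> (AE x in M. P (s + t) f x = P s (P t f) x))
     \<and> (\<forall>t>0. \<forall>f. L2 M f \<and> (AE x in M. 0 \<le> f x \<and> f x \<le> 1) \<longrightarrow>
          (AE x in M. 0 \<le> P t f x \<and> P t f x \<le> 1))
     \<and> (\<forall>f. L2 M f \<longrightarrow> L2_tendsto M (\<lambda>t. P t f) f (at_right 0))"

text \<open>\<open>L2_generator M P f g\<close>: \<open>f\<close> is in the domain of the infinitesimal generator of \<open>P\<close>,
  and \<open>g\<close> is its image.\<close>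

definition L2_generator ::
  "'a measure \<Rightarrow> (real \<Rightarrow> ('a \<Rightarrow> real) \<Rightarrow> 'a \<Rightarrow> real) \<Rightarrow> ('a \<Rightarrow> real) \<Rightarrow> ('a \<Rightarrow> real) \<Rightarrow> bool" where
  "L2_generator M P f g \<longleftrightarrow>
     L2 M f \<and> L2_tendsto M (\<lambda>t x. (P t f x - f x) / t) g (at_right 0)"

section \<open>The operator and the kernel\<close>

text \<open>From here on \<open>\<mu>\<close> and \<open>R\<close> stand for \<^const>\<open>exit_law\<close> and \<^const>\<open>regular_points\<close>.\<close>

text \<open>The value \<open>\<infinity>\<close> of \<^const>\<open>Ubd\<close> occurs only on the diagonal and only if \<open>w\<close> is
  unbounded, in which case \<open>\<mu>\<close> has no atoms; so \<^const>\<open>enn2real\<close> is harmless.\<close>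

definition Wop ::
  "(nat \<Rightarrow> real) \<Rightarrow> (nat \<Rightarrow> 'v) measure \<Rightarrow> ((nat \<Rightarrow> 'v) \<Rightarrow> real) \<Rightarrow> (nat \<Rightarrow> 'v) \<Rightarrow> real" where
  "Wop w \<mu> f \<eta> = (\<integral>\<xi>. enn2real (Ubd w \<eta> \<xi>) * f \<xi> \<partial>\<mu>)"

text \<open>The graph of the inverse of \<^const>\<open>Wop\<close> on \<open>L\<^sup>2\<close>.\<close>

definition Wop_inverse ::
  "(nat \<Rightarrow> real) \<Rightarrow> (nat \<Rightarrow> 'v) measure \<Rightarrow> ((nat \<Rightarrow> 'v) \<Rightarrow> real) \<Rightarrow> ((nat \<Rightarrow> 'v) \<Rightarrow> real) \<Rightarrow> bool" where
  "Wop_inverse w \<mu> f g \<longleftrightarrow> L2 \<mu> f \<and> L2 \<mu> g \<and> (AE \<eta> in \<mu>. Wop w \<mu> g \<eta> = f \<eta>)"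

definition cylinder_functions ::
  "'v rtree \<Rightarrow> (nat \<Rightarrow> 'v) measure \<Rightarrow> ((nat \<Rightarrow> 'v) \<Rightarrow> real) set" where
  "cylinder_functions T \<mu> = {f. L2 \<mu> f \<and> (\<exists>n. f \<in> borel_measurable (level_sigma T n))}"

definition cond_increment ::
  "'v rtree \<Rightarrow> (nat \<Rightarrow> 'v) measure \<Rightarrow> nat \<Rightarrow> ((nat \<Rightarrow> 'v) \<Rightarrow> real) \<Rightarrow> (nat \<Rightarrow> 'v) \<Rightarrow> real" where
  "cond_increment T \<mu> n f \<xi> =
     real_cond_exp \<mu> (level_sigma T n) f \<xi>
     - (if n = 0 then 0 else real_cond_exp \<mu> (level_sigma T (n - 1)) f \<xi>)"

definition Gfun ::
  "'v rtree \<Rightarrow> (nat \<Rightarrow> real) \<Rightarrow> (nat \<Rightarrow> 'v) measure \<Rightarrow> nat \<Rightarrow> (nat \<Rightarrow> 'v) \<Rightarrow> real" where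
  "Gfun T w \<mu> n \<xi> = (\<Sum>k. delta w (n + k) * measure \<mu> (cyl T (\<xi> (n + k))))"

text \<open>All terms are nonnegative on regular points; on the diagonal the sum is infinite and may
  diverge, whence the values in \<open>[0, \<infinity>]\<close>.\<close>

definition pker ::
  "'v rtree \<Rightarrow> (nat \<Rightarrow> real) \<Rightarrow> (nat \<Rightarrow> 'v) measure \<Rightarrow> real \<Rightarrow> (nat \<Rightarrow> 'v) \<Rightarrow> (nat \<Rightarrow> 'v) \<Rightarrow> ennreal" where
  "pker T w \<mu> t \<xi> \<eta> =
     (\<Sum>n. if enat n \<le> meet_level \<xi> \<eta>
          then ennreal ((exp (- t / Gfun T w \<mu> n \<xi>) - exp (- t / Gfun T w \<mu> (Suc n) \<xi>))
                        / measure \<mu> (cyl T (\<xi> n)))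
          else 0)"

text \<open>The kernel lives on regular points; off this set, which is \<open>\<mu>\<close>-null, \<open>P\<^sup>W\<close> is
  set to zero.\<close>

definition PW ::
  "'v rtree \<Rightarrow> (nat \<Rightarrow> real) \<Rightarrow> (nat \<Rightarrow> 'v) measure \<Rightarrow> (nat \<Rightarrow> 'v) set
    \<Rightarrow> real \<Rightarrow> ((nat \<Rightarrow> 'v) \<Rightarrow> real) \<Rightarrow> (nat \<Rightarrow> 'v) \<Rightarrow> real" where
  "PW T w \<mu> R t f \<xi> =
     (if \<xi> \<in> R then LINT \<eta>:R|\<mu>. enn2real (pker T w \<mu> t \<xi> \<eta>) * f \<eta> else 0)"

definition sub_markov_transition_kernel ::
  "'a measure \<Rightarrow> 'a set \<Rightarrow> (real \<Rightarrow> 'a \<Rightarrow> 'a \<Rightarrow> ennreal) \<Rightarrow> bool" where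
  "sub_markov_transition_kernel M R p \<longleftrightarrow>
     (\<forall>t>0. (\<lambda>(x, y). p t x y)
        \<in> borel_measurable (restrict_space M R \<Otimes>\<^sub>M restrict_space M R))
     \<and> (\<forall>t>0. \<forall>x\<in>R. (\<integral>\<^sup>+y\<in>R. p t x y \<partial>M) \<le> 1)
     \<and> (\<forall>s>0. \<forall>t>0. \<forall>x\<in>R. \<forall>z\<in>R. p (s + t) x z = (\<integral>\<^sup>+y\<in>R. p s x y * p t y z \<partial>M))"

definition continuous_restrictions :: "'v rtree \<Rightarrow> (nat \<Rightarrow> 'v) set \<Rightarrow> ((nat \<Rightarrow> 'v) \<Rightarrow> real) set" where
  "continuous_restrictions T R =
     {f. \<exists>g. continuous_map (boundary_top T) euclideanreal g \<and> (\<forall>\<xi>\<in>R. f \<xi> = g \<xi>)}"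

definition feller ::
  "'v rtree \<Rightarrow> (nat \<Rightarrow> 'v) set
    \<Rightarrow> (real \<Rightarrow> ((nat \<Rightarrow> 'v) \<Rightarrow> real) \<Rightarrow> (nat \<Rightarrow> 'v) \<Rightarrow> real) \<Rightarrow> bool" where
  "feller T R P \<longleftrightarrow>
     (\<forall>f\<in>continuous_restrictions T R.
        (\<forall>t>0. P t f \<in> continuous_restrictions T R)
        \<and> uniform_limit R (\<lambda>t. P t f) f (at_right 0))"

end

(* Let h(i) be the probability that the chain started at i is absorbed at the root.  The jump chain
   is reversible, so the expected numbers of visits, started at the root r, are expressed by h, and
   the flow through the edge above i gives mu(C(i)) = w_0 (h(i^-) - h(i)) / (Delta_|i|(w) (1 - h(r))).
   Hence G_{n+1}(xi) is w_0 h(xi(n)) / (1 - h(r)) at every xi with h(xi(n)) -> 0; these are the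
   regular points, because h decreases along the tree.  That they have full measure follows from an
   energy inequality: the form A_m(h) = sum over the level m of h times the flow of h, which is
   proportional to the integral of h(xi(m)) with respect to mu, is at most
   A_0(h) - 2 A_0(f) + A_0(f, f) for f the probability of absorption within k <= m steps, and this
   vanishes as k tends to infinity.

   On the boundary every operator involved has a kernel sum_n b(xi(n)) 1[xi(n) = eta(n)].  On a
   function of xi(n) with mean 0 over each cylinder of level n - 1 it acts as multiplication by the
   tail sum_{k >= n} b(xi(k)) mu(C^k(xi)): this is G_n for W, and, by telescoping, exp(-t / G_n) for
   p(t, ., .).  By the Schur test these operators are bounded on L^2, and the martingale increments
   of f sum up to f in L^2, so identities between the operators reduce to identities between these
   multipliers. *)
theory Submission
  imports Defs
begin

section \<open>Rooted trees and their rays\<close>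

text \<open>That h tends to 0 along almost every exit ray is a zero-one statement about the walk;
  the energy bound replaces a martingale argument by a computation with multi-step probabilities. It
  is the nonnegativity of the Dirichlet energy of h - f between the root and level m. The cross term
  is a pure boundary term because h is harmonic, the energy of f is at most its boundary term
  because f is subharmonic, and f vanishes on level m because m steps do not lead from there to
  absorption. Only terms at the root survive, and they cancel as f(r) tends to h(r).

  In the analytic half, the claims about the kernel, its mass and the Feller property hold at every
  regular point, those about L2 almost everywhere. So the multiplier rule is proved at each regular
  point for functions of finitely many coordinates, and extended to L2 by continuity afterwards. U
  may be infinite on the diagonal; the operators are bounded all the same, because the kernels have
  the constant row integrals G_0 and exp(-t / G_0).\<close>

locale rooted_tree =
  fixes T :: "'v rtree"
  assumes tree: "infinite_tree T"
begin

lemma root_site [simp]: "root T \<in> sites T"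
  and countable_sites: "countable (sites T)"
  and adj_sym: "adj T i j \<Longrightarrow> adj T j i"
  and adj_site: "adj T i j \<Longrightarrow> i \<in> sites T" "adj T i j \<Longrightarrow> j \<in> sites T"
  and adj_neq: "adj T i j \<Longrightarrow> i \<noteq> j"
  and finite_adj: "i \<in> sites T \<Longrightarrow> finite {j. adj T i j}"
  and succs_nonempty: "i \<in> sites T \<Longrightarrow> succs T i \<noteq> {}"
  and unique_path: "i \<in> sites T \<Longrightarrow> j \<in> sites T \<Longrightarrow> \<exists>!p. simple_path T i p j"
  using tree unfolding infinite_tree_def by blast+

abbreviation geo :: "'v \<Rightarrow> 'v list" where
  "geo i \<equiv> geodesic T (root T) i"

lemma geo_path: "i \<in> sites T \<Longrightarrow> simple_path T (root T) (geo i) i"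
  unfolding geodesic_def by (rule theI') (simp add: unique_path)

lemma geo_eqI: "simple_path T (root T) p i \<Longrightarrow> geo i = p"
proof -
  assume p: "simple_path T (root T) p i"
  then have "i \<in> sites T"
    unfolding simple_path_def using last_in_set by blast
  then show ?thesis
    unfolding geodesic_def using p unique_path[of "root T" i] by (intro the1_equality) auto
qed

lemma geo_root [simp]: "geo (root T) = [root T]"
  by (rule geo_eqI) (simp add: simple_path_def)

text \<open>An initial segment of a simple path is a simple path, so uniqueness makes it the
  geodesic of its last vertex.\<close>

lemma geo_prefix:
  assumes "j \<in> sites T" "i \<in> set (geo j)"
  shows "\<exists>q. geo j = geo i @ q"
proof -
  from assms(2) obtain ys zs where eq: "geo j = ys @ i # zs"
    by (auto dest: split_list)
  have "simple_path T (root T) (ys @ [i]) i"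
    using geo_path[OF assms(1)] unfolding simple_path_def eq
    by (auto simp: successively_append_iff hd_append split: if_splits)
  then show ?thesis
    using geo_eqI eq by fastforce
qed

text \<open>A neighbour outside the geodesic extends it. The two ends cannot lie on each other's
  geodesics: the two lists would be prefixes of one another, hence equal, with different last
  elements.\<close>

lemma geo_adj:
  assumes "adj T i k"
  shows "geo k = geo i @ [k] \<or> geo i = geo k @ [i]"
proof -
  have s: "i \<in> sites T" "k \<in> sites T" "i \<noteq> k" "adj T k i"
    using assms adj_site adj_neq adj_sym by blast+
  have ext: "geo b = geo a @ [b]" if "adj T a b" "b \<notin> set (geo a)" for a b
  proof (rule geo_eqI)
    have "a \<in> sites T" "b \<in> sites T" using that adj_site by blast+
    then show "simple_path T (root T) (geo a @ [b]) b"
      using geo_path[of a] that unfolding simple_path_def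
      by (auto simp: successively_append_iff)
  qed
  show ?thesis
  proof (cases "k \<in> set (geo i)")
    case True
    have "i \<notin> set (geo k)"
    proof
      assume "i \<in> set (geo k)"
      from geo_prefix[OF s(2) this] geo_prefix[OF s(1) True] obtain q q' where
        q: "geo k = geo i @ q" "geo i = geo k @ q'" by blast
      then have "geo i = geo k" by simp
      moreover have "last (geo i) = i" "last (geo k) = k"
        using geo_path s by (auto simp: simple_path_def)
      ultimately show False using s(3) by simp
    qed
    then show ?thesis using ext s(4) by blast
  next
    case False
    then show ?thesis using ext assms by blast
  qed
qed

lemma level_root [simp]: "level T (root T) = 0"
  by (simp add: level_def)

lemma geo_nonempty: "i \<in> sites T \<Longrightarrow> geo i \<noteq> []"
  using geo_path by (auto simp: simple_path_def)

lemma length_geo: "i \<in> sites T \<Longrightarrow> length (geo i) = Suc (level T i)"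
  using geo_nonempty by (simp add: level_def)

lemma ex_parent:
  assumes "i \<in> sites T" "i \<noteq> root T"
  shows "\<exists>j. adj T i j \<and> geo i = geo j @ [i]"
proof -
  note p = geo_path[OF assms(1), unfolded simple_path_def]
  obtain q where q: "geo i = q @ [i]"
    using p by (metis append_butlast_last_id)
  have "q \<noteq> []" using p q assms(2) by auto
  then have qs: "simple_path T (root T) q (last q)"
    using p unfolding q simple_path_def by (auto simp: successively_append_iff)
  have "adj T (last q) i"
    using p \<open>q \<noteq> []\<close> unfolding q by (auto simp: successively_append_iff)
  then show ?thesis
    using geo_eqI[OF qs] q adj_sym by metis
qed

text \<open>Justifies the definite description in \<open>parent\<close>: by \<open>geo_adj\<close> a
  neighbour of smaller level must precede \<open>i\<close> on its geodesic, which determines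
  it.\<close>

lemma parent_props:
  assumes "i \<in> sites T" "i \<noteq> root T"
  shows adj_parent: "adj T i (parent T i)" and geo_parent: "geo i = geo (parent T i) @ [i]"
proof -
  obtain j where j: "adj T i j" "geo i = geo j @ [i]"
    using ex_parent[OF assms] by blast
  have js: "j \<in> sites T" using j adj_site by blast
  have "parent T i = j"
    unfolding parent_def
  proof (rule the_equality)
    show "adj T i j \<and> level T j < level T i"
      using j length_geo[OF js] length_geo[OF assms(1)] by simp
  next
    fix k assume k: "adj T i k \<and> level T k < level T i"
    then have ks: "k \<in> sites T" using adj_site by blast
    from geo_adj[of i k] k have "geo k = geo i @ [k] \<or> geo i = geo k @ [i]" by blast
    then have "geo i = geo k @ [i]"
      using k length_geo[OF ks] length_geo[OF assms(1)] by (auto dest: arg_cong[of _ _ length])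
    then have "geo k = geo j" using j by simp
    then show "k = j" using geo_path[OF ks] geo_path[OF js] by (auto simp: simple_path_def)
  qed
  with j show "adj T i (parent T i)" "geo i = geo (parent T i) @ [i]" by auto
qed

lemma parent_site: "i \<in> sites T \<Longrightarrow> i \<noteq> root T \<Longrightarrow> parent T i \<in> sites T"
  using adj_parent adj_site by blast

lemma level_parent: "i \<in> sites T \<Longrightarrow> i \<noteq> root T \<Longrightarrow> level T i = Suc (level T (parent T i))"
  using geo_parent[of i] length_geo[of i] length_geo[OF parent_site, of i] by simp

lemma level_eq_0_iff: "i \<in> sites T \<Longrightarrow> level T i = 0 \<longleftrightarrow> i = root T"
  using level_parent by fastforce

lemma parent_neq: "i \<in> sites T \<Longrightarrow> i \<noteq> root T \<Longrightarrow> parent T i \<noteq> i"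
  using level_parent by fastforce

lemma succs_iff: "j \<in> succs T i \<longleftrightarrow> j \<in> sites T \<and> j \<noteq> root T \<and> parent T j = i"
  by (simp add: succs_def)

lemma succs_site: "j \<in> succs T i \<Longrightarrow> j \<in> sites T" "j \<in> succs T i \<Longrightarrow> i \<in> sites T"
  using parent_site by (auto simp: succs_iff)

lemma level_succs: "j \<in> succs T i \<Longrightarrow> level T j = Suc (level T i)"
  using level_parent by (auto simp: succs_iff)

lemma finite_succs: "finite (succs T i)"
proof (cases "i \<in> sites T")
  case True
  have "succs T i \<subseteq> {j. adj T i j}"
    using adj_parent adj_sym by (auto simp: succs_iff)
  then show ?thesis using finite_adj[OF True] finite_subset by blast
next
  case False
  then have "succs T i = {}" using parent_site by (auto simp: succs_iff)
  then show ?thesis by simp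
qed

section \<open>Levels, subtrees and ancestors\<close>

definition lev :: "nat \<Rightarrow> 'v set" where
  "lev n = {i \<in> sites T. level T i = n}"

lemma lev_0 [simp]: "lev 0 = {root T}"
  using level_eq_0_iff by (auto simp: lev_def)

lemma lev_Suc: "lev (Suc n) = (\<Union>i\<in>lev n. succs T i)"
proof (intro set_eqI iffI)
  fix j assume j: "j \<in> lev (Suc n)"
  then have "j \<noteq> root T" by (auto simp: lev_def)
  then show "j \<in> (\<Union>i\<in>lev n. succs T i)"
    using j level_parent[of j] parent_site[of j] by (auto simp: lev_def succs_iff)
qed (auto simp: lev_def dest: succs_site level_succs)

lemma finite_lev: "finite (lev n)"
  by (induction n) (auto simp: lev_Suc finite_succs)

lemma sum_lev_Suc: "(\<Sum>j\<in>lev (Suc n). f j) = (\<Sum>i\<in>lev n. \<Sum>j\<in>succs T i. f j)"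
  unfolding lev_Suc
  by (rule sum.UNION_disjoint) (auto simp: finite_lev finite_succs succs_iff)

text \<open>Replaces membership in a geodesic by a recursion along parents, the form in which
  subtrees are treated by \<open>site_induct\<close>.\<close>

lemma subtree_iff:
  "j \<in> subtree T i \<longleftrightarrow> j \<in> sites T \<and> (j = i \<or> (j \<noteq> root T \<and> parent T j \<in> subtree T i))"
proof (cases "j \<in> sites T \<and> j \<noteq> root T")
  case True
  then show ?thesis
    using geo_parent[of j] parent_site[of j] by (auto simp: subtree_def)
next
  case False
  then show ?thesis by (auto simp: subtree_def)
qed

lemma subtree_site: "j \<in> subtree T i \<Longrightarrow> j \<in> sites T"
  by (simp add: subtree_def)

lemma subtree_refl: "i \<in> sites T \<Longrightarrow> i \<in> subtree T i"
  by (subst subtree_iff) simp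

lemma subtree_root: "subtree T (root T) = sites T"
proof -
  have "hd (geo j) = root T" "geo j \<noteq> []" if "j \<in> sites T" for j
    using geo_path[OF that] by (auto simp: simple_path_def)
  then have "root T \<in> set (geo j)" if "j \<in> sites T" for j
    using hd_in_set that by metis
  then show ?thesis by (auto simp: subtree_def)
qed

lemma site_induct [consumes 1, case_names root step]:
  assumes "i \<in> sites T" "P (root T)"
    "\<And>i. i \<in> sites T \<Longrightarrow> i \<noteq> root T \<Longrightarrow> P (parent T i) \<Longrightarrow> P i"
  shows "P i"
  using assms(1)
proof (induction "level T i" arbitrary: i rule: less_induct)
  case less
  show ?case
    using less assms(2,3) level_parent[of i] parent_site[of i] by (cases "i = root T") auto
qed

lemma subtree_level: "j \<in> subtree T i \<Longrightarrow> level T i \<le> level T j"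
proof -
  assume j: "j \<in> subtree T i"
  have "j \<in> sites T" using j by (rule subtree_site)
  then show ?thesis using j
  proof (induction j rule: site_induct)
    case root
    then show ?case by (auto simp: subtree_def)
  next
    case (step j)
    then show ?case using level_parent[of j] by (subst (asm) subtree_iff) auto
  qed
qed

lemma subtree_level_eq: "j \<in> subtree T i \<Longrightarrow> level T i = level T j \<Longrightarrow> j = i"
  using subtree_level[of "parent T j" i] level_parent[of j] by (subst (asm) subtree_iff) auto

lemma subtree_trans: "k \<in> subtree T j \<Longrightarrow> j \<in> subtree T i \<Longrightarrow> k \<in> subtree T i"
proof -
  assume a: "k \<in> subtree T j" "j \<in> subtree T i"
  have "k \<in> sites T" using a by (auto dest: subtree_site)
  then show ?thesis using a
  proof (induction k rule: site_induct)
    case root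
    then show ?case by (auto simp: subtree_def)
  next
    case (step k)
    then show ?case by (metis subtree_iff)
  qed
qed

lemma ex_ancestor:
  assumes "j \<in> sites T" "n \<le> level T j"
  shows "\<exists>i\<in>lev n. j \<in> subtree T i"
  using assms
proof (induction j rule: site_induct)
  case root
  then have "n = 0" by simp
  then show ?case by (simp add: subtree_root)
next
  case (step j)
  show ?case
  proof (cases "n = level T j")
    case True
    then show ?thesis using step subtree_refl by (auto simp: lev_def)
  next
    case False
    then have "n \<le> level T (parent T j)" using step level_parent[of j] by auto
    with step show ?thesis by (metis subtree_iff)
  qed
qed

lemma ancestor_unique:
  assumes "j \<in> subtree T i" "j \<in> subtree T i'" "level T i = level T i'"
  shows "i = i'"
proof -
  have "j \<in> sites T" using assms by (auto dest: subtree_site)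
  then show ?thesis using assms
  proof (induction j rule: site_induct)
    case root
    then show ?case by (auto simp: subtree_def)
  next
    case (step j)
    show ?case
    proof (cases "j = i \<or> j = i'")
      case True
      then show ?thesis using step subtree_level_eq by metis
    next
      case False
      then show ?thesis using step by (metis subtree_iff)
    qed
  qed
qed

section \<open>Rays and cylinders\<close>

lemma boundary_site: "\<xi> \<in> boundary T \<Longrightarrow> \<xi> n \<in> sites T"
  by (cases n) (auto simp: boundary_def dest: succs_site)

lemma boundary_succ: "\<xi> \<in> boundary T \<Longrightarrow> \<xi> (Suc n) \<in> succs T (\<xi> n)"
  by (simp add: boundary_def)

lemma boundary_0: "\<xi> \<in> boundary T \<Longrightarrow> \<xi> 0 = root T"
  by (simp add: boundary_def)

lemma boundary_level: "\<xi> \<in> boundary T \<Longrightarrow> level T (\<xi> n) = n"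
  by (induction n) (simp_all add: boundary_0 level_succs[OF boundary_succ])

lemma boundary_parent: "\<xi> \<in> boundary T \<Longrightarrow> parent T (\<xi> (Suc n)) = \<xi> n"
  using boundary_succ by (auto simp: succs_iff)

lemma boundary_lev: "\<xi> \<in> boundary T \<Longrightarrow> \<xi> n \<in> lev n"
  by (simp add: lev_def boundary_site boundary_level)

lemma boundary_Suc_neq_root: "\<xi> \<in> boundary T \<Longrightarrow> \<xi> (Suc n) \<noteq> root T"
  using boundary_succ by (auto simp: succs_iff)

lemma boundary_eq_below:
  assumes "\<xi> \<in> boundary T" "\<eta> \<in> boundary T" "\<xi> n = \<eta> n" "m \<le> n"
  shows "\<xi> m = \<eta> m"
  using assms(3,4)
proof (induction n)
  case (Suc n)
  have "\<xi> n = \<eta> n" using Suc boundary_parent[OF assms(1), of n] boundary_parent[OF assms(2), of n] by metis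
  then show ?case using Suc by (cases "m = Suc n") auto
qed simp

lemma cyl_iff: "\<xi> \<in> cyl T i \<longleftrightarrow> \<xi> \<in> boundary T \<and> \<xi> (level T i) = i"
  by (simp add: cyl_def)

lemma mem_cyl_boundary: "\<xi> \<in> boundary T \<Longrightarrow> \<eta> \<in> cyl T (\<xi> n) \<longleftrightarrow> \<eta> \<in> boundary T \<and> \<eta> n = \<xi> n"
  by (simp add: cyl_def boundary_level)

lemma mem_cyl_lev: "i \<in> lev n \<Longrightarrow> \<eta> \<in> cyl T i \<longleftrightarrow> \<eta> \<in> boundary T \<and> \<eta> n = i"
  by (auto simp: cyl_def lev_def)

lemma cyl_root [simp]: "cyl T (root T) = boundary T"
  by (auto simp: cyl_def boundary_0)

lemma cyl_subset: "cyl T i \<subseteq> boundary T"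
  by (auto simp: cyl_def)

lemma cyl_succs: "i \<in> sites T \<Longrightarrow> cyl T i = (\<Union>j\<in>succs T i. cyl T j)"
proof (intro set_eqI iffI)
  fix \<xi> assume i: "i \<in> sites T" and "\<xi> \<in> cyl T i"
  then have x: "\<xi> \<in> boundary T" "\<xi> (level T i) = i" by (auto simp: cyl_iff)
  then have "\<xi> (Suc (level T i)) \<in> succs T i" using boundary_succ by metis
  moreover have "\<xi> \<in> cyl T (\<xi> (Suc (level T i)))"
    using x by (simp add: mem_cyl_boundary)
  ultimately show "\<xi> \<in> (\<Union>j\<in>succs T i. cyl T j)" by blast
next
  fix \<xi> assume "\<xi> \<in> (\<Union>j\<in>succs T i. cyl T j)"
  then obtain j where j: "j \<in> succs T i" "\<xi> \<in> cyl T j" by blast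
  then show "\<xi> \<in> cyl T i"
    using boundary_parent[of \<xi> "level T i"] level_succs[of j i] by (auto simp: cyl_iff succs_iff)
qed

lemma disjoint_cyl: "disjoint_family_on (cyl T) (lev n)"
  by (auto simp: disjoint_family_on_def mem_cyl_lev)

lemma boundary_subtree:
  assumes "\<xi> \<in> boundary T" "m \<le> n"
  shows "\<xi> n \<in> subtree T (\<xi> m)"
  using assms(2)
proof (induction n rule: dec_induct)
  case base
  show ?case using subtree_refl boundary_site[OF assms(1)] by blast
next
  case (step n)
  then show ?case
    using boundary_parent[OF assms(1)] boundary_site[OF assms(1)] boundary_Suc_neq_root[OF assms(1)]
    by (subst subtree_iff) auto
qed

text \<open>As balls in an ultrametric space, two cylinders are nested or disjoint: a common ray
  passes through both sites, so the deeper one is a descendant of the other.\<close>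

lemma cyl_inter:
  assumes "i \<in> sites T" "j \<in> sites T"
  shows "cyl T i \<inter> cyl T j = (if j \<in> subtree T i then cyl T j else if i \<in> subtree T j then cyl T i else {})"
proof -
  have cs: "cyl T b \<subseteq> cyl T a" if "b \<in> subtree T a" "a \<in> sites T" for a b
  proof
    fix \<xi> assume "\<xi> \<in> cyl T b"
    then have x: "\<xi> \<in> boundary T" "\<xi> (level T b) = b" by (auto simp: cyl_iff)
    have "b \<in> subtree T (\<xi> (level T a))"
      using boundary_subtree[OF x(1) subtree_level[OF that(1)]] x by simp
    then have "\<xi> (level T a) = a"
      using ancestor_unique[OF _ that(1)] boundary_level[OF x(1)] by simp
    then show "\<xi> \<in> cyl T a" using x by (simp add: cyl_iff)
  qed
  have ex: "j \<in> subtree T i \<or> i \<in> subtree T j" if "\<xi> \<in> cyl T i" "\<xi> \<in> cyl T j" for \<xi>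
    using that boundary_subtree[of \<xi> "level T i" "level T j"] boundary_subtree[of \<xi> "level T j" "level T i"]
    by (cases "level T i \<le> level T j") (auto simp: cyl_iff)
  show ?thesis
    using cs[of j i] cs[of i j] ex assms by auto
qed

text \<open>Every site has a successor, so a ray through the parent can be cut at the parent's level
  and continued through \<open>i\<close> by choices.\<close>

lemma ex_boundary: "i \<in> sites T \<Longrightarrow> cyl T i \<noteq> {}"
proof -
  have ext: "\<exists>\<xi>\<in>boundary T. \<xi> (level T i) = i" if "i \<in> sites T" for i
    using that
  proof (induction i rule: site_induct)
    case root
    define f where "f n = rec_nat (root T) (\<lambda>_ i. SOME j. j \<in> succs T i) n" for n
    have "f n \<in> sites T \<and> f (Suc n) \<in> succs T (f n)" for n
    proof (induction n)
      case 0
      then show ?case using succs_nonempty[of "root T"] by (auto simp: f_def some_in_eq)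
    next
      case (Suc n)
      then have "f (Suc n) \<in> sites T" using succs_site by blast
      then show ?case using succs_nonempty[of "f (Suc n)"] by (auto simp: f_def some_in_eq)
    qed
    then have "f \<in> boundary T" by (auto simp: boundary_def f_def)
    then show ?case by (auto simp: boundary_0)
  next
    case (step i)
    then obtain \<xi> where x: "\<xi> \<in> boundary T" "\<xi> (level T (parent T i)) = parent T i" by blast
    define l where "l = level T (parent T i)"
    define f where "f n = rec_nat i (\<lambda>_ i. SOME j. j \<in> succs T i) n" for n
    have f: "f n \<in> sites T \<and> f (Suc n) \<in> succs T (f n)" for n
    proof (induction n)
      case 0
      then show ?case using succs_nonempty[of i] step by (auto simp: f_def some_in_eq)
    next
      case (Suc n)
      then have "f (Suc n) \<in> sites T" using succs_site by blast
      then show ?case using succs_nonempty[of "f (Suc n)"] by (auto simp: f_def some_in_eq)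
    qed
    have "f 0 = i" by (simp add: f_def)
    have i: "i \<in> succs T (\<xi> l)" using step x by (simp add: succs_iff l_def)
    \<comment> \<open>\<open>Suc l\<close> is the level of \<open>i = f 0\<close>, so the
      continuation is read with this shift.\<close>
    define \<eta> where "\<eta> n = (if n \<le> l then \<xi> n else f (n - Suc l))" for n
    have "\<eta> (Suc n) \<in> succs T (\<eta> n)" for n
    proof -
      consider "n < l" | "n = l" | "n > l" by linarith
      then show ?thesis
      proof cases
        case 3
        then obtain k where "n = Suc l + k" using less_iff_Suc_add by auto
        then show ?thesis using f[of k] by (simp add: \<eta>_def)
      qed (use x i \<open>f 0 = i\<close> boundary_succ in \<open>auto simp: \<eta>_def\<close>)
    qed
    then have "\<eta> \<in> boundary T" using x by (auto simp: boundary_def \<eta>_def)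
    moreover have "\<eta> (level T i) = i"
      using step level_parent[of i] \<open>f 0 = i\<close> by (simp add: \<eta>_def l_def)
    ultimately show ?case by blast
  qed
  assume "i \<in> sites T"
  from ext[OF this] show ?thesis by (auto simp: cyl_iff)
qed

end

section \<open>The jump matrix and the absorption probability\<close>

locale weighted_tree = rooted_tree T for T :: "'v rtree" +
  fixes w :: "nat \<Rightarrow> real"
  assumes w_mono: "strict_mono w" and w_pos: "\<forall>n. 0 < w n"
begin

lemma delta_pos: "0 < delta w n"
  using w_pos strict_monoD[OF w_mono, of "n - 1" n] by (auto simp: delta_def)

text \<open>Conductance of the edge above \<open>i\<close>; \<open>delta w n\<close> is the
  resistance of an edge between the levels \<open>n - 1\<close> and \<open>n\<close>. For the root
  it belongs to the edge towards \<open>Absorbed\<close>.\<close>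

definition cond :: "'v \<Rightarrow> real" where
  "cond i = 1 / delta w (level T i)"

text \<open>Total conductance at \<open>i\<close>, the edge above included: the reversible measure
  of the jump chain on the sites.\<close>

definition rate :: "'v \<Rightarrow> real" where
  "rate i = cond i + (\<Sum>j\<in>succs T i. cond j)"

lemma cond_pos: "0 < cond i"
  by (simp add: cond_def delta_pos)

lemma cond_root: "cond (root T) = 1 / w 0"
  by (simp add: cond_def delta_def)

lemma rate_pos: "0 < rate i"
  unfolding rate_def by (intro add_pos_nonneg cond_pos sum_nonneg) (simp add: less_imp_le[OF cond_pos])

lemma rate_eq: "Qmat T w i i = - rate i"
  by (simp add: Qmat_def rate_def cond_def level_succs)

text \<open>The absorbing state is treated as the parent of the root: by \<open>cond_root\<close> its rate is the
  conductance of the missing edge above the root.\<close>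

definition up :: "'v \<Rightarrow> 'v state" where
  "up i = (if i = root T then Absorbed else Site (parent T i))"

definition states :: "'v state set" where
  "states = insert Absorbed (Site ` sites T)"

abbreviation jp :: "'v state \<Rightarrow> 'v state \<Rightarrow> real" where
  "jp \<equiv> jump_prob (Qext T w)"

text \<open>Every row of the jump matrix is supported in the finite set \<open>post\<close>, every
  column in the finite set \<open>pre\<close>, so the sums over the countable state space below are
  finite sums.\<close>

definition post :: "'v state \<Rightarrow> 'v state set" where
  "post x = (case x of Site i \<Rightarrow> insert (up i) (Site ` succs T i) | _ \<Rightarrow> {x})"

definition pre :: "'v state \<Rightarrow> 'v state set" where
  "pre x = (case x of Site i \<Rightarrow> post (Site i) - {Absorbed} | _ \<Rightarrow> {x, Site (root T)})"

lemma countable_states: "countable states"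
  by (simp add: states_def countable_sites)

lemma finite_post: "finite (post x)" and finite_pre: "finite (pre x)"
  by (auto simp: post_def pre_def finite_succs split: state.split)

lemma up_states: "i \<in> sites T \<Longrightarrow> up i \<in> states"
  by (auto simp: up_def states_def parent_site)

lemma post_states: "x \<in> states \<Longrightarrow> post x \<subseteq> states"
  using up_states by (fastforce simp: post_def states_def dest: succs_site)

lemma up_notin: "up i \<notin> Site ` succs T i" if "i \<in> sites T"
proof
  assume "up i \<in> Site ` succs T i"
  then have r: "i \<noteq> root T" and p: "parent T i \<in> succs T i"
    by (auto simp: up_def split: if_splits)
  from level_succs[OF p] level_parent[OF that r] show False by simp
qed

lemma sum_post_Site:
  assumes "i \<in> sites T"
  shows "(\<Sum>y\<in>post (Site i). f y) = f (up i) + (\<Sum>j\<in>succs T i. f (Site j))"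
  unfolding post_def using up_notin[OF assms]
  by (simp add: finite_succs sum.reindex inj_on_def)

lemma jp_Absorbed: "jp Absorbed y = of_bool (y = Absorbed)"
  by (auto simp: jump_prob_def)

lemma jp_Site: "jp (Site i) y = (if y = Site i then 0 else Qext T w (Site i) y / rate i)"
  using rate_pos[of i] rate_eq[of i] by (auto simp: jump_prob_def)

lemma jp_up:
  assumes "i \<in> sites T"
  shows "jp (Site i) (up i) = cond i / rate i"
proof (cases "i = root T")
  case False
  then have "Qmat T w i (parent T i) = cond i"
    using parent_neq[OF assms] unfolding Qmat_def cond_def by metis
  then show ?thesis using False parent_neq[OF assms] by (simp add: jp_Site up_def)
qed (simp add: jp_Site up_def cond_root)

lemma jp_succs: "j \<in> succs T i \<Longrightarrow> jp (Site i) (Site j) = cond j / rate i"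
proof -
  assume j: "j \<in> succs T i"
  then have s: "i \<in> sites T" "j \<in> sites T" "j \<noteq> root T" "parent T j = i" "i \<noteq> j"
    using succs_site[OF j] level_succs[OF j] by (auto simp: succs_iff)
  have "\<not> (i \<noteq> root T \<and> j = parent T i)"
    using level_succs[OF j] level_parent[OF s(1)] by (metis n_not_Suc_n Suc_n_not_le_n le_Suc_eq le_refl)
  then have "Qmat T w i j = cond j"
    unfolding Qmat_def cond_def using s(3-5) by metis
  then show ?thesis using s(5) by (simp add: jp_Site)
qed

lemma jp_nonneg: "x \<in> states \<Longrightarrow> y \<in> post x \<Longrightarrow> 0 \<le> jp x y"
  using cond_pos rate_pos
  by (auto simp: states_def post_def jp_Absorbed jp_up jp_succs less_imp_le)

lemma jp_zero: "x \<in> states \<Longrightarrow> y \<in> states \<Longrightarrow> y \<notin> post x \<Longrightarrow> jp x y = 0"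
proof -
  assume x: "x \<in> states" and ys: "y \<in> states" and y: "y \<notin> post x"
  show ?thesis
  proof (cases x)
    case (Site i)
    then have i: "i \<in> sites T" using x by (auto simp: states_def)
    show ?thesis
    proof (cases y)
      case j: (Site j)
      have "Qmat T w i j = 0" if "i \<noteq> j"
        using y ys Site j i that
        by (auto simp: Qmat_def post_def up_def succs_iff states_def split: if_splits)
      then show ?thesis using Site j by (auto simp: jp_Site)
    next
      case Absorbed
      then show ?thesis using Site y by (auto simp: jp_Site post_def up_def split: if_splits)
    qed (auto simp: Site jp_Site)
  next
    case Absorbed
    then show ?thesis using y by (auto simp: jp_Absorbed post_def)
  next
    case Cemetery
    then show ?thesis using x by (auto simp: states_def)
  qed
qed

lemma pre_post: "x \<in> states \<Longrightarrow> y \<in> states \<Longrightarrow> y \<in> post x \<Longrightarrow> x \<in> pre y"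
  by (auto simp: states_def post_def pre_def up_def succs_iff split: if_splits)

lemma pre_states: "y \<in> states \<Longrightarrow> pre y \<subseteq> states"
  using post_states[of y] by (auto simp: pre_def states_def split: state.splits)

lemma sum_jp: "x \<in> states \<Longrightarrow> (\<Sum>y\<in>post x. jp x y) = 1"
proof -
  assume "x \<in> states"
  then consider i where "x = Site i" "i \<in> sites T" | "x = Absorbed" by (auto simp: states_def)
  then show ?thesis
  proof cases
    case 1
    then have "(\<Sum>y\<in>post x. jp x y) = cond i / rate i + (\<Sum>j\<in>succs T i. cond j / rate i)"
      by (simp add: sum_post_Site jp_up jp_succs)
    also have "\<dots> = rate i / rate i"
      unfolding sum_divide_distrib[symmetric] add_divide_distrib[symmetric] by (simp only: rate_def)
    finally show ?thesis using rate_pos[of i] by simp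
  qed (simp add: post_def jp_Absorbed)
qed

section \<open>Multi-step transition probabilities, absorption probability and expected numbers of
  visits\<close>

fun Pn :: "nat \<Rightarrow> 'v state \<Rightarrow> 'v state \<Rightarrow> real" where
  "Pn 0 x z = of_bool (x = z)"
| "Pn (Suc n) x z = (\<Sum>y\<in>post x. jp x y * Pn n y z)"

lemma Pn_nonneg: "x \<in> states \<Longrightarrow> 0 \<le> Pn n x z"
proof (induction n arbitrary: x)
  case (Suc n)
  then show ?case using post_states[of x] by (auto intro!: sum_nonneg mult_nonneg_nonneg jp_nonneg)
qed simp

lemma Pn_le_1: "x \<in> states \<Longrightarrow> Pn n x z \<le> 1"
proof (induction n arbitrary: x)
  case (Suc n)
  have "Pn (Suc n) x z \<le> (\<Sum>y\<in>post x. jp x y * 1)"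
    unfolding Pn.simps using Suc post_states[of x]
    by (intro sum_mono mult_left_mono jp_nonneg) auto
  then show ?case using sum_jp[OF Suc.prems] by simp
qed simp

text \<open>\<open>Pn\<close> is defined by its first step; this is the decomposition by the last
  step. The two are matched in \<open>Pn_reversible\<close>, and the last step is what
  \<open>markov\<close> provides in \<open>prob_Y\<close>.\<close>

lemma Pn_forward:
  assumes "x \<in> states" "z \<in> states"
  shows "Pn (Suc n) x z = (\<Sum>u\<in>pre z. Pn n x u * jp u z)"
  using assms(1)
proof (induction n arbitrary: x)
  case 0
  have "Pn (Suc 0) x z = jp x z"
    using jp_zero[OF 0 assms(2)] by (simp add: of_bool_def finite_post if_distrib cong: if_cong)
  also have "\<dots> = (\<Sum>u\<in>pre z. Pn 0 x u * jp u z)"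
    using jp_zero[OF 0 assms(2)] pre_post[OF 0 assms(2)]
    by (auto simp: of_bool_def finite_pre if_distrib if_distribR cong: if_cong)
  finally show ?case .
next
  case (Suc n)
  have "Pn (Suc (Suc n)) x z = (\<Sum>y\<in>post x. jp x y * Pn (Suc n) y z)" by simp
  also have "\<dots> = (\<Sum>y\<in>post x. jp x y * (\<Sum>u\<in>pre z. Pn n y u * jp u z))"
    using Suc.IH post_states[OF Suc.prems] by (intro sum.cong) auto
  also have "\<dots> = (\<Sum>u\<in>pre z. (\<Sum>y\<in>post x. jp x y * Pn n y u) * jp u z)"
    by (simp add: sum_distrib_left sum_distrib_right mult.assoc) (rule sum.swap)
  finally show ?case by simp
qed

lemma Pn_Absorbed_Site: "Pn n Absorbed (Site j) = 0"
  by (induction n) (auto simp: post_def)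

text \<open>Detailed balance: across an edge both sides equal its conductance, elsewhere both
  vanish.\<close>

lemma jp_sym: "i \<in> sites T \<Longrightarrow> k \<in> sites T \<Longrightarrow> rate i * jp (Site i) (Site k) = rate k * jp (Site k) (Site i)"
proof -
  assume s: "i \<in> sites T" "k \<in> sites T"
  have *: "rate a * jp (Site a) (Site b) = rate b * jp (Site b) (Site a)" if "b \<in> succs T a" for a b
  proof -
    have "up b = Site a" "b \<in> sites T" using that by (auto simp: up_def succs_iff)
    then show ?thesis
      using that jp_up[of b] jp_succs[OF that] rate_pos[of a] rate_pos[of b] by simp
  qed
  consider "k \<in> succs T i" | "i \<in> succs T k" | "k \<notin> succs T i" "i \<notin> succs T k" by blast
  then show ?thesis
  proof cases
    case 3
    then have "Site k \<notin> post (Site i)" "Site i \<notin> post (Site k)"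
      using s by (auto simp: post_def up_def succs_iff split: if_splits)
    then show ?thesis using jp_zero s by (simp add: states_def)
  qed (use * in auto)
qed

text \<open>Detailed balance is applied one step at a time: the first step of a path from
  \<open>i\<close> becomes the last step of the reversed path from \<open>j\<close>.\<close>

lemma Pn_reversible:
  "i \<in> sites T \<Longrightarrow> j \<in> sites T \<Longrightarrow> rate i * Pn n (Site i) (Site j) = rate j * Pn n (Site j) (Site i)"
proof (induction n arbitrary: i)
  case (Suc n)
  have st: "Site i \<in> states" "Site j \<in> states" using Suc.prems by (auto simp: states_def)
  have pre: "pre (Site i) = post (Site i) - {Absorbed}" by (simp add: pre_def)
  \<comment> \<open>The absorbing state drops out because no path returns from it to a site.\<close>
  have "rate i * Pn (Suc n) (Site i) (Site j)
      = (\<Sum>y\<in>pre (Site i). rate i * (jp (Site i) y * Pn n y (Site j)))"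
    unfolding pre by (simp add: sum_distrib_left)
      (rule sum.mono_neutral_right, auto simp: finite_post Pn_Absorbed_Site)
  also have "\<dots> = (\<Sum>y\<in>pre (Site i). rate j * (Pn n (Site j) y * jp y (Site i)))"
  proof (rule sum.cong)
    fix y assume y: "y \<in> pre (Site i)"
    then obtain k where k: "y = Site k" "k \<in> sites T"
      using pre_states[OF st(1)] by (auto simp: pre_def states_def)
    have "rate i * (jp (Site i) y * Pn n y (Site j)) = jp y (Site i) * (rate k * Pn n y (Site j))"
      using jp_sym[OF Suc.prems(1) k(2)] k by (simp add: algebra_simps)
    also have "\<dots> = jp y (Site i) * (rate j * Pn n (Site j) y)"
      using Suc.IH[OF k(2) Suc.prems(2)] k by simp
    finally show "rate i * (jp (Site i) y * Pn n y (Site j)) = rate j * (Pn n (Site j) y * jp y (Site i))"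
      by (simp add: algebra_simps)
  qed simp
  also have "\<dots> = rate j * Pn (Suc n) (Site j) (Site i)"
    by (simp only: Pn_forward[OF st(2) st(1)] sum_distrib_left)
  finally show ?case .
qed simp

text \<open>\<open>Absorbed\<close> is entered only from the root and is never left.\<close>

lemma Pn_Absorbed_Suc:
  "x \<in> states \<Longrightarrow> Pn (Suc n) x Absorbed = Pn n x Absorbed + Pn n x (Site (root T)) * (cond (root T) / rate (root T))"
proof -
  assume x: "x \<in> states"
  have "Absorbed \<in> states" by (simp add: states_def)
  from Pn_forward[OF x this] show ?thesis
    using jp_up[of "root T"] by (simp add: pre_def jp_Absorbed up_def)
qed

lemma incseq_Pn_Absorbed: "x \<in> states \<Longrightarrow> incseq (\<lambda>n. Pn n x Absorbed)"
  unfolding incseq_Suc_iff Pn_Absorbed_Suc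
  using Pn_nonneg cond_pos rate_pos by (simp add: less_imp_le)

text \<open>The absorption probability, defined as an increasing limit of matrix entries;
  \<open>prob_absorbed\<close> gives its probabilistic meaning.\<close>

definition habs :: "'v state \<Rightarrow> real" where
  "habs x = lim (\<lambda>n. Pn n x Absorbed)"

lemma Pn_Absorbed_tendsto: "x \<in> states \<Longrightarrow> (\<lambda>n. Pn n x Absorbed) \<longlonglongrightarrow> habs x"
proof -
  assume x: "x \<in> states"
  obtain L where "(\<lambda>n. Pn n x Absorbed) \<longlonglongrightarrow> L"
    using incseq_convergent[OF incseq_Pn_Absorbed[OF x], of 1] Pn_le_1[OF x] by metis
  then show ?thesis unfolding habs_def by (simp add: limI)
qed

lemma Pn_Absorbed_le_habs: "x \<in> states \<Longrightarrow> Pn n x Absorbed \<le> habs x"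
  by (rule incseq_le[OF incseq_Pn_Absorbed Pn_Absorbed_tendsto])

lemma habs_le_1: "x \<in> states \<Longrightarrow> habs x \<le> 1"
  by (rule LIMSEQ_le_const2[OF Pn_Absorbed_tendsto]) (auto intro: Pn_le_1)

lemma habs_nonneg: "x \<in> states \<Longrightarrow> 0 \<le> habs x"
  using Pn_Absorbed_le_habs[of x 0] Pn_nonneg[of x 0 Absorbed] by linarith

lemma habs_Absorbed: "habs Absorbed = 1"
proof -
  have "Pn n Absorbed Absorbed = 1" for n
    by (induction n) (auto simp: post_def jp_Absorbed)
  then show ?thesis by (simp add: habs_def)
qed

lemma habs_harmonic: "x \<in> states \<Longrightarrow> habs x = (\<Sum>y\<in>post x. jp x y * habs y)"
proof (rule LIMSEQ_unique)
  assume x: "x \<in> states"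
  show "(\<lambda>n. Pn (Suc n) x Absorbed) \<longlonglongrightarrow> habs x"
    using Pn_Absorbed_tendsto[OF x] by (rule LIMSEQ_Suc)
  show "(\<lambda>n. Pn (Suc n) x Absorbed) \<longlonglongrightarrow> (\<Sum>y\<in>post x. jp x y * habs y)"
    unfolding Pn.simps using post_states[OF x]
    by (intro tendsto_sum tendsto_mult tendsto_const Pn_Absorbed_tendsto) auto
qed

text \<open>From every site absorption is possible by climbing to the parent at each step.\<close>

lemma habs_pos: "i \<in> sites T \<Longrightarrow> 0 < habs (Site i)"
proof (induction i rule: site_induct)
  have *: "0 < habs (Site i)" if "i \<in> sites T" "0 < habs (up i)" for i
  proof -
    have st: "Site i \<in> states" using that by (auto simp: states_def)
    have "0 < jp (Site i) (up i) * habs (up i)"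
      using jp_up[OF that(1)] that(2) cond_pos[of i] rate_pos[of i] by simp
    also have "\<dots> \<le> (\<Sum>y\<in>post (Site i). jp (Site i) y * habs y)"
    proof (rule member_le_sum)
      show "up i \<in> post (Site i)" by (simp add: post_def)
      show "finite (post (Site i))" by (rule finite_post)
      show "0 \<le> jp (Site i) y * habs y" if "y \<in> post (Site i) - {up i}" for y
        using that post_states[OF st] jp_nonneg[OF st, of y] habs_nonneg[of y] by auto
    qed
    finally show ?thesis using habs_harmonic[OF st] by simp
  qed
  {
    case root
    show ?case by (rule *) (auto simp: up_def habs_Absorbed)
  next
    case (step i)
    then show ?case using *[of i] by (auto simp: up_def)
  }
qed

text \<open>Each visit to the root is followed by absorption with probability \<open>K\<close>, and
  there is no other way to be absorbed, so the absorption probability is \<open>K\<close> times the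
  expected number of visits to the root.\<close>

lemma sums_visits_root:
  assumes "i \<in> sites T"
  shows "(\<lambda>n. Pn n (Site i) (Site (root T))) sums (habs (Site i) * w 0 * rate (root T))"
proof -
  have st: "Site i \<in> states" using assms by (auto simp: states_def)
  define K where "K = cond (root T) / rate (root T)"
  have K: "K \<noteq> 0" using cond_pos[of "root T"] rate_pos[of "root T"] by (simp add: K_def)
  have part: "Pn n (Site i) Absorbed = (\<Sum>k<n. Pn k (Site i) (Site (root T)) * K)" for n
    by (induction n) (simp_all add: Pn_Absorbed_Suc[OF st] K_def del: Pn.simps(2))
  have "(\<lambda>k. Pn k (Site i) (Site (root T)) * K) sums habs (Site i)"
    unfolding sums_def using Pn_Absorbed_tendsto[OF st] by (simp add: part)
  then have "(\<lambda>k. Pn k (Site i) (Site (root T)) * K / K) sums (habs (Site i) / K)"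
    by (rule sums_divide)
  moreover have "habs (Site i) / K = habs (Site i) * w 0 * rate (root T)"
    by (simp add: K_def cond_root)
  ultimately show ?thesis using K by simp
qed

text \<open>Reversibility turns visits to \<open>i\<close> from the root into visits to the root
  from \<open>i\<close>.\<close>

lemma sums_visits:
  assumes "i \<in> sites T"
  shows "(\<lambda>n. Pn n (Site (root T)) (Site i)) sums (rate i * w 0 * habs (Site i))"
proof -
  have "Pn n (Site (root T)) (Site i) = rate i / rate (root T) * Pn n (Site i) (Site (root T))" for n
    using Pn_reversible[OF assms root_site, of n] rate_pos[of "root T"] by (simp add: field_simps)
  then show ?thesis
    using sums_mult[OF sums_visits_root[OF assms], of "rate i / rate (root T)"] rate_pos[of "root T"]
    by (simp add: mult.commute mult.left_commute)
qed

section \<open>Currents through the edges, counted away from the root, and the Dirichlet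
  energy\<close>

definition flow :: "('v state \<Rightarrow> real) \<Rightarrow> 'v \<Rightarrow> real" where
  "flow f i = cond i * (f (up i) - f (Site i))"

lemma sum_post_jp:
  "i \<in> sites T \<Longrightarrow>
    rate i * (\<Sum>y\<in>post (Site i). jp (Site i) y * f y) = cond i * f (up i) + (\<Sum>j\<in>succs T i. cond j * f (Site j))"
  using rate_pos[of i]
  by (simp add: sum_post_Site jp_up jp_succs distrib_left sum_distrib_left)

text \<open>Kirchhoff's law with a source: the current leaving \<open>i\<close> downwards exceeds
  the incoming one by \<open>rate i\<close> times the defect of harmonicity of \<open>f\<close> at
  \<open>i\<close>.\<close>

lemma sum_flow_succs:
  assumes "i \<in> sites T"
  shows "(\<Sum>j\<in>succs T i. flow f j) = flow f i + rate i * (f (Site i) - (\<Sum>y\<in>post (Site i). jp (Site i) y * f y))"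
proof -
  have "(\<Sum>j\<in>succs T i. flow f j) = (\<Sum>j\<in>succs T i. cond j * f (Site i) - cond j * f (Site j))"
    by (rule sum.cong) (auto simp: flow_def up_def succs_iff right_diff_distrib)
  also have "\<dots> = (rate i - cond i) * f (Site i) - (\<Sum>j\<in>succs T i. cond j * f (Site j))"
    by (simp add: rate_def sum_subtractf sum_distrib_right)
  finally show ?thesis
    using sum_post_jp[OF assms, of f] by (simp add: flow_def algebra_simps)
qed

lemma sum_flow_habs: "i \<in> sites T \<Longrightarrow> (\<Sum>j\<in>succs T i. flow habs j) = flow habs i"
  using habs_harmonic[of "Site i"] sum_flow_succs[of i habs] by (simp add: states_def)

text \<open>The boundary term at level \<open>n\<close> in the discrete Green formula
  \<open>energy_eq\<close>.\<close>

definition lev_form :: "('v state \<Rightarrow> real) \<Rightarrow> ('v state \<Rightarrow> real) \<Rightarrow> nat \<Rightarrow> real" where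
  "lev_form f g n = (\<Sum>i\<in>lev n. f (Site i) * flow g i)"

text \<open>The part of the Dirichlet form that belongs to the edges between the levels
  \<open>n\<close> and \<open>n + 1\<close>.\<close>

definition energy :: "('v state \<Rightarrow> real) \<Rightarrow> ('v state \<Rightarrow> real) \<Rightarrow> nat \<Rightarrow> real" where
  "energy f g n = (\<Sum>i\<in>lev n. \<Sum>j\<in>succs T i. cond j * (f (Site i) - f (Site j)) * (g (Site i) - g (Site j)))"

text \<open>Summation by parts over the edges below level \<open>n\<close>.\<close>

lemma energy_eq:
  "energy f g n = (\<Sum>i\<in>lev n. f (Site i) * (\<Sum>j\<in>succs T i. flow g j)) - lev_form f g (Suc n)"
  unfolding energy_def lev_form_def sum_lev_Suc sum_subtractf[symmetric]
  by (intro sum.cong refl)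
     (auto simp: sum_distrib_left sum_subtractf[symmetric] flow_def up_def succs_iff algebra_simps
        intro!: sum.cong)

lemma energy_habs: "energy f habs n = lev_form f habs n - lev_form f habs (Suc n)"
  unfolding energy_eq by (auto simp: lev_form_def lev_def sum_flow_habs intro!: sum.cong)

text \<open>For a nonnegative subharmonic \<open>f\<close> the current below a site is at most the
  current above it, so the identity \<open>energy_habs\<close> of the harmonic case becomes an
  inequality.\<close>

lemma energy_le:
  assumes "\<And>x. x \<in> states \<Longrightarrow> 0 \<le> f x" and "\<And>x. x \<in> states \<Longrightarrow> f x \<le> (\<Sum>y\<in>post x. jp x y * f y)"
  shows "energy f f n \<le> lev_form f f n - lev_form f f (Suc n)"
proof -
  have "f (Site i) * (\<Sum>j\<in>succs T i. flow f j) \<le> f (Site i) * flow f i" if "i \<in> lev n" for i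
  proof (rule mult_left_mono)
    have i: "i \<in> sites T" "Site i \<in> states" using that by (auto simp: lev_def states_def)
    then show "(\<Sum>j\<in>succs T i. flow f j) \<le> flow f i"
      using assms(2)[of "Site i"] rate_pos[of i] sum_flow_succs[OF i(1), of f]
      by (simp add: mult_nonneg_nonpos)
    show "0 \<le> f (Site i)" using i assms by auto
  qed
  then show ?thesis unfolding energy_eq lev_form_def by (simp add: sum_mono)
qed

text \<open>Nonnegativity of the energy of \<open>habs - f\<close>; with \<open>f\<close> the probability of absorption within
  \<open>k\<close> steps, the bound tends to \<open>0\<close> as \<open>k\<close> grows.\<close>

lemma lev_form_habs_le:
  assumes f: "\<And>x. x \<in> states \<Longrightarrow> 0 \<le> f x" "\<And>x. x \<in> states \<Longrightarrow> f x \<le> (\<Sum>y\<in>post x. jp x y * f y)"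
    and zero: "\<And>i. i \<in> lev m \<Longrightarrow> f (Site i) = 0"
  shows "lev_form habs habs m \<le> lev_form habs habs 0 - 2 * lev_form f habs 0 + lev_form f f 0"
proof -
  have tel: "(\<Sum>n<m. F n - F (Suc n)) = F 0 - F m" for F :: "nat \<Rightarrow> real"
    by (induction m) auto
  have z: "lev_form f g m = 0" for g
    by (simp add: lev_form_def zero)
  have "0 \<le> (\<Sum>n<m. energy (\<lambda>x. habs x - f x) (\<lambda>x. habs x - f x) n)"
    unfolding energy_def using cond_pos
    by (intro sum_nonneg) (simp add: mult.assoc less_imp_le)
  also have "\<dots> = (\<Sum>n<m. energy habs habs n - 2 * energy f habs n + energy f f n)"
    unfolding energy_def sum_distrib_left sum_subtractf[symmetric] sum.distrib[symmetric]
    by (intro sum.cong refl) (simp add: algebra_simps)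
  also have "\<dots> = (\<Sum>n<m. energy habs habs n) - 2 * (\<Sum>n<m. energy f habs n) + (\<Sum>n<m. energy f f n)"
    by (simp add: sum.distrib sum_subtractf sum_distrib_left)
  also have "\<dots> \<le> (lev_form habs habs 0 - lev_form habs habs m) - 2 * lev_form f habs 0 + lev_form f f 0"
  proof -
    have "(\<Sum>n<m. energy f f n) \<le> (\<Sum>n<m. lev_form f f n - lev_form f f (Suc n))"
      by (intro sum_mono energy_le f)
    then show ?thesis by (simp add: energy_habs tel z)
  qed
  finally show ?thesis by simp
qed

text \<open>From level \<open>l\<close> the walk needs \<open>l + 1\<close> steps: one for each
  level, and one from the root to \<open>Absorbed\<close>.\<close>

lemma Pn_Absorbed_eq_0: "i \<in> sites T \<Longrightarrow> n \<le> level T i \<Longrightarrow> Pn n (Site i) Absorbed = 0"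
proof (induction n arbitrary: i)
  case (Suc n)
  then have "i \<noteq> root T" by auto
  have "Pn n (up i) Absorbed = 0"
    using Suc \<open>i \<noteq> root T\<close> level_parent[of i] parent_site[of i] by (simp add: up_def)
  moreover have "Pn n (Site j) Absorbed = 0" if "j \<in> succs T i" for j
    using Suc that level_succs[OF that] succs_site[OF that] by simp
  ultimately show ?case
    using Suc.prems by (simp add: sum_post_Site)
qed simp

text \<open>The lower bound comes from the nonnegativity of the flow, a hypothesis here because it
  is derived later from its meaning as a probability. The upper bound is
  \<open>lev_form_habs_le\<close> for absorption within \<open>k\<close> steps, taken with
  \<open>k = m\<close>.\<close>

lemma lev_form_habs_tendsto: "(\<lambda>m. lev_form habs habs m) \<longlonglongrightarrow> 0"
  if nonneg: "\<And>i. i \<in> sites T \<Longrightarrow> 0 \<le> flow habs i"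
proof -
  have r: "Site (root T) \<in> states" by (simp add: states_def)
  let ?h = "habs (Site (root T))"
  define a where "a k = Pn k (Site (root T)) Absorbed" for k
  \<comment> \<open>The bound of \<open>lev_form_habs_le\<close> evaluated at the root, where the
    current comes from \<open>Absorbed\<close> and both functions have the value 1 there.\<close>
  define e where "e k = cond (root T) * (?h * (1 - ?h) - 2 * (a k * (1 - ?h)) + a k * (1 - a k))" for k
  have A1: "Pn k Absorbed Absorbed = 1" for k
    by (induction k) (auto simp: post_def jp_Absorbed)
  have le: "lev_form habs habs m \<le> e k" if "k \<le> m" for k m
  proof -
    have "lev_form habs habs m \<le> lev_form habs habs 0 - 2 * lev_form (\<lambda>x. Pn k x Absorbed) habs 0
        + lev_form (\<lambda>x. Pn k x Absorbed) (\<lambda>x. Pn k x Absorbed) 0"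
    proof (rule lev_form_habs_le)
      fix x assume x: "x \<in> states"
      show "0 \<le> Pn k x Absorbed" using Pn_nonneg[OF x] .
      show "Pn k x Absorbed \<le> (\<Sum>y\<in>post x. jp x y * Pn k y Absorbed)"
        using incseq_SucD[OF incseq_Pn_Absorbed[OF x], of k] by simp
    next
      fix i assume "i \<in> lev m"
      then show "Pn k (Site i) Absorbed = 0" using that by (intro Pn_Absorbed_eq_0) (auto simp: lev_def)
    qed
    also have "\<dots> = e k"
      by (simp add: lev_form_def flow_def up_def habs_Absorbed A1 e_def a_def algebra_simps)
    finally show ?thesis .
  qed
  \<comment> \<open>As \<open>a k\<close> tends to \<open>?h\<close>, the three products become
    equal and their coefficients 1, -2 and 1 cancel.\<close>
  have "e \<longlonglongrightarrow> cond (root T) * (?h * (1 - ?h) - 2 * (?h * (1 - ?h)) + ?h * (1 - ?h))"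
    unfolding e_def a_def by (intro tendsto_intros Pn_Absorbed_tendsto r)
  then have lim: "e \<longlonglongrightarrow> 0" by simp
  show ?thesis
  proof (rule tendsto_sandwich[OF _ _ tendsto_const lim])
    show "\<forall>\<^sub>F m in sequentially. 0 \<le> lev_form habs habs m"
      by (auto simp: lev_form_def lev_def states_def intro!: always_eventually sum_nonneg mult_nonneg_nonneg nonneg habs_nonneg)
  qed (auto simp: le)
qed

end

section \<open>The sigma-field of the boundary and functions of one coordinate\<close>

context rooted_tree
begin

lemma space_boundary_sigma: "space (boundary_sigma T) = boundary T"
  unfolding boundary_sigma_def by (rule space_measure_of) (use cyl_subset in blast)

lemma sets_boundary_sigma: "sets (boundary_sigma T) = sigma_sets (boundary T) (cyl T ` sites T)"
  unfolding boundary_sigma_def by (rule sets_measure_of) (use cyl_subset in blast)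

lemma cyl_sets: "i \<in> sites T \<Longrightarrow> cyl T i \<in> sets (boundary_sigma T)"
  by (auto simp: sets_boundary_sigma)

lemma measurable_site_coord: "(\<lambda>\<xi>. \<xi> n) \<in> measurable (boundary_sigma T) (count_space (lev n))"
proof (subst measurable_count_space_eq2[OF finite_lev], intro conjI ballI)
  show "(\<lambda>\<xi>. \<xi> n) \<in> space (boundary_sigma T) \<rightarrow> lev n"
    by (auto simp: space_boundary_sigma boundary_lev)
next
  fix i assume i: "i \<in> lev n"
  then have "(\<lambda>\<xi>. \<xi> n) -` {i} \<inter> space (boundary_sigma T) = cyl T i"
    by (auto simp: space_boundary_sigma mem_cyl_lev)
  then show "(\<lambda>\<xi>. \<xi> n) -` {i} \<inter> space (boundary_sigma T) \<in> sets (boundary_sigma T)"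
    using i cyl_sets by (simp add: lev_def)
qed

lemma measurable_coord: "(\<lambda>\<xi>. \<phi> (\<xi> n)) \<in> measurable (boundary_sigma T) N"
  if "\<And>i. \<phi> i \<in> space N"
  by (rule measurable_compose[OF measurable_site_coord]) (use that in auto)

text \<open>The empty set is added because it is the intersection of disjoint cylinders.\<close>

lemma Int_stable_cyls: "Int_stable (insert {} (cyl T ` sites T))"
proof (rule Int_stableI)
  fix a b assume "a \<in> insert {} (cyl T ` sites T)" "b \<in> insert {} (cyl T ` sites T)"
  then consider "a \<inter> b = {}" | i j where "i \<in> sites T" "j \<in> sites T" "a = cyl T i" "b = cyl T j"
    by auto
  then show "a \<inter> b \<in> insert {} (cyl T ` sites T)"
    by cases (auto simp: cyl_inter)
qed

end

text \<open>The common ground of the probabilistic part, where the measure is the exit law, and of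
  the analytic part.\<close>

locale boundary_measure = rooted_tree T + prob_space \<mu>
  for T :: "'v rtree" and \<mu> :: "(nat \<Rightarrow> 'v) measure" +
  assumes sets_mu: "sets \<mu> = sets (boundary_sigma T)"
begin

lemma space_mu: "space \<mu> = boundary T"
  using sets_eq_imp_space_eq[OF sets_mu] by (simp add: space_boundary_sigma)

lemma cyl_mu: "i \<in> sites T \<Longrightarrow> cyl T i \<in> sets \<mu>"
  by (simp add: sets_mu cyl_sets)

lemma borel_coord [measurable]: "(\<lambda>\<xi>. \<phi> (\<xi> n) :: 'b :: topological_space) \<in> borel_measurable \<mu>"
  unfolding measurable_cong_sets[OF sets_mu refl] by (rule measurable_coord) simp

lemma integrable_coord: "integrable \<mu> (\<lambda>\<xi>. \<phi> (\<xi> n) :: real)"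
proof (rule integrable_const_bound[where B = "\<Sum>i\<in>lev n. \<bar>\<phi> i\<bar>"])
  show "AE \<xi> in \<mu>. norm (\<phi> (\<xi> n)) \<le> (\<Sum>i\<in>lev n. \<bar>\<phi> i\<bar>)"
    by (auto simp: space_mu finite_lev intro!: AE_I2 member_le_sum[where f = "\<lambda>i. \<bar>\<phi> i\<bar>"] boundary_lev)
qed measurable

lemma coord_eq_sum:
  "\<xi> \<in> boundary T \<Longrightarrow> (\<phi> (\<xi> n) :: real) = (\<Sum>i\<in>lev n. \<phi> i * indicator (cyl T i) \<xi>)"
  using boundary_lev[of \<xi> n]
  by (subst sum.remove[of _ "\<xi> n"])
     (auto simp: finite_lev mem_cyl_lev indicator_def intro!: sum.neutral)

lemma integral_coord: "(\<integral>\<xi>. \<phi> (\<xi> n) \<partial>\<mu>) = (\<Sum>i\<in>lev n. \<phi> i * measure \<mu> (cyl T i))"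
proof -
  have "(\<integral>\<xi>. \<phi> (\<xi> n) \<partial>\<mu>) = (\<integral>\<xi>. (\<Sum>i\<in>lev n. \<phi> i * indicator (cyl T i) \<xi>) \<partial>\<mu>)"
    by (rule Bochner_Integration.integral_cong) (auto simp: space_mu coord_eq_sum)
  also have "\<dots> = (\<Sum>i\<in>lev n. \<phi> i * measure \<mu> (cyl T i))"
    using cyl_mu sets.sets_into_space[OF cyl_mu]
    by (subst Bochner_Integration.integral_sum)
       (auto simp: lev_def Int_absorb2 emeasure_eq_measure intro!: sum.cong integrable_mult_right)
  finally show ?thesis .
qed

lemma measure_succs: "i \<in> sites T \<Longrightarrow> (\<Sum>j\<in>succs T i. measure \<mu> (cyl T j)) = measure \<mu> (cyl T i)"
proof -
  assume i: "i \<in> sites T"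
  have "succs T i \<subseteq> lev (Suc (level T i))"
    by (auto simp: lev_def level_succs dest: succs_site)
  then have d: "disjoint_family_on (cyl T) (succs T i)"
    using disjoint_cyl by (rule disjoint_family_on_mono)
  show ?thesis
    unfolding cyl_succs[OF i]
    by (rule finite_measure_finite_Union[OF finite_succs _ d, symmetric])
       (use succs_site cyl_mu in blast)
qed

end

section \<open>Exit from the tree\<close>

context rooted_tree
begin

text \<open>The subtrees along a ray decrease, so the infimum in \<open>to_boundary\<close> is taken
  over a directed family.\<close>

lemma eventually_to_boundary:
  assumes "\<xi> \<in> boundary T"
  shows "eventually Q (to_boundary T \<xi>) \<longleftrightarrow> (\<exists>n. \<forall>j\<in>subtree T (\<xi> n). Q j)"
proof -
  have "eventually Q (to_boundary T \<xi>) \<longleftrightarrow> (\<exists>n\<in>UNIV. eventually Q (principal (subtree T (\<xi> n))))"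
    unfolding to_boundary_def
  proof (rule eventually_INF_base)
    fix a b :: nat
    have "subtree T (\<xi> (max a b)) \<subseteq> subtree T (\<xi> a) \<inter> subtree T (\<xi> b)"
      using boundary_subtree[OF assms, of a "max a b"] boundary_subtree[OF assms, of b "max a b"]
        subtree_trans by auto
    then show "\<exists>x\<in>UNIV. principal (subtree T (\<xi> x)) \<le> inf (principal (subtree T (\<xi> a))) (principal (subtree T (\<xi> b)))"
      by (auto simp: intro!: exI[of _ "max a b"])
  qed simp
  then show ?thesis by (simp add: eventually_principal)
qed

lemma filterlim_to_boundary:
  assumes "\<xi> \<in> boundary T"
  shows "filterlim g (filtermap Site (to_boundary T \<xi>)) F \<longleftrightarrow>
    (\<forall>m. \<forall>\<^sub>F t in F. g t \<in> Site ` subtree T (\<xi> m))"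
proof
  assume l: "filterlim g (filtermap Site (to_boundary T \<xi>)) F"
  show "\<forall>m. \<forall>\<^sub>F t in F. g t \<in> Site ` subtree T (\<xi> m)"
  proof
    fix m
    have "eventually (\<lambda>x. x \<in> Site ` subtree T (\<xi> m)) (filtermap Site (to_boundary T \<xi>))"
      by (auto simp: eventually_filtermap eventually_to_boundary[OF assms])
    then show "\<forall>\<^sub>F t in F. g t \<in> Site ` subtree T (\<xi> m)"
      by (rule l[unfolded filterlim_iff, rule_format])
  qed
next
  assume e: "\<forall>m. \<forall>\<^sub>F t in F. g t \<in> Site ` subtree T (\<xi> m)"
  show "filterlim g (filtermap Site (to_boundary T \<xi>)) F"
    unfolding filterlim_iff
  proof (intro allI impI)
    fix Q assume "eventually Q (filtermap Site (to_boundary T \<xi>))"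
    then obtain n where n: "\<forall>j\<in>subtree T (\<xi> n). Q (Site j)"
      by (auto simp: eventually_filtermap eventually_to_boundary[OF assms])
    from e have "\<forall>\<^sub>F t in F. g t \<in> Site ` subtree T (\<xi> n)" by blast
    then show "\<forall>\<^sub>F t in F. Q (g t)" by (rule eventually_mono) (use n in auto)
  qed
qed

end

text \<open>A single trajectory: \<open>y\<close>, \<open>s\<close>, \<open>x\<close> are the jump chain, the holding times and the path.\<close>

locale tree_path = weighted_tree T w for T :: "'v rtree" and w +
  fixes y :: "nat \<Rightarrow> 'v state" and s :: "nat \<Rightarrow> ennreal" and x :: "real \<Rightarrow> 'o \<Rightarrow> 'v state" and \<omega> :: 'o
  assumes y_states: "y n \<in> states" and s_pos: "0 < s n"
    and x_jump: "0 \<le> t \<Longrightarrow> (\<Sum>k<n. s k) \<le> ennreal t \<Longrightarrow> ennreal t < (\<Sum>k<Suc n. s k) \<Longrightarrow> x t \<omega> = y n"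
    and x_cemetery: "0 \<le> t \<Longrightarrow> (\<Sum>k. s k) \<le> ennreal t \<Longrightarrow> x t \<omega> = Cemetery"
begin

lemma partial_le: "(\<Sum>k<n. s k) \<le> (\<Sum>k. s k)"
  by (rule sum_le_suminf) auto

lemma partial_less_Suc: "(\<Sum>k<n. s k) < \<infinity> \<Longrightarrow> (\<Sum>k<n. s k) < (\<Sum>k<Suc n. s k)"
  using s_pos[of n] by (cases "\<Sum>k<n. s k"; cases "s n") (auto simp: ennreal_plus[symmetric] ennreal_less_iff simp del: ennreal_plus)

lemma ex_interval:
  assumes "t < (\<Sum>k. s k)"
  shows "\<exists>n. (\<Sum>k<n. s k) \<le> t \<and> t < (\<Sum>k<Suc n. s k)"
proof -
  have "\<exists>n. t < (\<Sum>k<n. s k)"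
    using assms by (auto simp: suminf_eq_SUP less_SUP_iff)
  then obtain n where n: "t < (\<Sum>k<n. s k)" "\<And>m. m < n \<Longrightarrow> \<not> t < (\<Sum>k<m. s k)"
    using exists_least_iff[of "\<lambda>n. t < (\<Sum>k<n. s k)"] by blast
  show ?thesis
  proof (cases n)
    case (Suc m)
    then show ?thesis using n(1) n(2)[of m] by (auto simp: not_less)
  qed (use n(1) in simp)
qed

lemma x_before:
  assumes "0 \<le> t" "ennreal t < (\<Sum>k. s k)"
  obtains n where "(\<Sum>k<n. s k) \<le> ennreal t" "ennreal t < (\<Sum>k<Suc n. s k)" "x t \<omega> = y n"
  using ex_interval[OF assms(2)] x_jump[OF assms(1)] by blast

lemma x_partial:
  assumes "(\<Sum>k<n. s k) < \<infinity>"
  shows "x (enn2real (\<Sum>k<n. s k)) \<omega> = y n"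
  using x_jump[of "enn2real (\<Sum>k<n. s k)" n] partial_less_Suc[OF assms] assms
  by (simp add: ennreal_enn2real)

text \<open>It does not suffice that the jump chain reaches \<open>Absorbed\<close>: the preceding
  holding times must have a finite sum for the path to get there.\<close>

lemma absorption_finite_iff:
  "absorption_time x \<omega> < \<infinity> \<longleftrightarrow> (\<exists>n. y n = Absorbed \<and> (\<Sum>k<n. s k) < \<infinity>)"
proof
  assume "absorption_time x \<omega> < \<infinity>"
  then have "{t. 0 \<le> t \<and> x t \<omega> = Absorbed} \<noteq> {}"
    unfolding absorption_time_def by (intro notI) simp
  then obtain t where t: "0 \<le> t" "x t \<omega> = Absorbed" by auto
  then have "ennreal t < (\<Sum>k. s k)"
    using x_cemetery[OF t(1)] by (metis not_less state.distinct(5))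
  then obtain n where "(\<Sum>k<n. s k) \<le> ennreal t" "x t \<omega> = y n"
    using x_before[OF t(1)] by blast
  then show "\<exists>n. y n = Absorbed \<and> (\<Sum>k<n. s k) < \<infinity>"
    using t by (metis le_less_trans ennreal_less_top infinity_ennreal_def)
next
  assume "\<exists>n. y n = Absorbed \<and> (\<Sum>k<n. s k) < \<infinity>"
  then obtain n where n: "y n = Absorbed" "(\<Sum>k<n. s k) < \<infinity>" by blast
  then have "absorption_time x \<omega> \<le> ennreal (enn2real (\<Sum>k<n. s k))"
    unfolding absorption_time_def using x_partial[OF n(2)] n(1)
    by (intro Inf_lower imageI) simp
  then show "absorption_time x \<omega> < \<infinity>"
    by (rule le_less_trans) simp
qed

lemma explosion_time_eq: "explosion_time x \<omega> = (\<Sum>k. s k)"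
proof (rule antisym)
  show "explosion_time x \<omega> \<le> (\<Sum>k. s k)"
  proof (cases "(\<Sum>k. s k) = \<infinity>")
    case False
    then have "ennreal (enn2real (\<Sum>k. s k)) = (\<Sum>k. s k)"
      by (simp add: ennreal_enn2real less_top)
    then show ?thesis
      unfolding explosion_time_def using x_cemetery[of "enn2real (\<Sum>k. s k)"]
      by (intro Inf_lower) (auto simp: image_iff intro!: exI[of _ "enn2real (\<Sum>k. s k)"])
  qed simp
  show "(\<Sum>k. s k) \<le> explosion_time x \<omega>"
    unfolding explosion_time_def
  proof (rule Inf_greatest)
    fix u assume "u \<in> ennreal ` {t. 0 \<le> t \<and> x t \<omega> = Cemetery}"
    then obtain t where t: "0 \<le> t" "x t \<omega> = Cemetery" "u = ennreal t" by auto
    show "(\<Sum>k. s k) \<le> u"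
    proof (rule ccontr)
      assume "\<not> (\<Sum>k. s k) \<le> u"
      then obtain n where "x t \<omega> = y n" using x_before[OF t(1)] t by (auto simp: not_le)
      then show False using y_states[of n] t by (auto simp: states_def)
    qed
  qed
qed

lemma lifetime_eq: "absorption_time x \<omega> = \<infinity> \<Longrightarrow> lifetime x \<omega> = (\<Sum>k. s k)"
  by (auto simp: lifetime_def explosion_time_eq min_def top_unique)

lemma total_pos: "0 < (\<Sum>k. s k)"
  using partial_le[of 1] s_pos[of 0] by auto

text \<open>The partial sums are the jump times. They increase strictly to the total time and the
  path is constant between them, so a left neighbourhood of the total time corresponds to a tail of
  the jump chain.\<close>

lemma eventually_at_left_iff:
  assumes "\<And>n. s n < \<infinity>"
  shows "(\<forall>\<^sub>F t in at_left (\<Sum>k. s k). x (enn2real t) \<omega> \<in> A) \<longleftrightarrow> (\<forall>\<^sub>F n in sequentially. y n \<in> A)"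
proof -
  have fin: "(\<Sum>k<n. s k) < \<infinity>" for n
    using assms by (simp add: less_top[symmetric])
  show ?thesis
    unfolding eventually_at_left[OF total_pos] eventually_sequentially
  proof
    assume "\<exists>b<\<Sum>k. s k. \<forall>t>b. t < (\<Sum>k. s k) \<longrightarrow> x (enn2real t) \<omega> \<in> A"
    then obtain b where b: "b < (\<Sum>k. s k)" "\<And>t. b < t \<Longrightarrow> t < (\<Sum>k. s k) \<Longrightarrow> x (enn2real t) \<omega> \<in> A"
      by blast
    obtain N where N: "b < (\<Sum>k<N. s k)"
      using b(1) by (auto simp: suminf_eq_SUP less_SUP_iff)
    have "y n \<in> A" if "N \<le> n" for n
    proof -
      have "(\<Sum>k<N. s k) \<le> (\<Sum>k<n. s k)" using that by (intro sum_mono2) auto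
      then have "b < (\<Sum>k<n. s k)" using N by simp
      moreover have "(\<Sum>k<n. s k) < (\<Sum>k. s k)"
        using partial_less_Suc[OF fin] partial_le by (rule less_le_trans)
      ultimately show ?thesis using b(2)[of "\<Sum>k<n. s k"] x_partial[OF fin, of n] by simp
    qed
    then show "\<exists>N. \<forall>n\<ge>N. y n \<in> A" by blast
  next
    assume "\<exists>N. \<forall>n\<ge>N. y n \<in> A"
    then obtain N where N: "\<And>n. N \<le> n \<Longrightarrow> y n \<in> A" by blast
    show "\<exists>b<\<Sum>k. s k. \<forall>t>b. t < (\<Sum>k. s k) \<longrightarrow> x (enn2real t) \<omega> \<in> A"
    proof (intro exI conjI allI impI)
      show "(\<Sum>k<N. s k) < (\<Sum>k. s k)"
        using partial_less_Suc[OF fin] partial_le by (rule less_le_trans)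
    next
      fix t assume t: "(\<Sum>k<N. s k) < t" "t < (\<Sum>k. s k)"
      then have e: "ennreal (enn2real t) = t"
        by (intro ennreal_enn2real) (auto simp: less_top[symmetric])
      then obtain n where n: "ennreal (enn2real t) < (\<Sum>k<Suc n. s k)" "x (enn2real t) \<omega> = y n"
        using x_before[of "enn2real t"] t by auto
      have "N \<le> n"
      proof (rule ccontr)
        assume "\<not> N \<le> n"
        then have "(\<Sum>k<Suc n. s k) \<le> (\<Sum>k<N. s k)" by (intro sum_mono2) auto
        then show False using n(1) t(1) e by simp
      qed
      then show "x (enn2real t) \<omega> \<in> A" using N n(2) by simp
    qed
  qed
qed

text \<open>With finite holding times, convergence of the path is translated by
  \<open>eventually_at_left_iff\<close>. An infinite holding time stops the path at one site, which
  excludes convergence to a ray.\<close>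

lemma exits_at_iff:
  "exits_at T x \<omega> \<xi> \<longleftrightarrow> \<xi> \<in> boundary T \<and> (\<forall>n. s n < \<infinity>) \<and> (\<forall>n. y n \<noteq> Absorbed)
     \<and> (\<forall>m. \<forall>\<^sub>F n in sequentially. y n \<in> Site ` subtree T (\<xi> m))"
proof (cases "\<xi> \<in> boundary T \<and> (\<forall>n. s n < \<infinity>)")
  case True
  then have fin: "s n < \<infinity>" for n by blast
  then have "(\<Sum>k<n. s k) < \<infinity>" for n by (simp add: less_top[symmetric])
  then have abs: "absorption_time x \<omega> = \<infinity> \<longleftrightarrow> (\<forall>n. y n \<noteq> Absorbed)"
    using absorption_finite_iff by (metis less_top infinity_ennreal_def)
  show ?thesis
    unfolding exits_at_def abs
    using True lifetime_eq abs eventually_at_left_iff[OF fin]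
    by (auto simp: filterlim_to_boundary)
next
  case False
  have "\<not> exits_at T x \<omega> \<xi>" if xi: "\<xi> \<in> boundary T" and inf: "\<exists>n. \<not> s n < \<infinity>"
  proof
    assume e: "exits_at T x \<omega> \<xi>"
    then have abs: "absorption_time x \<omega> = \<infinity>" by (simp add: exits_at_def)
    \<comment> \<open>The first infinite holding time: from its beginning on, the path stays at
      \<open>y n\<close>.\<close>
    obtain n where n: "\<not> s n < \<infinity>" "\<And>m. m < n \<Longrightarrow> s m < \<infinity>"
      using inf exists_least_iff[of "\<lambda>n. \<not> s n < \<infinity>"] by blast
    have fin: "(\<Sum>k<n. s k) < \<infinity>" using n(2) by (simp add: less_top[symmetric])
    have top: "(\<Sum>k<Suc n. s k) = \<infinity>" using n(1) by (simp add: less_top[symmetric])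
    then have Z: "(\<Sum>k. s k) = \<infinity>" using partial_le[of "Suc n"] by (metis top_unique infinity_ennreal_def)
    have xt: "x t \<omega> = y n" if "(\<Sum>k<n. s k) \<le> ennreal t" "0 \<le> t" for t
      using x_jump[OF that(2,1)] unfolding top by (simp add: less_top[symmetric])
    have "y n \<noteq> Absorbed" using absorption_finite_iff abs fin by auto
    then obtain i where i: "y n = Site i" using y_states[of n] by (auto simp: states_def)
    \<comment> \<open>Convergence to \<xi> forces the path into a subtree that starts one level
      deeper than \<open>i\<close> and so does not contain \<open>i\<close>.\<close>
    have "\<forall>\<^sub>F t in at_left \<infinity>. x (enn2real t) \<omega> \<in> Site ` subtree T (\<xi> (Suc (level T i)))"
      using e lifetime_eq[OF abs] Z by (auto simp: exits_at_def filterlim_to_boundary[OF xi])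
    then obtain b where b: "b < \<infinity>" "\<And>t. b < t \<Longrightarrow> t < \<infinity> \<Longrightarrow> x (enn2real t) \<omega> \<in> Site ` subtree T (\<xi> (Suc (level T i)))"
      by (subst (asm) eventually_at_left[of 0]) auto
    \<comment> \<open>A finite time strictly after \<open>b\<close> and not before the beginning of
      the infinite holding time.\<close>
    define t where "t = max b (\<Sum>k<n. s k) + 1"
    have t: "b < t" "(\<Sum>k<n. s k) \<le> t" "t < \<infinity>"
      using b(1) fin unfolding t_def
      by (cases b; cases "\<Sum>k<n. s k"; auto simp: max_def ennreal_plus[symmetric] ennreal_less_iff simp del: ennreal_plus simp flip: ennreal_1)+
    then have "x (enn2real t) \<omega> = y n" by (intro xt) (auto simp: ennreal_enn2real)
    then have "i \<in> subtree T (\<xi> (Suc (level T i)))" using b(2)[OF t(1,3)] i by auto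
    then show False using subtree_level boundary_level[OF xi] by fastforce
  qed
  then show ?thesis using False by (auto simp: exits_at_def)
qed

abbreviation ends_in :: "'v \<Rightarrow> bool" where
  "ends_in i \<equiv> \<forall>\<^sub>F n in sequentially. y n \<in> Site ` subtree T i"

lemma ends_in_unique:
  assumes "ends_in i" "ends_in j" "level T i = level T j"
  shows "i = j"
proof -
  from assms(1,2) have "\<forall>\<^sub>F n in sequentially. y n \<in> Site ` subtree T i \<and> y n \<in> Site ` subtree T j"
    by (rule eventually_conj)
  then obtain n where "y n \<in> Site ` subtree T i" "y n \<in> Site ` subtree T j"
    unfolding eventually_sequentially by blast
  then show ?thesis using ancestor_unique assms(3) by auto
qed

text \<open>At each level at most one subtree finally contains the walk, and these subtrees are
  nested, so their top sites form a ray. The right-hand side uses countably many conditions on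
  \<open>y\<close> and \<open>s\<close>, from which the escape event is seen to be
  measurable.\<close>

lemma exits_iff:
  "(\<exists>\<xi>. exits_at T x \<omega> \<xi>) \<longleftrightarrow>
    (\<forall>n. s n < \<infinity>) \<and> (\<forall>n. y n \<noteq> Absorbed) \<and> (\<forall>m. \<exists>i\<in>lev m. ends_in i)"
proof
  assume "\<exists>\<xi>. exits_at T x \<omega> \<xi>"
  then show "(\<forall>n. s n < \<infinity>) \<and> (\<forall>n. y n \<noteq> Absorbed) \<and> (\<forall>m. \<exists>i\<in>lev m. ends_in i)"
    unfolding exits_at_iff using boundary_lev by blast
next
  assume a: "(\<forall>n. s n < \<infinity>) \<and> (\<forall>n. y n \<noteq> Absorbed) \<and> (\<forall>m. \<exists>i\<in>lev m. ends_in i)"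
  then obtain \<xi> where xi: "\<And>m. \<xi> m \<in> lev m" "\<And>m. ends_in (\<xi> m)" by metis
  have "\<xi> (Suc m) \<in> succs T (\<xi> m)" for m
  proof -
    have l: "\<xi> (Suc m) \<in> sites T" "level T (\<xi> (Suc m)) = Suc m" "level T (\<xi> m) = m"
      using xi(1)[of m] xi(1)[of "Suc m"] by (auto simp: lev_def)
    then have r: "\<xi> (Suc m) \<noteq> root T" by auto
    have "subtree T (\<xi> (Suc m)) \<subseteq> subtree T (parent T (\<xi> (Suc m)))"
      using subtree_trans[of _ "\<xi> (Suc m)"] subtree_iff[of "\<xi> (Suc m)" "parent T (\<xi> (Suc m))"]
        subtree_refl[OF parent_site[OF l(1) r]] l r by blast
    then have "ends_in (parent T (\<xi> (Suc m)))"
      using xi(2)[of "Suc m"] by (auto elim!: eventually_mono)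
    then have "parent T (\<xi> (Suc m)) = \<xi> m"
      using ends_in_unique xi(2)[of m] level_parent[OF l(1) r] l by simp
    then show ?thesis using l r by (simp add: succs_iff)
  qed
  moreover have "\<xi> 0 = root T" using xi(1)[of 0] by simp
  ultimately have "\<xi> \<in> boundary T" by (simp add: boundary_def)
  then show "\<exists>\<xi>. exits_at T x \<omega> \<xi>" using a xi by (auto simp: exits_at_iff)
qed

lemma exit_point_boundary: "\<exists>\<xi>. exits_at T x \<omega> \<xi> \<Longrightarrow> exits_at T x \<omega> (exit_point T x \<omega>)"
proof -
  assume ex: "\<exists>\<xi>. exits_at T x \<omega> \<xi>"
  have "\<exists>!\<xi>. exits_at T x \<omega> \<xi>"
  proof (rule ex_ex1I[OF ex])
    fix \<xi> \<eta> assume "exits_at T x \<omega> \<xi>" "exits_at T x \<omega> \<eta>"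
    then have "\<xi> m = \<eta> m" for m
      by (auto simp: exits_at_iff boundary_level intro: ends_in_unique)
    then show "\<xi> = \<eta>" by auto
  qed
  then show ?thesis unfolding exit_point_def using theI'[of "exits_at T x \<omega>"] ex by auto
qed

text \<open>The coordinate of the exit point at the level of \<open>i\<close> is the unique site of
  that level whose subtree finally contains the walk.\<close>

lemma exit_point_cyl:
  assumes "\<exists>\<xi>. exits_at T x \<omega> \<xi>" "i \<in> sites T"
  shows "exit_point T x \<omega> \<in> cyl T i \<longleftrightarrow> ends_in i"
proof -
  note e = exit_point_boundary[OF assms(1), unfolded exits_at_iff]
  then show ?thesis
    using ends_in_unique[of "exit_point T x \<omega> (level T i)" i]
    by (auto simp: cyl_iff boundary_level) (metis e)
qed

end

section \<open>The law of the jump chain and of the holding times\<close>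

locale jump_chain = weighted_tree T w + prob_space M
  for T :: "'v rtree" and w and M :: "'o measure" +
  fixes i\<^sub>0 :: 'v and Y :: "nat \<Rightarrow> 'o \<Rightarrow> 'v state" and S :: "nat \<Rightarrow> 'o \<Rightarrow> ennreal"
  assumes start: "i\<^sub>0 \<in> sites T"
    and Y_meas: "Y n \<in> measurable M (count_space (insert Absorbed (Site ` sites T)))"
    and S_meas [measurable]: "S n \<in> borel_measurable M"
    and S_pos: "\<omega> \<in> space M \<Longrightarrow> 0 < S n \<omega>"
    and law: "\<forall>k\<le>n. y k \<in> insert Absorbed (Site ` sites T) \<and> 0 \<le> s k \<Longrightarrow>
      measure M {\<omega> \<in> space M. \<forall>k\<le>n. Y k \<omega> = y k \<and> ennreal (s k) < S k \<omega>}
        = of_bool (y 0 = Site i\<^sub>0)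
          * (\<Prod>k<n. jump_prob (Qext T w) (y k) (y (Suc k)))
          * (\<Prod>k\<le>n. exp (Qext T w (y k) (y k) * s k))"
begin

lemma Y_states: "\<omega> \<in> space M \<Longrightarrow> Y n \<omega> \<in> states"
  using measurable_space[OF Y_meas] by (auto simp: states_def)

lemma Y_in [measurable]: "Measurable.pred M (\<lambda>\<omega>. Y n \<omega> \<in> A)"
  by (rule measurable_compose[OF Y_meas]) simp

lemma Y_eq [measurable]: "Measurable.pred M (\<lambda>\<omega>. Y n \<omega> = y)"
  using Y_in[of n "{y}"] by simp

text \<open>Initial segments as functions on \<open>{..n}\<close>. There are countably many, so an
  event can be split over them and \<open>law\<close> applied to each.\<close>

definition paths :: "nat \<Rightarrow> (nat \<Rightarrow> 'v state) set" where
  "paths n = PiE {..n} (\<lambda>_. states)"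

definition path_set :: "nat \<Rightarrow> (nat \<Rightarrow> 'v state) \<Rightarrow> 'o set" where
  "path_set n p = {\<omega> \<in> space M. \<forall>k\<le>n. Y k \<omega> = p k}"

lemma path_set_sets [measurable]: "path_set n p \<in> sets M"
  unfolding path_set_def by measurable

lemma countable_paths: "countable (paths n)"
  unfolding paths_def by (intro countable_PiE countable_states) simp

lemma ex_path: "\<omega> \<in> space M \<Longrightarrow> \<exists>p\<in>paths n. \<omega> \<in> path_set n p"
  by (rule bexI[of _ "restrict (\<lambda>k. Y k \<omega>) {..n}"]) (auto simp: path_set_def paths_def Y_states)

lemma emeasure_paths:
  assumes [measurable]: "E \<in> sets M"
  shows "emeasure M E = (\<integral>\<^sup>+p. emeasure M (E \<inter> path_set n p) \<partial>count_space (paths n))"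
proof -
  have "E = (\<Union>p\<in>paths n. E \<inter> path_set n p)"
    using ex_path sets.sets_into_space[OF assms] by blast
  moreover have "disjoint_family_on (\<lambda>p. E \<inter> path_set n p) (paths n)"
    unfolding disjoint_family_on_def
  proof (intro ballI impI)
    fix p q assume "p \<in> paths n" "q \<in> paths n" "p \<noteq> q"
    then obtain k where "k \<le> n" "p k \<noteq> q k"
      unfolding paths_def by (metis PiE_ext atMost_iff)
    then show "(E \<inter> path_set n p) \<inter> (E \<inter> path_set n q) = {}" by (auto simp: path_set_def)
  qed
  ultimately show ?thesis
    using emeasure_UN_countable[of "paths n" "\<lambda>p. E \<inter> path_set n p" M] countable_paths by auto
qed

lemma AE_paths:
  assumes "\<And>p. p \<in> paths n \<Longrightarrow> AE \<omega> in M. \<omega> \<in> path_set n p \<longrightarrow> Q \<omega>"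
  shows "AE \<omega> in M. Q \<omega>"
proof -
  have "AE \<omega> in M. \<forall>p\<in>paths n. \<omega> \<in> path_set n p \<longrightarrow> Q \<omega>"
    using assms by (subst AE_ball_countable) (auto simp: countable_paths)
  then show ?thesis using ex_path by (auto elim!: AE_mp intro!: AE_I2)
qed

text \<open>With all thresholds \<open>s k\<close> equal to 0 the holding times disappear from
  \<open>law\<close>, since they are positive.\<close>

lemma measure_path_set:
  assumes "\<And>k. k \<le> n \<Longrightarrow> y k \<in> states"
  shows "measure M (path_set n y) = of_bool (y 0 = Site i\<^sub>0) * (\<Prod>k<n. jp (y k) (y (Suc k)))"
proof -
  have "path_set n y = {\<omega> \<in> space M. \<forall>k\<le>n. Y k \<omega> = y k \<and> ennreal 0 < S k \<omega>}"
    using S_pos by (auto simp: path_set_def)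
  then show ?thesis using law[of n y "\<lambda>_. 0"] assms by (auto simp: states_def)
qed

text \<open>The Markov property as a product, which avoids conditioning on null events. On each
  initial segment it says that \<open>measure_path_set\<close> acquires one more factor.\<close>

lemma markov:
  assumes "y \<in> states" "z \<in> states"
  shows "emeasure M {\<omega> \<in> space M. Y n \<omega> = y \<and> Y (Suc n) \<omega> = z} = emeasure M {\<omega> \<in> space M. Y n \<omega> = y} * ennreal (jp y z)"
proof -
  have jp0: "0 \<le> jp y z"
    using jp_nonneg jp_zero assms by (cases "z \<in> post y") auto
  have "emeasure M ({\<omega> \<in> space M. Y n \<omega> = y \<and> Y (Suc n) \<omega> = z} \<inter> path_set n p)
      = emeasure M ({\<omega> \<in> space M. Y n \<omega> = y} \<inter> path_set n p) * ennreal (jp y z)"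
    if p: "p \<in> paths n" for p
  proof (cases "p n = y")
    case True
    have ps: "p k \<in> states" if "k \<le> n" for k using p that by (auto simp: paths_def)
    have "{\<omega> \<in> space M. Y n \<omega> = y} \<inter> path_set n p = path_set n p"
      using True by (auto simp: path_set_def)
    moreover have "{\<omega> \<in> space M. Y n \<omega> = y \<and> Y (Suc n) \<omega> = z} \<inter> path_set n p = path_set (Suc n) (p(Suc n := z))"
      using True by (auto simp: path_set_def le_Suc_eq)
    moreover have "measure M (path_set (Suc n) (p(Suc n := z))) = measure M (path_set n p) * jp y z"
      using ps assms True by (subst (1 2) measure_path_set) (auto simp: le_Suc_eq)
    ultimately show ?thesis
      using jp0 by (simp add: emeasure_eq_measure ennreal_mult)
  next
    case False
    then have "{\<omega> \<in> space M. Y n \<omega> = y \<and> Y (Suc n) \<omega> = z} \<inter> path_set n p = {}"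
      "{\<omega> \<in> space M. Y n \<omega> = y} \<inter> path_set n p = {}" by (auto simp: path_set_def)
    then show ?thesis by simp
  qed
  then show ?thesis
    by (subst (1 2) emeasure_paths[of _ n])
       (auto simp: nn_integral_multc[symmetric] intro!: nn_integral_cong)
qed

lemma AE_post: "AE \<omega> in M. \<forall>n. Y (Suc n) \<omega> \<in> post (Y n \<omega>)"
proof (subst AE_all_countable, intro allI)
  fix n
  have "AE \<omega> in M. \<forall>y\<in>states. \<forall>z\<in>states - post y. \<not> (Y n \<omega> = y \<and> Y (Suc n) \<omega> = z)"
  proof (subst AE_ball_countable[OF countable_states], intro ballI,
      subst AE_ball_countable[OF countable_Diff[OF countable_states]], intro ballI)
    fix y z assume "y \<in> states" "z \<in> states - post y"
    then have "emeasure M {\<omega> \<in> space M. Y n \<omega> = y \<and> Y (Suc n) \<omega> = z} = 0"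
      using markov[of y z n] jp_zero[of y z] by simp
    then show "AE \<omega> in M. \<not> (Y n \<omega> = y \<and> Y (Suc n) \<omega> = z)"
      by (intro AE_I[of _ _ "{\<omega> \<in> space M. Y n \<omega> = y \<and> Y (Suc n) \<omega> = z}"]) auto
  qed
  then show "AE \<omega> in M. Y (Suc n) \<omega> \<in> post (Y n \<omega>)"
    by (rule AE_mp) (use Y_states in \<open>auto intro!: AE_I2\<close>)
qed

lemma AE_absorbed: "AE \<omega> in M. \<forall>n m. Y n \<omega> = Absorbed \<longrightarrow> n \<le> m \<longrightarrow> Y m \<omega> = Absorbed"
  using AE_post
proof (rule AE_mp, intro AE_I2 impI allI)
  fix \<omega> n m assume p: "\<forall>n. Y (Suc n) \<omega> \<in> post (Y n \<omega>)" and n: "Y n \<omega> = Absorbed" and "n \<le> m"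
  from \<open>n \<le> m\<close> show "Y m \<omega> = Absorbed"
  proof (induction m rule: dec_induct)
    case base
    then show ?case by (rule n)
  next
    case (step m)
    then show ?case using p[rule_format, of m] by (simp add: post_def)
  qed
qed

text \<open>Decomposition by the last step. Transitions outside \<open>pre\<close> have probability
  0 but may occur on a null set, so the events agree up to a null set.\<close>

lemma prob_Y: "z \<in> states \<Longrightarrow> prob {\<omega> \<in> space M. Y n \<omega> = z} = Pn n (Site i\<^sub>0) z"
proof (induction n arbitrary: z)
  case 0
  have "{\<omega> \<in> space M. Y 0 \<omega> = z} = path_set 0 (\<lambda>_. z)" by (auto simp: path_set_def)
  then show ?case using measure_path_set[of 0 "\<lambda>_. z"] 0 by auto
next
  case (Suc n)
  have st: "Site i\<^sub>0 \<in> states" using start by (simp add: states_def)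
  have "prob {\<omega> \<in> space M. Y (Suc n) \<omega> = z} = prob (\<Union>u\<in>pre z. {\<omega> \<in> space M. Y n \<omega> = u \<and> Y (Suc n) \<omega> = z})"
  proof (rule finite_measure_eq_AE)
    show "AE \<omega> in M. (\<omega> \<in> {\<omega> \<in> space M. Y (Suc n) \<omega> = z})
        = (\<omega> \<in> (\<Union>u\<in>pre z. {\<omega> \<in> space M. Y n \<omega> = u \<and> Y (Suc n) \<omega> = z}))"
      using AE_post by (rule AE_mp) (use Y_states pre_post in \<open>fastforce intro!: AE_I2\<close>)
  qed (use finite_pre in \<open>auto intro!: sets.finite_UN\<close>)
  also have "\<dots> = (\<Sum>u\<in>pre z. prob {\<omega> \<in> space M. Y n \<omega> = u \<and> Y (Suc n) \<omega> = z})"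
    by (rule finite_measure_finite_Union) (auto simp: finite_pre disjoint_family_on_def)
  also have "\<dots> = (\<Sum>u\<in>pre z. Pn n (Site i\<^sub>0) u * jp u z)"
  proof (rule sum.cong)
    fix u assume "u \<in> pre z"
    then have u: "u \<in> states" using pre_states[OF Suc.prems] by auto
    have "0 \<le> jp u z" using jp_nonneg jp_zero u Suc.prems by (cases "z \<in> post u") auto
    then have "prob {\<omega> \<in> space M. Y n \<omega> = u \<and> Y (Suc n) \<omega> = z} = prob {\<omega> \<in> space M. Y n \<omega> = u} * jp u z"
      using markov[OF u Suc.prems, of n]
      by (simp add: emeasure_eq_measure ennreal_mult[symmetric])
    then show "prob {\<omega> \<in> space M. Y n \<omega> = u \<and> Y (Suc n) \<omega> = z} = Pn n (Site i\<^sub>0) u * jp u z"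
      using Suc.IH[OF u] by simp
  qed simp
  finally show ?case using Pn_forward[OF st Suc.prems] by simp
qed

text \<open>Along a fixed initial segment an infinite holding time exceeds every threshold
  \<open>r\<close>, and the exponential tail tends to 0 as \<open>r\<close> grows.\<close>

lemma AE_holding_finite: "AE \<omega> in M. \<forall>n. Y n \<omega> \<noteq> Absorbed \<longrightarrow> S n \<omega> < \<infinity>"
proof (subst AE_all_countable, intro allI, rule AE_paths)
  fix n p assume p: "p \<in> paths n"
  have ps: "p k \<in> states" if "k \<le> n" for k using p that by (auto simp: paths_def)
  show "AE \<omega> in M. \<omega> \<in> path_set n p \<longrightarrow> Y n \<omega> \<noteq> Absorbed \<longrightarrow> S n \<omega> < \<infinity>"
  proof (cases "p n = Absorbed")
    case True
    then show ?thesis by (auto simp: path_set_def)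
  next
    case False
    then obtain j where j: "p n = Site j" using ps[of n] by (auto simp: states_def)
    define c where "c = of_bool (p 0 = Site i\<^sub>0) * (\<Prod>k<n. jp (p k) (p (Suc k)))"
    define E where "E = {\<omega> \<in> space M. \<omega> \<in> path_set n p \<and> S n \<omega> = \<infinity>}"
    have [measurable]: "E \<in> sets M" unfolding E_def by measurable
    have le: "prob E \<le> c * exp (- rate j * real r)" for r :: nat
    proof -
      \<comment> \<open>Only the last holding time gets a nontrivial threshold.\<close>
      let ?s = "\<lambda>k. if k = n then real r else 0"
      have "prob E \<le> prob {\<omega> \<in> space M. \<forall>k\<le>n. Y k \<omega> = p k \<and> ennreal (?s k) < S k \<omega>}"
        by (rule finite_measure_mono) (auto simp: E_def path_set_def S_pos)
      also have "\<dots> = c * (\<Prod>k\<le>n. exp (Qext T w (p k) (p k) * ?s k))"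
        using ps by (subst law) (auto simp: states_def c_def)
      also have "(\<Prod>k\<le>n. exp (Qext T w (p k) (p k) * ?s k)) = exp (- rate j * real r)"
        by (subst prod.remove[of _ n]) (auto simp: j rate_eq)
      finally show ?thesis .
    qed
    have "(\<lambda>r. c * exp (- rate j * real r)) \<longlonglongrightarrow> c * 0"
      by (intro tendsto_mult tendsto_const filterlim_compose[OF exp_at_bot]
          filterlim_tendsto_neg_mult_at_bot[OF tendsto_const] filterlim_real_sequentially)
         (use rate_pos[of j] in simp)
    from LIMSEQ_le_const[OF this] have "prob E \<le> c * 0" using le by blast
    then have "prob E \<le> 0" by simp
    then have "emeasure M E = 0" by (simp add: emeasure_eq_measure measure_le_0_iff)
    then show ?thesis
      by (intro AE_I[of _ _ E]) (auto simp: E_def less_top[symmetric])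
  qed
qed

lemma prob_absorbed: "prob {\<omega> \<in> space M. \<exists>n. Y n \<omega> = Absorbed} = habs (Site i\<^sub>0)"
proof (rule LIMSEQ_unique)
  have st: "Site i\<^sub>0 \<in> states" "Absorbed \<in> states" using start by (auto simp: states_def)
  show "(\<lambda>n. prob {\<omega> \<in> space M. \<exists>k\<le>n. Y k \<omega> = Absorbed}) \<longlonglongrightarrow> prob {\<omega> \<in> space M. \<exists>n. Y n \<omega> = Absorbed}"
  proof -
    have "(\<Union>n. {\<omega> \<in> space M. \<exists>k\<le>n. Y k \<omega> = Absorbed}) = {\<omega> \<in> space M. \<exists>n. Y n \<omega> = Absorbed}" by auto
    moreover have "range (\<lambda>n. {\<omega> \<in> space M. \<exists>k\<le>n. Y k \<omega> = Absorbed}) \<subseteq> events" by auto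
    moreover have "incseq (\<lambda>n. {\<omega> \<in> space M. \<exists>k\<le>n. Y k \<omega> = Absorbed})"
      by (auto simp: incseq_def intro: order_trans)
    ultimately show ?thesis
      using finite_Lim_measure_incseq[of "\<lambda>n. {\<omega> \<in> space M. \<exists>k\<le>n. Y k \<omega> = Absorbed}"] by simp
  qed
  have "prob {\<omega> \<in> space M. \<exists>k\<le>n. Y k \<omega> = Absorbed} = prob {\<omega> \<in> space M. Y n \<omega> = Absorbed}" for n
  proof (rule finite_measure_eq_AE)
    show "AE \<omega> in M. (\<omega> \<in> {\<omega> \<in> space M. \<exists>k\<le>n. Y k \<omega> = Absorbed}) = (\<omega> \<in> {\<omega> \<in> space M. Y n \<omega> = Absorbed})"
      using AE_absorbed by (rule AE_mp) (auto intro!: AE_I2)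
  qed auto
  then show "(\<lambda>n. prob {\<omega> \<in> space M. \<exists>k\<le>n. Y k \<omega> = Absorbed}) \<longlonglongrightarrow> habs (Site i\<^sub>0)"
    using Pn_Absorbed_tendsto[OF st(1)] by (simp add: prob_Y[OF st(2)])
qed

end

section \<open>Crossings of an edge and the subtree in which the walk ends\<close>

context weighted_tree
begin

lemma up_notin_subtree: "j \<in> sites T \<Longrightarrow> up j \<notin> Site ` subtree T j"
  using subtree_level[of "parent T j" j] level_parent[of j] by (auto simp: up_def)

text \<open>The subtree of \<open>j\<close> is joined to the rest only by the edge above
  \<open>j\<close>, so entering or leaving it means crossing this edge. The exits added on the left
  and the entrances added on the right balance the membership after and before the step.\<close>

lemma step_subtree_iff:
  assumes "j \<in> sites T" "y \<in> states" "z \<in> post y"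
  shows "z \<in> Site ` subtree T j \<or> (y = Site j \<and> z = up j) \<longleftrightarrow>
    y \<in> Site ` subtree T j \<or> (y = up j \<and> z = Site j)"
proof -
  have img: "Site k \<in> Site ` subtree T j \<longleftrightarrow> k \<in> subtree T j" for k by auto
  consider "y = Absorbed" "z = Absorbed" | a where "y = Site a" "a \<in> sites T" "z = up a"
    | a b where "y = Site a" "a \<in> sites T" "z = Site b" "b \<in> succs T a"
    using assms by (auto simp: states_def post_def)
  then show ?thesis
  proof cases
    case 1
    then show ?thesis by auto
  next
    case (2 a)
    show ?thesis
    proof (cases "a = j")
      case True
      then show ?thesis using 2 assms(1) subtree_refl[of j] by auto
    next
      case False
      have "up a \<in> Site ` subtree T j \<longleftrightarrow> a \<in> subtree T j"
        using False 2(2) by (subst subtree_iff[of a]) (auto simp: up_def)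
      moreover have False if u: "up j = Site a" "up a = Site j"
      proof -
        have "level T (parent T k) < level T k" if "k \<in> sites T" "k \<noteq> root T" for k
          using level_parent[OF that] by simp
        moreover have "a \<noteq> root T" "j \<noteq> root T" "parent T j = a" "parent T a = j"
          using u unfolding up_def by (metis state.distinct(1) state.inject(1))+
        ultimately show False using 2(2) assms(1) by (metis less_asym)
      qed
      ultimately show ?thesis using 2 False img[of a] subtree_refl[OF assms(1)]
        by (metis state.inject(1))
    qed
  next
    case (3 a b)
    then have b: "b \<in> sites T" "b \<noteq> root T" "parent T b = a" by (auto simp: succs_iff)
    have ub: "up b = Site a" using b by (simp add: up_def)
    have "b \<in> subtree T j \<longleftrightarrow> b = j \<or> a \<in> subtree T j"
      using b by (subst subtree_iff) auto
    moreover have "\<not> (a = j \<and> Site b = up j)"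
    proof
      assume "a = j \<and> Site b = up j"
      then have "j \<noteq> root T" "level T b = level T (parent T j)" "level T b = Suc (level T j)"
        using level_succs[OF 3(4)] by (auto simp: up_def split: if_splits)
      then show False using level_parent[OF assms(1)] by simp
    qed
    ultimately show ?thesis using 3 ub img subtree_refl[OF assms(1)] by auto
  qed
qed

end

locale root_chain = jump_chain T w M "root T" Y S
  for T :: "'v rtree" and w and M :: "'o measure" and Y S
begin

definition ends_event :: "'v \<Rightarrow> 'o set" where
  "ends_event j = {\<omega> \<in> space M. \<forall>\<^sub>F n in sequentially. Y n \<omega> \<in> Site ` subtree T j}"

lemma ends_event_sets [measurable]: "ends_event j \<in> sets M"
  unfolding ends_event_def eventually_sequentially by measurable

text \<open>Borel-Cantelli: the expected number of visits is finite by
  \<open>sums_visits\<close>.\<close>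

lemma AE_leaves_site: "AE \<omega> in M. \<forall>j\<in>sites T. \<forall>\<^sub>F n in sequentially. Y n \<omega> \<noteq> Site j"
proof (subst AE_ball_countable[OF countable_sites], intro ballI)
  fix j assume j: "j \<in> sites T"
  then have "summable (\<lambda>n. prob {\<omega> \<in> space M. Y n \<omega> = Site j})"
    using sums_summable[OF sums_visits[OF j]] by (simp add: prob_Y states_def)
  then have "AE \<omega> in M. \<forall>\<^sub>F n in sequentially. \<omega> \<in> space M - {\<omega> \<in> space M. Y n \<omega> = Site j}"
    by (intro borel_cantelli_AE1) (auto simp: emeasure_eq_measure)
  then show "AE \<omega> in M. \<forall>\<^sub>F n in sequentially. Y n \<omega> \<noteq> Site j"
    by (rule AE_mp) (auto intro!: AE_I2 elim: eventually_mono)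
qed

text \<open>Entering or leaving the subtree of \<open>j\<close> requires a visit to
  \<open>j\<close>, and these visits stop.\<close>

lemma AE_ends_or_not:
  "AE \<omega> in M. \<forall>j\<in>sites T. (\<forall>\<^sub>F n in sequentially. Y n \<omega> \<in> Site ` subtree T j)
      \<or> (\<forall>\<^sub>F n in sequentially. Y n \<omega> \<notin> Site ` subtree T j)"
  using AE_leaves_site AE_post AE_space
proof eventually_elim
  case (elim \<omega>)
  show ?case
  proof
    fix j assume j: "j \<in> sites T"
    obtain N where N: "\<And>n. N \<le> n \<Longrightarrow> Y n \<omega> \<noteq> Site j"
      using elim(1) j by (auto simp: eventually_sequentially)
    have step: "Y (Suc n) \<omega> \<in> Site ` subtree T j \<longleftrightarrow> Y n \<omega> \<in> Site ` subtree T j" if "N \<le> n" for n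
      using step_subtree_iff[OF j Y_states[OF elim(3)], of "Y (Suc n) \<omega>" n] elim(2) N[of n] N[of "Suc n"] that by auto
    have "Y n \<omega> \<in> Site ` subtree T j \<longleftrightarrow> Y N \<omega> \<in> Site ` subtree T j" if "N \<le> n" for n
      using that by (induction n rule: dec_induct) (auto simp: step)
    then show "(\<forall>\<^sub>F n in sequentially. Y n \<omega> \<in> Site ` subtree T j)
      \<or> (\<forall>\<^sub>F n in sequentially. Y n \<omega> \<notin> Site ` subtree T j)"
      unfolding eventually_sequentially by blast
  qed
qed

text \<open>Mass balance of a subtree in one step: crossings downwards minus crossings
  upwards.\<close>

lemma prob_subtree_Suc:
  assumes "j \<in> sites T"
  shows "prob {\<omega> \<in> space M. Y (Suc n) \<omega> \<in> Site ` subtree T j} =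
    prob {\<omega> \<in> space M. Y n \<omega> \<in> Site ` subtree T j}
    + (Pn n (Site (root T)) (up j) * jp (up j) (Site j) - Pn n (Site (root T)) (Site j) * jp (Site j) (up j))"
proof -
  let ?A = "\<lambda>n. {\<omega> \<in> space M. Y n \<omega> \<in> Site ` subtree T j}"
  let ?B = "\<lambda>y z. {\<omega> \<in> space M. Y n \<omega> = y \<and> Y (Suc n) \<omega> = z}"
  have st: "Site j \<in> states" "up j \<in> states" using assms up_states by (auto simp: states_def)
  have pB: "prob (?B y z) = Pn n (Site (root T)) y * jp y z" if "y \<in> states" "z \<in> states" for y z
  proof -
    have "0 \<le> jp y z" using jp_nonneg jp_zero that by (cases "z \<in> post y") auto
    then have "prob (?B y z) = prob {\<omega> \<in> space M. Y n \<omega> = y} * jp y z"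
      using markov[OF that, of n] by (simp add: emeasure_eq_measure ennreal_mult[symmetric])
    then show ?thesis using prob_Y[OF that(1), of n] by simp
  qed
  \<comment> \<open>Both unions are disjoint because \<open>up j\<close> lies outside the
    subtree.\<close>
  have "prob (?A (Suc n)) + prob (?B (Site j) (up j)) = prob (?A (Suc n) \<union> ?B (Site j) (up j))"
    using up_notin_subtree[OF assms] by (intro finite_measure_Union[symmetric]) auto
  also have "\<dots> = prob (?A n \<union> ?B (up j) (Site j))"
  proof (rule finite_measure_eq_AE)
    show "AE \<omega> in M. (\<omega> \<in> ?A (Suc n) \<union> ?B (Site j) (up j)) = (\<omega> \<in> ?A n \<union> ?B (up j) (Site j))"
      using AE_post
    proof (rule AE_mp, intro AE_I2 impI)
      fix \<omega> assume \<omega>: "\<omega> \<in> space M" "\<forall>n. Y (Suc n) \<omega> \<in> post (Y n \<omega>)"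
      from step_subtree_iff[OF assms Y_states[OF \<omega>(1)], of "Y (Suc n) \<omega>"] \<omega>
      show "(\<omega> \<in> ?A (Suc n) \<union> ?B (Site j) (up j)) = (\<omega> \<in> ?A n \<union> ?B (up j) (Site j))"
        by simp
    qed
  qed auto
  also have "\<dots> = prob (?A n) + prob (?B (up j) (Site j))"
    using up_notin_subtree[OF assms] by (intro finite_measure_Union) auto
  finally show ?thesis using pB st by simp
qed

text \<open>The indicators are almost surely eventually constant, so dominated convergence
  applies.\<close>

lemma prob_subtree_tendsto:
  assumes "j \<in> sites T"
  shows "(\<lambda>n. prob {\<omega> \<in> space M. Y n \<omega> \<in> Site ` subtree T j}) \<longlonglongrightarrow> prob (ends_event j)"
proof -
  let ?f = "\<lambda>n \<omega>. indicator {\<omega> \<in> space M. Y n \<omega> \<in> Site ` subtree T j} \<omega> :: real"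
  have "(\<lambda>n. integral\<^sup>L M (?f n)) \<longlonglongrightarrow> (\<integral>\<omega>. indicator (ends_event j) \<omega> \<partial>M)"
  proof (rule integral_dominated_convergence[where w = "\<lambda>_. 1"])
    show "AE \<omega> in M. (\<lambda>n. ?f n \<omega>) \<longlonglongrightarrow> indicator (ends_event j) \<omega>"
      using AE_ends_or_not
    proof (rule AE_mp, intro AE_I2 impI)
      fix \<omega> assume \<omega>: "\<omega> \<in> space M" and
        "\<forall>j\<in>sites T. (\<forall>\<^sub>F n in sequentially. Y n \<omega> \<in> Site ` subtree T j)
          \<or> (\<forall>\<^sub>F n in sequentially. Y n \<omega> \<notin> Site ` subtree T j)"
      then consider "\<forall>\<^sub>F n in sequentially. Y n \<omega> \<in> Site ` subtree T j"
        | "\<forall>\<^sub>F n in sequentially. Y n \<omega> \<notin> Site ` subtree T j" using assms by blast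
      then show "(\<lambda>n. ?f n \<omega>) \<longlonglongrightarrow> indicator (ends_event j) \<omega>"
      proof cases
        case 1
        then have "\<omega> \<in> ends_event j" using \<omega> by (simp add: ends_event_def)
        then show ?thesis
          using 1 \<omega> by (intro tendsto_eventually) (auto elim!: eventually_mono)
      next
        case 2
        then have "\<omega> \<notin> ends_event j"
          using eventually_conj[of "\<lambda>n. Y n \<omega> \<in> Site ` subtree T j" sequentially "\<lambda>n. Y n \<omega> \<notin> Site ` subtree T j"]
          by (auto simp: ends_event_def)
        then show ?thesis
          using 2 \<omega> by (intro tendsto_eventually) (auto elim!: eventually_mono)
      qed
    qed
  qed (auto simp: indicator_def)
  then show ?thesis by (simp add: ends_event_def Int_absorb2)
qed

text \<open>Summed over time, the mass balance expresses the final mass by the expected numbers of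
  crossings of the edge above \<open>j\<close>, which \<open>sums_visits\<close> gives in terms of
  \<open>habs\<close>.\<close>

lemma prob_ends_event:
  assumes "j \<in> sites T"
  shows "prob (ends_event j) = w 0 * flow habs j"
proof -
  let ?r = "Site (root T)"
  let ?D = "\<lambda>k. Pn k ?r (up j) * jp (up j) (Site j) - Pn k ?r (Site j) * jp (Site j) (up j)"
  have w0: "w 0 > 0" using w_pos by auto
  have A0: "prob {\<omega> \<in> space M. Y 0 \<omega> \<in> Site ` subtree T j} = of_bool (j = root T)"
  proof -
    have "prob {\<omega> \<in> space M. Y 0 \<omega> = ?r} = 1"
      using prob_Y[of ?r 0] by (simp add: states_def)
    then have ae: "AE \<omega> in M. Y 0 \<omega> = ?r"
      using prob_Collect_eq_1[of "\<lambda>\<omega>. Y 0 \<omega> = ?r"] by simp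
    have rs: "root T \<in> subtree T j \<longleftrightarrow> j = root T"
      using subtree_refl assms by (auto simp: subtree_def)
    have "prob {\<omega> \<in> space M. Y 0 \<omega> \<in> Site ` subtree T j} = prob (if j = root T then space M else {})"
    proof (rule finite_measure_eq_AE)
      show "AE \<omega> in M. (\<omega> \<in> {\<omega> \<in> space M. Y 0 \<omega> \<in> Site ` subtree T j}) = (\<omega> \<in> (if j = root T then space M else {}))"
        using ae AE_space by eventually_elim (use rs in auto)
    qed auto
    then show ?thesis by (simp add: prob_space)
  qed
  have "prob {\<omega> \<in> space M. Y n \<omega> \<in> Site ` subtree T j} = of_bool (j = root T) + (\<Sum>k<n. ?D k)" for n
    by (induction n) (simp_all only: A0 prob_subtree_Suc[OF assms] sum.lessThan_Suc lessThan_0 sum.empty add_0_right add.assoc)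
  then have lim: "(\<lambda>n. of_bool (j = root T) + (\<Sum>k<n. ?D k)) \<longlonglongrightarrow> prob (ends_event j)"
    using prob_subtree_tendsto[OF assms] by simp
  have s1: "(\<lambda>k. Pn k ?r (up j) * jp (up j) (Site j)) sums (of_bool (j \<noteq> root T) * (cond j * w 0 * habs (up j)))"
  proof (cases "j = root T")
    case True
    then show ?thesis by (simp add: up_def jp_Absorbed)
  next
    case False
    then have u: "up j = Site (parent T j)" "parent T j \<in> sites T" "j \<in> succs T (parent T j)"
      using assms parent_site by (auto simp: up_def succs_iff)
    have "cond j * w 0 * habs (up j) = rate (parent T j) * w 0 * habs (Site (parent T j)) * (cond j / rate (parent T j))"
      using u rate_pos[of "parent T j"] by simp
    then show ?thesis
      using sums_mult2[OF sums_visits[OF u(2)], of "cond j / rate (parent T j)"] u False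
      by (simp add: jp_succs)
  qed
  have s2: "(\<lambda>k. Pn k ?r (Site j) * jp (Site j) (up j)) sums (cond j * w 0 * habs (Site j))"
  proof -
    have "cond j * w 0 * habs (Site j) = rate j * w 0 * habs (Site j) * (cond j / rate j)"
      using rate_pos[of j] by simp
    then show ?thesis
      using sums_mult2[OF sums_visits[OF assms], of "cond j / rate j"] jp_up[OF assms] by simp
  qed
  \<comment> \<open>For the root, the initial mass 1 takes the place of crossings from
    \<open>Absorbed\<close>: it equals \<open>cond (root T) * w 0 * habs Absorbed\<close>.\<close>
  have "(\<lambda>n. of_bool (j = root T) + (\<Sum>k<n. ?D k)) \<longlonglongrightarrow>
      of_bool (j = root T) + (of_bool (j \<noteq> root T) * (cond j * w 0 * habs (up j)) - cond j * w 0 * habs (Site j))"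
    using sums_diff[OF s1 s2] unfolding sums_def by (intro tendsto_intros)
  from LIMSEQ_unique[OF lim this] show ?thesis
    using w0 by (auto simp: flow_def up_def habs_Absorbed cond_root algebra_simps)
qed

lemma flow_habs_nonneg: "j \<in> sites T \<Longrightarrow> 0 \<le> flow habs j"
  using prob_ends_event[of j] measure_nonneg[of M "ends_event j"] w_pos
  by (metis zero_le_mult_iff not_less)

definition escape :: "'o set" where
  "escape = {\<omega> \<in> space M. (\<forall>n. S n \<omega> < \<infinity>) \<and> (\<forall>n. Y n \<omega> \<noteq> Absorbed) \<and> (\<forall>m. \<exists>i\<in>lev m. \<omega> \<in> ends_event i)}"

lemma escape_sets [measurable]: "escape \<in> sets M"
proof -
  have [measurable]: "countable (lev m)" for m using finite_lev by (rule countable_finite)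
  show ?thesis unfolding escape_def by measurable
qed

text \<open>A walk that is never absorbed leaves each of the finitely many sites of level below
  \<open>m\<close> for ever, hence stays in the union of the subtrees of level \<open>m\<close>; by
  \<open>AE_ends_or_not\<close> it settles in one of them.\<close>

lemma AE_escape_iff: "AE \<omega> in M. \<omega> \<in> escape \<longleftrightarrow> (\<forall>n. Y n \<omega> \<noteq> Absorbed)"
  using AE_holding_finite AE_ends_or_not AE_leaves_site AE_space
proof eventually_elim
  case (elim \<omega>)
  have "\<exists>i\<in>lev m. \<omega> \<in> ends_event i" if na: "\<forall>n. Y n \<omega> \<noteq> Absorbed" for m
  proof (rule ccontr)
    assume "\<not> (\<exists>i\<in>lev m. \<omega> \<in> ends_event i)"
    then have "\<forall>i\<in>lev m. \<forall>\<^sub>F n in sequentially. Y n \<omega> \<notin> Site ` subtree T i"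
      using elim(2,4) by (auto simp: ends_event_def lev_def)
    then have e1: "\<forall>\<^sub>F n in sequentially. \<forall>i\<in>lev m. Y n \<omega> \<notin> Site ` subtree T i"
      by (simp add: eventually_ball_finite finite_lev)
    have "\<forall>i\<in>(\<Union>k<m. lev k). \<forall>\<^sub>F n in sequentially. Y n \<omega> \<noteq> Site i"
      using elim(3) by (auto simp: lev_def)
    then have e2: "\<forall>\<^sub>F n in sequentially. \<forall>i\<in>(\<Union>k<m. lev k). Y n \<omega> \<noteq> Site i"
      by (intro eventually_ball_finite) (auto simp: finite_lev)
    from eventually_conj[OF e1 e2] obtain n where n: "\<forall>i\<in>lev m. Y n \<omega> \<notin> Site ` subtree T i"
      "\<forall>i\<in>(\<Union>k<m. lev k). Y n \<omega> \<noteq> Site i"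
      unfolding eventually_sequentially by blast
    obtain j where j: "Y n \<omega> = Site j" "j \<in> sites T"
      using Y_states[OF elim(4), of n] na by (auto simp: states_def)
    have "m \<le> level T j" using n(2) j by (auto simp: lev_def not_less[symmetric])
    then show False using ex_ancestor[OF j(2)] n(1) j by blast
  qed
  then show ?case using elim by (auto simp: escape_def)
qed

lemma prob_escape: "prob escape = 1 - habs (Site (root T))"
proof -
  have "prob escape = prob (space M - {\<omega> \<in> space M. \<exists>n. Y n \<omega> = Absorbed})"
  proof (rule finite_measure_eq_AE)
    show "AE \<omega> in M. (\<omega> \<in> escape) = (\<omega> \<in> space M - {\<omega> \<in> space M. \<exists>n. Y n \<omega> = Absorbed})"
      using AE_escape_iff AE_space by eventually_elim auto
  qed auto
  then show ?thesis using prob_absorbed by (simp add: prob_compl)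
qed

text \<open>\<open>Absorbed\<close> lies in no subtree and is never left, so a walk that settles in
  a subtree has escaped almost surely.\<close>

lemma prob_escape_ends: "j \<in> sites T \<Longrightarrow> prob (escape \<inter> ends_event j) = w 0 * flow habs j"
proof -
  assume j: "j \<in> sites T"
  have "prob (escape \<inter> ends_event j) = prob (ends_event j)"
  proof (rule finite_measure_eq_AE)
    show "AE \<omega> in M. (\<omega> \<in> escape \<inter> ends_event j) = (\<omega> \<in> ends_event j)"
      using AE_escape_iff AE_absorbed
    proof eventually_elim
      case (elim \<omega>)
      have "Y n \<omega> \<noteq> Absorbed" if e: "\<omega> \<in> ends_event j" for n
      proof
        assume "Y n \<omega> = Absorbed"
        then have "\<forall>\<^sub>F m in sequentially. Y m \<omega> = Absorbed"
          using elim(2) by (auto simp: eventually_sequentially)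
        moreover have "\<forall>\<^sub>F m in sequentially. Y m \<omega> \<in> Site ` subtree T j"
          using e by (simp add: ends_event_def)
        ultimately have "\<forall>\<^sub>F m::nat in sequentially. False" by eventually_elim auto
        then show False by simp
      qed
      then show ?case using elim(1) by auto
    qed
  qed auto
  then show ?thesis by (simp add: prob_ends_event[OF j])
qed

end

section \<open>The exit law and the regular points\<close>

locale tree_chain = weighted_tree T w for T :: "'v rtree" and w +
  fixes P :: "'v \<Rightarrow> 'o measure" and X :: "real \<Rightarrow> 'o \<Rightarrow> 'v state"
    and Y :: "nat \<Rightarrow> 'o \<Rightarrow> 'v state" and S :: "nat \<Rightarrow> 'o \<Rightarrow> ennreal"
  assumes jump: "i \<in> sites T \<Longrightarrow> jump_chain T w (P i) i Y S"
    and path: "i \<in> sites T \<Longrightarrow> \<omega> \<in> space (P i) \<Longrightarrow> tree_path T w (\<lambda>n. Y n \<omega>) (\<lambda>n. S n \<omega>) X \<omega>"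
    and transient: "transient T P X"
begin

lemma prob_absorption:
  assumes "i \<in> sites T"
  shows "measure (P i) {\<omega> \<in> space (P i). absorption_time X \<omega> < \<infinity>} = habs (Site i)"
proof -
  interpret jump_chain T w "P i" i Y S by (rule jump[OF assms])
  have eq: "absorption_time X \<omega> < \<infinity> \<longleftrightarrow> (\<exists>n. Y n \<omega> = Absorbed \<and> (\<Sum>k<n. S k \<omega>) < \<infinity>)"
    if "\<omega> \<in> space (P i)" for \<omega>
    by (rule tree_path.absorption_finite_iff[OF path[OF assms that]])
  have "prob {\<omega> \<in> space (P i). absorption_time X \<omega> < \<infinity>}
      = prob {\<omega> \<in> space (P i). \<exists>n. Y n \<omega> = Absorbed \<and> (\<Sum>k<n. S k \<omega>) < \<infinity>}"
    by (rule arg_cong[where f = prob]) (use eq in auto)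
  also have "\<dots> = prob {\<omega> \<in> space (P i). \<exists>n. Y n \<omega> = Absorbed}"
  proof (rule finite_measure_eq_AE)
    show "AE \<omega> in P i. (\<omega> \<in> {\<omega> \<in> space (P i). \<exists>n. Y n \<omega> = Absorbed \<and> (\<Sum>k<n. S k \<omega>) < \<infinity>})
        = (\<omega> \<in> {\<omega> \<in> space (P i). \<exists>n. Y n \<omega> = Absorbed})"
      using AE_holding_finite
    proof eventually_elim
      case (elim \<omega>)
      have "\<exists>n. Y n \<omega> = Absorbed \<and> (\<Sum>k<n. S k \<omega>) < \<infinity>" if ab: "\<exists>n. Y n \<omega> = Absorbed"
      proof -
        \<comment> \<open>Before the first absorption only finite holding times have
          elapsed.\<close>
        obtain n where n: "Y n \<omega> = Absorbed" "\<And>m. m < n \<Longrightarrow> Y m \<omega> \<noteq> Absorbed"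
          using ab exists_least_iff[of "\<lambda>n. Y n \<omega> = Absorbed"] by blast
        then have "(\<Sum>k<n. S k \<omega>) < \<infinity>" using elim by (simp add: less_top[symmetric])
        then show ?thesis using n by blast
      qed
      then show ?case by blast
    qed
  qed measurable
  also have "\<dots> = habs (Site i)" by (rule prob_absorbed)
  finally show ?thesis .
qed

sublocale root_chain T w "P (root T)" Y S
  unfolding root_chain_def by (rule jump) simp

lemma escape_eq: "escape_event T P X = escape"
  using tree_path.exits_iff[OF path[OF root_site]]
  by (auto simp: escape_event_def escape_def ends_event_def)

lemma escape_pos: "0 < prob escape"
  using transient by (simp add: transient_def escape_eq)

lemma habs_root_less_1: "habs (Site (root T)) < 1"
  using escape_pos by (simp add: prob_escape)

abbreviation \<mu> :: "(nat \<Rightarrow> 'v) measure" where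
  "\<mu> \<equiv> exit_law T P X"

lemma boundary_nonempty: "(SOME \<xi>. \<xi> \<in> boundary T) \<in> boundary T"
  using ex_boundary[OF root_site] by (simp add: some_in_eq)

text \<open>Off the escape event the exit point is one fixed default ray, so that part of the
  preimage of a cylinder is either empty or the whole complement.\<close>

lemma exit_point_measurable [measurable]:
  "exit_point T X \<in> measurable (uniform_measure (P (root T)) escape) (boundary_sigma T)"
  unfolding boundary_sigma_def
proof (rule measurable_measure_of)
  show "cyl T ` sites T \<subseteq> Pow (boundary T)" using cyl_subset by blast
  have in_b: "exit_point T X \<omega> \<in> boundary T" if "\<omega> \<in> space (P (root T))" for \<omega>
  proof (cases "\<exists>\<xi>. exits_at T X \<omega> \<xi>")
    case True
    then show ?thesis
      using tree_path.exit_point_boundary[OF path[OF root_site that] True] by (simp add: exits_at_def)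
  next
    case False
    then show ?thesis using boundary_nonempty by (simp add: exit_point_def)
  qed
  then show "exit_point T X \<in> space (uniform_measure (P (root T)) escape) \<rightarrow> boundary T" by auto
  fix A assume "A \<in> cyl T ` sites T"
  then obtain i where i: "i \<in> sites T" "A = cyl T i" by auto
  have "exit_point T X -` A \<inter> space (P (root T)) =
      (escape \<inter> ends_event i) \<union> (if (SOME \<xi>. \<xi> \<in> boundary T) \<in> A then space (P (root T)) - escape else {})"
  proof (rule set_eqI)
    fix \<omega>
    show "\<omega> \<in> exit_point T X -` A \<inter> space (P (root T)) \<longleftrightarrow>
      \<omega> \<in> (escape \<inter> ends_event i) \<union> (if (SOME \<xi>. \<xi> \<in> boundary T) \<in> A then space (P (root T)) - escape else {})"
    proof (cases "\<omega> \<in> escape")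
      case True
      then have \<omega>: "\<omega> \<in> space (P (root T))" "\<exists>\<xi>. exits_at T X \<omega> \<xi>"
        using escape_eq by (auto simp: escape_event_def)
      then show ?thesis
        using tree_path.exit_point_cyl[OF path[OF root_site \<omega>(1)] \<omega>(2) i(1)] True i(2)
        by (auto simp: ends_event_def)
    next
      case False
      then have "\<omega> \<in> space (P (root T)) \<Longrightarrow> exit_point T X \<omega> = (SOME \<xi>. \<xi> \<in> boundary T)"
        using escape_eq unfolding escape_event_def exit_point_def by (auto simp del: some_in_eq)
      then show ?thesis using False by auto
    qed
  qed
  then show "exit_point T X -` A \<inter> space (uniform_measure (P (root T)) escape) \<in> sets (uniform_measure (P (root T)) escape)"
    by auto
qed

lemma escape_emeasure: "emeasure (P (root T)) escape \<noteq> 0" "emeasure (P (root T)) escape \<noteq> \<infinity>"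
  using escape_pos by (auto simp: emeasure_eq_measure)

sublocale bd: boundary_measure T \<mu>
proof -
  interpret u: prob_space "uniform_measure (P (root T)) escape"
    by (rule prob_space_uniform_measure[OF escape_emeasure])
  have "prob_space \<mu>"
    unfolding exit_law_def escape_eq by (rule u.prob_space_distr) measurable
  then show "boundary_measure T \<mu>"
    by (intro boundary_measure.intro boundary_measure_axioms.intro rooted_tree_axioms) (auto simp: exit_law_def)
qed

lemma measure_cyl:
  assumes "i \<in> sites T"
  shows "measure \<mu> (cyl T i) = w 0 * flow habs i / (1 - habs (Site (root T)))"
proof -
  have "exit_point T X -` cyl T i \<inter> space (P (root T)) \<inter> escape = escape \<inter> ends_event i"
  proof (rule set_eqI)
    fix \<omega>
    show "\<omega> \<in> exit_point T X -` cyl T i \<inter> space (P (root T)) \<inter> escape \<longleftrightarrow> \<omega> \<in> escape \<inter> ends_event i"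
    proof (cases "\<omega> \<in> escape")
      case True
      then have \<omega>: "\<omega> \<in> space (P (root T))" "\<exists>\<xi>. exits_at T X \<omega> \<xi>"
        using escape_eq by (auto simp: escape_event_def)
      then show ?thesis
        using tree_path.exit_point_cyl[OF path[OF root_site \<omega>(1)] \<omega>(2) assms] True
        by (auto simp: ends_event_def)
    qed auto
  qed
  then have eq: "escape \<inter> (exit_point T X -` cyl T i \<inter> space (P (root T))) = escape \<inter> ends_event i"
    by blast
  have "exit_point T X -` cyl T i \<inter> space (P (root T)) \<in> sets (P (root T))"
    using measurable_sets[OF exit_point_measurable cyl_sets[OF assms]] by simp
  then have "measure \<mu> (cyl T i) = prob (escape \<inter> ends_event i) / prob escape"
    unfolding exit_law_def escape_eq
    using measurable_sets[OF exit_point_measurable cyl_sets[OF assms]]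
    by (subst measure_distr) (auto simp: cyl_sets assms measure_uniform_measure escape_emeasure eq)
  then show ?thesis by (simp add: prob_escape prob_escape_ends[OF assms])
qed

lemma habs_parent_ge: "i \<in> sites T \<Longrightarrow> i \<noteq> root T \<Longrightarrow> habs (Site i) \<le> habs (Site (parent T i))"
  using flow_habs_nonneg[of i] cond_pos[of i] by (simp add: flow_def up_def zero_le_mult_iff)

lemma habs_subtree_le: "j \<in> subtree T i \<Longrightarrow> habs (Site j) \<le> habs (Site i)"
proof -
  assume j: "j \<in> subtree T i"
  then have "j \<in> sites T" by (rule subtree_site)
  then show ?thesis using j
  proof (induction j rule: site_induct)
    case root
    then show ?case by (auto simp: subtree_def)
  next
    case (step j)
    then show ?case using habs_parent_ge[of j] by (subst (asm) subtree_iff) auto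
  qed
qed

lemma decseq_habs: "\<xi> \<in> boundary T \<Longrightarrow> decseq (\<lambda>n. habs (Site (\<xi> n)))"
  by (auto simp: decseq_def intro!: habs_subtree_le boundary_subtree)

text \<open>Since \<open>habs\<close> decreases along the tree, its value at the top of a subtree
  bounds it on the whole subtree; the limit over sites near a ray reduces to the limit along the
  ray.\<close>

lemma regular_points_eq: "regular_points T P X = {\<xi> \<in> boundary T. (\<lambda>n. habs (Site (\<xi> n))) \<longlonglongrightarrow> 0}"
proof (intro set_eqI iffI)
  fix \<xi> assume "\<xi> \<in> regular_points T P X"
  then have xi: "\<xi> \<in> boundary T"
    and l: "((\<lambda>j. measure (P j) {\<omega> \<in> space (P j). absorption_time X \<omega> < \<infinity>}) \<longlongrightarrow> 0) (to_boundary T \<xi>)"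
    by (auto simp: regular_points_def)
  have "filterlim \<xi> (to_boundary T \<xi>) sequentially"
    unfolding filterlim_iff eventually_to_boundary[OF xi] eventually_sequentially
    using boundary_subtree[OF xi] by blast
  from filterlim_compose[OF l this] xi
  show "\<xi> \<in> {\<xi> \<in> boundary T. (\<lambda>n. habs (Site (\<xi> n))) \<longlonglongrightarrow> 0}"
    by (simp add: prob_absorption[simplified] boundary_site)
next
  fix \<xi> assume "\<xi> \<in> {\<xi> \<in> boundary T. (\<lambda>n. habs (Site (\<xi> n))) \<longlonglongrightarrow> 0}"
  then have xi: "\<xi> \<in> boundary T" and l: "(\<lambda>n. habs (Site (\<xi> n))) \<longlonglongrightarrow> 0" by auto
  have "((\<lambda>j. measure (P j) {\<omega> \<in> space (P j). absorption_time X \<omega> < \<infinity>}) \<longlongrightarrow> 0) (to_boundary T \<xi>)"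
  proof (rule tendstoI)
    fix e :: real assume "0 < e"
    then have "\<forall>\<^sub>F n in sequentially. habs (Site (\<xi> n)) < e"
      using order_tendstoD(2)[OF l] by simp
    then obtain n where n: "habs (Site (\<xi> n)) < e" by (auto simp: eventually_sequentially)
    show "\<forall>\<^sub>F j in to_boundary T \<xi>. dist (measure (P j) {\<omega> \<in> space (P j). absorption_time X \<omega> < \<infinity>}) 0 < e"
      unfolding eventually_to_boundary[OF xi]
      using prob_absorption[OF subtree_site] habs_subtree_le n by (intro exI[of _ n]) fastforce
  qed
  then show "\<xi> \<in> regular_points T P X" using xi by (simp add: regular_points_def)
qed

text \<open>The limit exists by monotonicity. Its integral is the limit of a constant multiple of
  \<open>lev_form habs habs\<close>, hence 0.\<close>

lemma AE_habs_tendsto_0: "AE \<xi> in \<mu>. (\<lambda>n. habs (Site (\<xi> n))) \<longlonglongrightarrow> 0"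
proof -
  let ?h = "\<lambda>n \<xi>. habs (Site (\<xi> n))"
  define L where "L \<xi> = lim (\<lambda>n. ?h n \<xi>)" for \<xi>
  have conv: "(\<lambda>n. ?h n \<xi>) \<longlonglongrightarrow> L \<xi>" if "\<xi> \<in> boundary T" for \<xi>
  proof -
    have "convergent (\<lambda>n. ?h n \<xi>)"
    proof -
      have "\<forall>n. 0 \<le> habs (Site (\<xi> n))"
        using boundary_site[OF that] by (intro allI habs_nonneg) (simp add: states_def)
      from decseq_convergent[OF decseq_habs[OF that] this] show ?thesis
        unfolding convergent_def by metis
    qed
    then show ?thesis by (simp add: L_def convergent_LIMSEQ_iff)
  qed
  have Lm: "L \<in> borel_measurable \<mu>"
    unfolding L_def by (intro borel_measurable_lim_metric bd.borel_coord)
  have Lnn: "0 \<le> L \<xi>" if "\<xi> \<in> boundary T" for \<xi>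
    using boundary_site[OF that]
    by (intro LIMSEQ_le_const[OF conv[OF that]]) (auto intro!: habs_nonneg simp: states_def)
  have bd: "0 \<le> ?h n \<xi> \<and> ?h n \<xi> \<le> 1" if "\<xi> \<in> boundary T" for \<xi> n
    using boundary_site[OF that] by (auto intro!: habs_nonneg habs_le_1 simp: states_def)
  have lims: "AE \<xi> in \<mu>. (\<lambda>n. ?h n \<xi>) \<longlonglongrightarrow> L \<xi>" using conv by (intro AE_I2) (simp add: bd.space_mu)
  have b1: "AE \<xi> in \<mu>. norm (?h n \<xi>) \<le> 1" for n using bd by (intro AE_I2) (auto simp: bd.space_mu)
  have i1: "(\<lambda>n. integral\<^sup>L \<mu> (?h n)) \<longlonglongrightarrow> integral\<^sup>L \<mu> L" and Li: "integrable \<mu> L"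
    using integral_dominated_convergence[OF Lm bd.borel_coord _ lims b1] integrable_dominated_convergence[OF Lm bd.borel_coord _ lims b1] by auto
  have "integral\<^sup>L \<mu> (?h n) = w 0 / (1 - habs (Site (root T))) * lev_form habs habs n" for n
    by (subst bd.integral_coord) (auto simp: lev_form_def lev_def measure_cyl sum_distrib_left intro!: sum.cong)
  moreover have "(\<lambda>n. w 0 / (1 - habs (Site (root T))) * lev_form habs habs n) \<longlonglongrightarrow> w 0 / (1 - habs (Site (root T))) * 0"
    by (intro tendsto_mult tendsto_const lev_form_habs_tendsto flow_habs_nonneg)
  ultimately have "integral\<^sup>L \<mu> L = 0" using LIMSEQ_unique[OF i1] by simp
  then have "AE \<xi> in \<mu>. L \<xi> = 0"
    using Lnn by (subst (asm) integral_nonneg_eq_0_iff_AE[OF Li]) (auto simp: bd.space_mu)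
  with lims show ?thesis by eventually_elim simp
qed

end

text \<open>In \<open>minimal_chain\<close> the processes \<open>Y\<close> and \<open>S\<close>
  serve all starting sites at once, so they can be fixed before the site.\<close>

lemma tree_chain_exists:
  assumes "infinite_tree T" "strict_mono w" "\<forall>n. 0 < w n" "minimal_chain T w P X" "transient T P X"
  shows "\<exists>Y S. tree_chain T w P X Y S"
proof -
  interpret weighted_tree T w using assms by unfold_locales auto
  from assms(4) obtain Y S where YS: "\<forall>i\<in>sites T.
       prob_space (P i)
       \<and> (\<forall>n. Y n \<in> measurable (P i) (count_space (insert Absorbed (Site ` sites T))))
       \<and> (\<forall>n. S n \<in> borel_measurable (P i))
       \<and> (\<forall>n. \<forall>\<omega>\<in>space (P i). 0 < S n \<omega>)
       \<and> (\<forall>n (y :: nat \<Rightarrow> 'a state) (s :: nat \<Rightarrow> real).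
            (\<forall>k\<le>n. y k \<in> insert Absorbed (Site ` sites T) \<and> 0 \<le> s k) \<longrightarrow>
            measure (P i) {\<omega> \<in> space (P i). \<forall>k\<le>n. Y k \<omega> = y k \<and> ennreal (s k) < S k \<omega>}
            = of_bool (y 0 = Site i)
              * (\<Prod>k<n. jump_prob (Qext T w) (y k) (y (Suc k)))
              * (\<Prod>k\<le>n. exp (Qext T w (y k) (y k) * s k)))
       \<and> (\<forall>\<omega>\<in>space (P i). \<forall>t\<ge>0.
            (\<forall>n. (\<Sum>k<n. S k \<omega>) \<le> ennreal t \<and> ennreal t < (\<Sum>k<Suc n. S k \<omega>)
                 \<longrightarrow> X t \<omega> = Y n \<omega>)
            \<and> ((\<Sum>k. S k \<omega>) \<le> ennreal t \<longrightarrow> X t \<omega> = Cemetery))"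
    unfolding minimal_chain_def by blast
  have "tree_chain T w P X Y S"
  proof (intro tree_chain.intro tree_chain_axioms.intro weighted_tree_axioms)
    fix i assume i: "i \<in> sites T"
    note YSi = bspec[OF YS i]
    interpret prob_space "P i" using YSi by blast
    show "jump_chain T w (P i) i Y S"
    proof (intro jump_chain.intro jump_chain_axioms.intro weighted_tree_axioms prob_space_axioms i)
      fix n
      show "Y n \<in> measurable (P i) (count_space (insert Absorbed (Site ` sites T)))" "S n \<in> borel_measurable (P i)"
        using YSi by blast+
    next
      fix n y and s :: "nat \<Rightarrow> real"
      assume "\<forall>k\<le>n. y k \<in> insert Absorbed (Site ` sites T) \<and> 0 \<le> s k"
      then show "measure (P i) {\<omega> \<in> space (P i). \<forall>k\<le>n. Y k \<omega> = y k \<and> ennreal (s k) < S k \<omega>}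
            = of_bool (y 0 = Site i)
              * (\<Prod>k<n. jump_prob (Qext T w) (y k) (y (Suc k)))
              * (\<Prod>k\<le>n. exp (Qext T w (y k) (y k) * s k))"
        using YSi by blast
    next
      show "0 < S n \<omega>" if "\<omega> \<in> space (P i)" for n \<omega> using YSi that by blast
    qed
    fix \<omega> assume \<omega>: "\<omega> \<in> space (P i)"
    have st: "Y n \<omega> \<in> states" for n
      using YSi \<omega> measurable_space[of "Y n" "P i"] unfolding states_def by fastforce
    show "tree_path T w (\<lambda>n. Y n \<omega>) (\<lambda>n. S n \<omega>) X \<omega>"
      by (intro tree_path.intro tree_path_axioms.intro weighted_tree_axioms) (use YSi \<omega> st in blast)+
  qed (rule assms)
  then show ?thesis by blast
qed

section \<open>Convergence and density in \<open>L\<^sup>2\<close>\<close>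

lemma L2_measurable: "L2 M f \<Longrightarrow> f \<in> borel_measurable M"
  and L2_square: "L2 M f \<Longrightarrow> integrable M (\<lambda>x. (f x)\<^sup>2)"
  by (auto simp: L2_def)

lemma sum_square_le: "(a + b)\<^sup>2 \<le> 2 * a\<^sup>2 + 2 * (b :: real)\<^sup>2"
  using zero_le_power2[of "a - b"] by (simp add: power2_eq_square algebra_simps)

lemma L2_cmult: "L2 M f \<Longrightarrow> L2 M (\<lambda>x. c * f x)"
  by (auto simp: L2_def power_mult_distrib)

lemma L2_add:
  assumes "L2 M f" "L2 M g"
  shows "L2 M (\<lambda>x. f x + g x)"
proof -
  have [measurable]: "f \<in> borel_measurable M" "g \<in> borel_measurable M"
    using assms by (auto simp: L2_def)
  have "integrable M (\<lambda>x. 2 * (f x)\<^sup>2 + 2 * (g x)\<^sup>2)"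
    using assms[THEN L2_square] by simp
  then have "integrable M (\<lambda>x. (f x + g x)\<^sup>2)"
  proof (rule Bochner_Integration.integrable_bound)
    show "AE x in M. norm ((f x + g x)\<^sup>2) \<le> norm (2 * (f x)\<^sup>2 + 2 * (g x)\<^sup>2)"
    proof (rule AE_I2)
      fix x
      show "norm ((f x + g x)\<^sup>2) \<le> norm (2 * (f x)\<^sup>2 + 2 * (g x)\<^sup>2)"
        using sum_square_le[of "f x" "g x"] by simp
    qed
  qed measurable
  then show ?thesis by (simp add: L2_def)
qed

lemma L2_diff: "L2 M f \<Longrightarrow> L2 M g \<Longrightarrow> L2 M (\<lambda>x. f x - g x)"
  using L2_add[of M f "\<lambda>x. -1 * g x"] L2_cmult[of M g "-1"] by simp

lemma L2_zero: "L2 M (\<lambda>x. 0)"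
  by (simp add: L2_def)

lemma L2_sum: "(\<And>i. i \<in> I \<Longrightarrow> L2 M (f i)) \<Longrightarrow> L2 M (\<lambda>x. \<Sum>i\<in>I. f i x)"
  by (induction I rule: infinite_finite_induct) (auto simp: L2_zero L2_add)

lemma L2_cong_AE: "L2 M f \<Longrightarrow> g \<in> borel_measurable M \<Longrightarrow> AE x in M. f x = g x \<Longrightarrow> L2 M g"
  unfolding L2_def by (auto intro: integrable_cong_AE_imp)

lemma L2_bounded:
  assumes "finite_measure M" "f \<in> borel_measurable M" "AE x in M. \<bar>f x\<bar> \<le> (B :: real)"
  shows "L2 M f"
proof -
  interpret finite_measure M by fact
  have "AE x in M. norm ((f x)\<^sup>2) \<le> B\<^sup>2"
    using assms(3)
  proof eventually_elim
    case (elim x)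
    then have "\<bar>f x\<bar> \<le> \<bar>B\<bar>" by simp
    then show ?case by (simp add: abs_le_square_iff)
  qed
  then show ?thesis
    using assms unfolding L2_def by (intro conjI integrable_const_bound) auto
qed

lemma integral_square_add_le:
  assumes "L2 M f" "L2 M g"
  shows "(\<integral>x. (f x + g x)\<^sup>2 \<partial>M) \<le> 2 * (\<integral>x. (f x)\<^sup>2 \<partial>M) + 2 * (\<integral>x. (g x)\<^sup>2 \<partial>M)"
proof -
  have "(\<integral>x. (f x + g x)\<^sup>2 \<partial>M) \<le> (\<integral>x. 2 * (f x)\<^sup>2 + 2 * (g x)\<^sup>2 \<partial>M)"
    using L2_square[OF L2_add[OF assms]] L2_square[OF assms(1)] L2_square[OF assms(2)] sum_square_le
    by (intro integral_mono) auto
  then show ?thesis using L2_square[OF assms(1)] L2_square[OF assms(2)] by simp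
qed

text \<open>Convergence is handled through integrals of squares: \<open>sum_square_le\<close> then
  plays the part of the triangle inequality, at the price of factors 2.\<close>

lemma L2_tendsto_iff:
  "L2_tendsto M u v F \<longleftrightarrow> (\<forall>\<^sub>F t in F. L2 M (u t)) \<and> L2 M v \<and> ((\<lambda>t. \<integral>x. (u t x - v x)\<^sup>2 \<partial>M) \<longlongrightarrow> 0) F"
proof -
  have "((\<lambda>t. sqrt (\<integral>x. (u t x - v x)\<^sup>2 \<partial>M)) \<longlongrightarrow> 0) F \<longleftrightarrow> ((\<lambda>t. \<integral>x. (u t x - v x)\<^sup>2 \<partial>M) \<longlongrightarrow> 0) F"
  proof
    assume "((\<lambda>t. sqrt (\<integral>x. (u t x - v x)\<^sup>2 \<partial>M)) \<longlongrightarrow> 0) F"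
    then have "((\<lambda>t. (sqrt (\<integral>x. (u t x - v x)\<^sup>2 \<partial>M))\<^sup>2) \<longlongrightarrow> 0\<^sup>2) F" by (rule tendsto_power)
    then show "((\<lambda>t. \<integral>x. (u t x - v x)\<^sup>2 \<partial>M) \<longlongrightarrow> 0) F" by simp
  next
    assume "((\<lambda>t. \<integral>x. (u t x - v x)\<^sup>2 \<partial>M) \<longlongrightarrow> 0) F"
    from tendsto_real_sqrt[OF this] show "((\<lambda>t. sqrt (\<integral>x. (u t x - v x)\<^sup>2 \<partial>M)) \<longlongrightarrow> 0) F" by simp
  qed
  then show ?thesis by (simp add: L2_tendsto_def L2_norm_def)
qed

lemma L2_tendsto_le:
  assumes "\<forall>\<^sub>F t in F. L2 M (u t)" "L2 M v"
    and "\<forall>\<^sub>F t in F. (\<integral>x. (u t x - v x)\<^sup>2 \<partial>M) \<le> e t" "(e \<longlongrightarrow> 0) F"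
  shows "L2_tendsto M u v F"
  unfolding L2_tendsto_iff
  using assms by (auto intro: tendsto_sandwich[OF _ assms(3) tendsto_const assms(4)])

lemma L2_tendsto_add:
  assumes "L2_tendsto M u v F" "L2_tendsto M u' v' F"
  shows "L2_tendsto M (\<lambda>t x. u t x + u' t x) (\<lambda>x. v x + v' x) F"
proof (rule L2_tendsto_le)
  note a = assms[unfolded L2_tendsto_iff]
  show "\<forall>\<^sub>F t in F. L2 M (\<lambda>x. u t x + u' t x)"
    using a by (auto intro: eventually_elim2[where P = "\<lambda>t. L2 M (u t)" and Q = "\<lambda>t. L2 M (u' t)"] L2_add)
  show "L2 M (\<lambda>x. v x + v' x)" using a by (auto intro: L2_add)
  have "\<forall>\<^sub>F t in F. L2 M (u t) \<and> L2 M (u' t)" using a by (auto intro: eventually_conj)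
  then show "\<forall>\<^sub>F t in F. (\<integral>x. (u t x + u' t x - (v x + v' x))\<^sup>2 \<partial>M)
      \<le> 2 * (\<integral>x. (u t x - v x)\<^sup>2 \<partial>M) + 2 * (\<integral>x. (u' t x - v' x)\<^sup>2 \<partial>M)"
  proof eventually_elim
    case (elim t)
    have "(\<integral>x. (u t x + u' t x - (v x + v' x))\<^sup>2 \<partial>M) = (\<integral>x. ((u t x - v x) + (u' t x - v' x))\<^sup>2 \<partial>M)"
      by (rule Bochner_Integration.integral_cong) (auto simp: algebra_simps)
    then show ?case using integral_square_add_le[of M "\<lambda>x. u t x - v x" "\<lambda>x. u' t x - v' x"] a elim
      by (auto intro: L2_diff)
  qed
  show "((\<lambda>t. 2 * (\<integral>x. (u t x - v x)\<^sup>2 \<partial>M) + 2 * (\<integral>x. (u' t x - v' x)\<^sup>2 \<partial>M)) \<longlongrightarrow> 0) F"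
    using a by (auto intro!: tendsto_eq_intros)
qed

lemma L2_tendsto_cmult:
  assumes "L2_tendsto M u v F"
  shows "L2_tendsto M (\<lambda>t x. c * u t x) (\<lambda>x. c * v x) F"
proof (rule L2_tendsto_le)
  note a = assms[unfolded L2_tendsto_iff]
  show "\<forall>\<^sub>F t in F. L2 M (\<lambda>x. c * u t x)" "L2 M (\<lambda>x. c * v x)"
    using a by (auto elim!: eventually_mono intro: L2_cmult)
  show "\<forall>\<^sub>F t in F. (\<integral>x. (c * u t x - c * v x)\<^sup>2 \<partial>M) \<le> c\<^sup>2 * (\<integral>x. (u t x - v x)\<^sup>2 \<partial>M)"
    by (intro always_eventually) (simp flip: right_diff_distrib add: power_mult_distrib)
  show "((\<lambda>t. c\<^sup>2 * (\<integral>x. (u t x - v x)\<^sup>2 \<partial>M)) \<longlongrightarrow> 0) F"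
    using a by (auto intro!: tendsto_eq_intros)
qed

lemma L2_tendsto_const: "L2 M f \<Longrightarrow> L2_tendsto M (\<lambda>_. f) f F"
  by (simp add: L2_tendsto_iff)

lemma L2_tendsto_cong_AE:
  assumes "L2_tendsto M u v F" "\<forall>\<^sub>F t in F. L2 M (u' t) \<and> (AE x in M. u t x = u' t x)"
    and "L2 M v'" "AE x in M. v x = v' x"
  shows "L2_tendsto M u' v' F"
proof (rule L2_tendsto_le)
  note a = assms(1)[unfolded L2_tendsto_iff]
  show "\<forall>\<^sub>F t in F. L2 M (u' t)" using assms(2) by (rule eventually_mono) simp
  show "((\<lambda>t. \<integral>x. (u t x - v x)\<^sup>2 \<partial>M) \<longlongrightarrow> 0) F" using a by simp
  have "\<forall>\<^sub>F t in F. L2 M (u t)" using a by simp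
  then show "\<forall>\<^sub>F t in F. (\<integral>x. (u' t x - v' x)\<^sup>2 \<partial>M) \<le> (\<integral>x. (u t x - v x)\<^sup>2 \<partial>M)"
    using assms(2)
  proof eventually_elim
    case (elim t)
    have [measurable]: "u t \<in> borel_measurable M" "u' t \<in> borel_measurable M" "v \<in> borel_measurable M" "v' \<in> borel_measurable M"
      using elim a assms(3) by (auto simp: L2_def)
    have "AE x in M. u t x = u' t x" using elim by simp
    then have "AE x in M. (u' t x - v' x)\<^sup>2 = (u t x - v x)\<^sup>2"
      using assms(4) by eventually_elim simp
    then have "(\<integral>x. (u' t x - v' x)\<^sup>2 \<partial>M) = (\<integral>x. (u t x - v x)\<^sup>2 \<partial>M)"
      by (intro integral_cong_AE) auto
    then show ?case by simp
  qed
qed (rule assms(3))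

lemma L2_tendsto_unique:
  assumes "F \<noteq> bot" "L2_tendsto M u v F" "L2_tendsto M u v' F"
  shows "AE x in M. v x = v' x"
proof -
  have v: "L2 M v" "L2 M v'" using assms by (auto simp: L2_tendsto_iff)
  have "L2_tendsto M (\<lambda>t x. u t x + (-1) * u t x) (\<lambda>x. v x + (-1) * v' x) F"
    by (intro L2_tendsto_add L2_tendsto_cmult assms)
  then have "((\<lambda>t. \<integral>x. (v x - v' x)\<^sup>2 \<partial>M) \<longlongrightarrow> 0) F"
    by (simp add: L2_tendsto_iff power2_commute)
  then have "(\<integral>x. (v x - v' x)\<^sup>2 \<partial>M) = 0"
    using assms(1) by (simp add: tendsto_const_iff)
  then have "AE x in M. (v x - v' x)\<^sup>2 = 0"
    using L2_square[OF L2_diff[OF v]] by (subst (asm) integral_nonneg_eq_0_iff_AE) auto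
  then show ?thesis by simp
qed

lemma L2_tendsto_dominated:
  assumes "\<And>n. u n \<in> borel_measurable M" "v \<in> borel_measurable M" "L2 M g"
    and "AE x in M. (\<lambda>n. u n x) \<longlonglongrightarrow> v x" "\<And>n. AE x in M. \<bar>u n x\<bar> \<le> g x"
  shows "L2_tendsto M u v sequentially"
proof -
  have [measurable]: "\<And>n. u n \<in> borel_measurable M" "v \<in> borel_measurable M" "g \<in> borel_measurable M"
    using assms by (auto simp: L2_def)
  have bnd: "AE x in M. \<forall>n. \<bar>u n x\<bar> \<le> g x"
    using assms(5) by (simp add: AE_all_countable)
  have vg: "AE x in M. \<bar>v x\<bar> \<le> g x"
    using assms(4) bnd
  proof eventually_elim
    case (elim x)
    from tendsto_rabs[OF elim(1)] show ?case
      by (rule LIMSEQ_le_const2) (use elim(2) in auto)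
  qed
  have l2: "L2 M f" if [measurable]: "f \<in> borel_measurable M" and "AE x in M. \<bar>f x\<bar> \<le> g x" for f
    unfolding L2_def
  proof
    have sq: "AE x in M. norm ((f x)\<^sup>2) \<le> norm ((g x)\<^sup>2)"
      using that(2)
    proof eventually_elim
      case (elim x)
      then have "\<bar>f x\<bar> \<le> \<bar>g x\<bar>" by simp
      then show ?case by (simp add: abs_le_square_iff)
    qed
    show "integrable M (\<lambda>x. (f x)\<^sup>2)"
      using L2_square[OF assms(3)]
      by (rule Bochner_Integration.integrable_bound)
        (use that(2) sq in auto)
  qed simp
  have "(\<lambda>n. \<integral>x. (u n x - v x)\<^sup>2 \<partial>M) \<longlonglongrightarrow> (\<integral>x. 0 \<partial>M)"
  \<comment> \<open>The bound is the square of \<open>2 * g\<close>, since both \<open>u n\<close>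
    and \<open>v\<close> are dominated by \<open>g\<close>.\<close>
  proof (rule integral_dominated_convergence[where w = "\<lambda>x. 4 * (g x)\<^sup>2"])
    show "integrable M (\<lambda>x. 4 * (g x)\<^sup>2)" using L2_square[OF assms(3)] by simp
    show "AE x in M. (\<lambda>n. (u n x - v x)\<^sup>2) \<longlonglongrightarrow> 0"
      using assms(4)
    proof eventually_elim
      case (elim x)
      have "(\<lambda>n. (u n x - v x)\<^sup>2) \<longlonglongrightarrow> (v x - v x)\<^sup>2" by (intro tendsto_intros elim)
      then show ?case by simp
    qed
    show "AE x in M. norm ((u n x - v x)\<^sup>2) \<le> 4 * (g x)\<^sup>2" for n
      using assms(5)[of n] vg
    proof eventually_elim
      case (elim x)
      then have "\<bar>u n x - v x\<bar> \<le> \<bar>2 * g x\<bar>" by linarith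
      then have "(u n x - v x)\<^sup>2 \<le> (2 * g x)\<^sup>2" by (simp only: abs_le_square_iff)
      then show ?case by (simp add: power_mult_distrib)
    qed
  qed auto
  then show ?thesis
    unfolding L2_tendsto_iff using l2 assms(5) vg by (auto intro!: always_eventually)
qed

lemma (in finite_measure) L2_integrable: "L2 M f \<Longrightarrow> integrable M f"
  unfolding L2_def using square_integrable_imp_integrable by blast

text \<open>A monotone class argument for properties closed under linear combinations and limits in
  L2: from a pi-system to all measurable sets, then to simple functions, then to square-integrable
  functions.\<close>

lemma (in finite_measure) L2_dense_induct:
  assumes f: "L2 M f"
    and gen: "sets M = sigma_sets (space M) G" "Int_stable G" "G \<subseteq> Pow (space M)" "space M \<in> G"
    and basic: "\<And>A. A \<in> G \<Longrightarrow> Q (indicator A)"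
    and lin: "\<And>u v a b. L2 M u \<Longrightarrow> L2 M v \<Longrightarrow> Q u \<Longrightarrow> Q v \<Longrightarrow> Q (\<lambda>x. a * u x + b * v x)"
    and lim: "\<And>u v. L2_tendsto M u v sequentially \<Longrightarrow> (\<And>n. Q (u n)) \<Longrightarrow> Q v"
  shows "Q f"
proof -
  have l2i: "L2 M (indicator A)" if "A \<in> sets M" for A
    using that by (intro L2_bounded[where B = 1] finite_measure_axioms) (auto simp: indicator_def)
  \<comment> \<open>A constant sequence converges in L2 to every function equal to it almost
    everywhere, so \<open>lim\<close> also allows a change of representative.\<close>
  have ext: "Q v" if "Q u" "L2 M u" "v \<in> borel_measurable M" "\<And>x. x \<in> space M \<Longrightarrow> u x = v x" for u v
  proof -
    have "AE x in M. u x = v x" using that(4) by (intro AE_I2)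
    then show ?thesis
      using that(1-3) lim[of "\<lambda>_. u" v]
        L2_tendsto_cong_AE[OF L2_tendsto_const[OF that(2)], where u' = "\<lambda>_. u" and v' = v and F = sequentially]
      by (auto intro: L2_cong_AE)
  qed
  have ind: "Q (indicator A)" if "A \<in> sets M" for A
    using gen(2,3) that[unfolded gen(1)]
  proof (induction rule: sigma_sets_induct_disjoint)
    case (basic A)
    then show ?case by (rule assms(6))
  next
    case empty
    have "Q (\<lambda>x. 0 * indicator (space M) x + 0 * indicator (space M) x)"
      by (intro lin l2i basic gen sets.top)
    then show ?case by (rule ext) (auto simp: L2_zero)
  next
    case (compl A)
    have A: "A \<in> sets M" using compl by (simp add: gen(1))
    have "Q (\<lambda>x. 1 * indicator (space M) x + (-1) * indicator A x)"
      by (intro lin l2i basic gen sets.top A compl)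
    then show ?case
    proof (rule ext)
      show "L2 M (\<lambda>x. 1 * indicator (space M) x + (-1) * indicator A x)"
        by (intro L2_add L2_cmult l2i A sets.top)
    qed (use A in \<open>auto simp: indicator_def\<close>)
  next
    case (union A)
    have A: "A i \<in> sets M" for i using union by (auto simp: gen(1))
    have "L2_tendsto M (\<lambda>n x. \<Sum>i<n. indicator (A i) x) (indicator (\<Union>i. A i)) sequentially"
    proof (rule L2_tendsto_dominated[where g = "\<lambda>_. 1"])
      show "L2 M (\<lambda>_. 1)" by (intro L2_bounded[where B = 1] finite_measure_axioms) auto
      have part: "(\<Sum>i<n. indicator (A i) x) = (indicator (\<Union>i<n. A i) x :: real)" for n x
        using union(1) by (intro indicator_UN_disjoint[symmetric]) (auto simp: disjoint_family_on_def)
      show "AE x in M. (\<lambda>n. \<Sum>i<n. indicator (A i) x) \<longlonglongrightarrow> (indicator (\<Union>i. A i) x :: real)"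
        unfolding part by (intro AE_I2 LIMSEQ_indicator_UN)
      show "AE x in M. \<bar>\<Sum>i<n. indicator (A i) x :: real\<bar> \<le> 1" for n
        unfolding part by (auto simp: indicator_def)
    qed (use A in auto)
    moreover have "Q (\<lambda>x. \<Sum>i<n. indicator (A i) x)" for n
    proof (induction n)
      case 0
      have "Q (\<lambda>x. 0 * indicator (space M) x + 0 * indicator (space M) x)"
        by (intro lin l2i basic gen sets.top)
      then show ?case by simp
    next
      case (Suc n)
      have "Q (\<lambda>x. 1 * (\<Sum>i<n. indicator (A i) x) + 1 * indicator (A n) x)"
        by (intro lin L2_sum l2i A Suc union)
      then show ?case by simp
    qed
    ultimately show ?case by (rule lim)
  qed
  have simple: "Q s" if s: "simple_function M s" for s :: "'a \<Rightarrow> real"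
  proof -
    have [measurable]: "s \<in> borel_measurable M" using s by (rule borel_measurable_simple_function)
    have lev: "s -` {y} \<inter> space M \<in> sets M" for y by measurable
    have Qsum: "Q (\<lambda>x. \<Sum>y\<in>J. y * indicator (s -` {y} \<inter> space M) x)" if "finite J" for J
      using that
    proof (induction J)
      case empty
      have "Q (\<lambda>x. 0 * indicator (space M) x + 0 * indicator (space M) x)"
        by (intro lin l2i basic gen sets.top)
      then show ?case by simp
    next
      case (insert y J)
      have "Q (\<lambda>x. y * indicator (s -` {y} \<inter> space M) x + 1 * (\<Sum>y\<in>J. y * indicator (s -` {y} \<inter> space M) x))"
        by (intro lin L2_sum L2_cmult l2i lev ind insert)
      then show ?case by (simp only: sum.insert[OF insert(1,2)] mult_1)
    qed
    have fin: "finite (s ` space M)" using s by (simp add: simple_function_def)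
    from Qsum[OF this] show ?thesis
    proof (rule ext)
      show "L2 M (\<lambda>x. \<Sum>y\<in>s ` space M. y * indicator (s -` {y} \<inter> space M) x)"
        by (intro L2_sum L2_cmult l2i lev)
      fix x assume x: "x \<in> space M"
      show "(\<Sum>y\<in>s ` space M. y * indicator (s -` {y} \<inter> space M) x) = s x"
        using x fin by (subst sum.remove[of _ "s x"]) (auto simp: indicator_def intro!: sum.neutral)
    qed simp
  qed
  have [measurable]: "f \<in> borel_measurable M" using f by (rule L2_measurable)
  obtain s where s: "\<And>i. simple_function M (s i)" "\<And>x. x \<in> space M \<Longrightarrow> (\<lambda>i. s i x) \<longlonglongrightarrow> f x"
    "\<And>i x. x \<in> space M \<Longrightarrow> dist (s i x) 0 \<le> 2 * dist (f x) 0"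
  proof -
    from borel_measurable_implies_sequence_metric[of f M 0]
    obtain s where "(\<forall>i. simple_function M (s i)) \<and> (\<forall>x\<in>space M. (\<lambda>i. s i x) \<longlonglongrightarrow> f x)
        \<and> (\<forall>i. \<forall>x\<in>space M. dist (s i x) 0 \<le> 2 * dist (f x) 0)"
      by (elim exE meta_impE) simp_all
    then show thesis by (intro that[of s]) blast+
  qed
  have "L2_tendsto M s f sequentially"
  proof (rule L2_tendsto_dominated[where g = "\<lambda>x. 2 * \<bar>f x\<bar>"])
    show "L2 M (\<lambda>x. 2 * \<bar>f x\<bar>)" using f by (intro L2_cmult) (auto simp: L2_def)
  qed (use s in \<open>auto intro: borel_measurable_simple_function simp: dist_norm\<close>)
  from this simple[OF s(1)] show ?thesis by (rule lim)
qed

section \<open>Hierarchical kernels on the boundary\<close>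

text \<open>\<open>gam\<close> is a multiple of the absorption probability, normalised so that \<open>G\<^sub>n\<^sub>+\<^sub>1(\<xi>) = gam (\<xi> n)\<close>
  on regular points.\<close>

locale potential_tree = boundary_measure T \<mu> + weighted_tree T w
  for T :: "'v rtree" and \<mu> and w +
  fixes gam :: "'v \<Rightarrow> real" and R :: "(nat \<Rightarrow> 'v) set"
  assumes gam_pos: "i \<in> sites T \<Longrightarrow> 0 < gam i"
    and gam_step: "i \<in> sites T \<Longrightarrow> i \<noteq> root T \<Longrightarrow>
      gam (parent T i) - gam i = delta w (level T i) * measure \<mu> (cyl T i)"
    and R_def: "R = {\<xi> \<in> boundary T. (\<lambda>n. gam (\<xi> n)) \<longlonglongrightarrow> 0}"
    and AE_gam: "AE \<xi> in \<mu>. (\<lambda>n. gam (\<xi> n)) \<longlonglongrightarrow> 0"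
begin

abbreviation m :: "'v \<Rightarrow> real" where
  "m i \<equiv> measure \<mu> (cyl T i)"

lemma AE_R: "AE \<xi> in \<mu>. \<xi> \<in> R"
  using AE_gam AE_space by eventually_elim (auto simp: R_def space_mu)

lemma R_boundary: "\<xi> \<in> R \<Longrightarrow> \<xi> \<in> boundary T"
  by (simp add: R_def)

lemma R_sets [measurable]: "R \<in> sets \<mu>"
proof -
  have "R = {\<xi> \<in> space \<mu>. (\<lambda>n. gam (\<xi> n)) \<longlonglongrightarrow> 0}" by (simp add: R_def space_mu)
  also have "\<dots> \<in> sets \<mu>" by measurable
  finally show ?thesis .
qed

lemma pred_coord_eq [measurable]: "Measurable.pred \<mu> (\<lambda>\<xi>. \<xi> n = i)"
proof -
  have "Measurable.pred \<mu> (\<lambda>\<xi>. of_bool (\<xi> n = i) = (1 :: real))"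
    using borel_coord[where \<phi> = "\<lambda>j. of_bool (j = i) :: real" and n = n] by measurable
  then show ?thesis by simp
qed

definition cker :: "('v \<Rightarrow> real) \<Rightarrow> (nat \<Rightarrow> 'v) \<Rightarrow> (nat \<Rightarrow> 'v) \<Rightarrow> ennreal" where
  "cker b \<xi> \<eta> = (\<Sum>n. ennreal (b (\<xi> n)) * of_bool (\<xi> n = \<eta> n))"

text \<open>The conversion \<open>enn2real\<close> sends \<infinity> to 0. For weights that have a
  symbol, \<open>AE_cker_finite\<close> shows that at a regular \<xi> this concerns a null set of
  \<eta>.\<close>

definition Kop :: "('v \<Rightarrow> real) \<Rightarrow> ((nat \<Rightarrow> 'v) \<Rightarrow> real) \<Rightarrow> (nat \<Rightarrow> 'v) \<Rightarrow> real" where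
  "Kop b f \<xi> = (\<integral>\<eta>. enn2real (cker b \<xi> \<eta>) * f \<eta> \<partial>\<mu>)"

text \<open>Where the indicator is not 0, the weight is read at the common site of the two
  rays.\<close>

lemma cker_sym: "cker b \<xi> \<eta> = cker b \<eta> \<xi>"
  unfolding cker_def by (intro suminf_cong) (auto simp: of_bool_def)

lemma cker_measurable2 [measurable]: "(\<lambda>(\<xi>, \<eta>). cker b \<xi> \<eta>) \<in> borel_measurable (\<mu> \<Otimes>\<^sub>M \<mu>)"
proof -
  have "(\<lambda>(\<xi>, \<eta>). ennreal (b (\<xi> n)) * of_bool (\<xi> n = \<eta> n)) \<in> borel_measurable (\<mu> \<Otimes>\<^sub>M \<mu>)" for n
  proof -
    have [measurable]: "cyl T i \<in> sets \<mu>" if "i \<in> lev n" for i using that cyl_mu by (simp add: lev_def)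
    have "(\<lambda>(\<xi>, \<eta>). \<Sum>i\<in>lev n. ennreal (b i) * (indicator (cyl T i) \<xi> * indicator (cyl T i) \<eta>)) \<in> borel_measurable (\<mu> \<Otimes>\<^sub>M \<mu>)"
      unfolding case_prod_beta by (intro borel_measurable_sum) simp
    also have "?this \<longleftrightarrow> ?thesis"
    proof (rule measurable_cong)
      fix x assume x: "x \<in> space (\<mu> \<Otimes>\<^sub>M \<mu>)"
      then have b: "fst x \<in> boundary T" "snd x \<in> boundary T" by (auto simp: space_pair_measure space_mu)
      show "(case x of (\<xi>, \<eta>) \<Rightarrow> \<Sum>i\<in>lev n. ennreal (b i) * (indicator (cyl T i) \<xi> * indicator (cyl T i) \<eta>))
          = (case x of (\<xi>, \<eta>) \<Rightarrow> ennreal (b (\<xi> n)) * of_bool (\<xi> n = \<eta> n))"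
        unfolding case_prod_beta using boundary_lev[OF b(1), of n] b
        by (subst sum.remove[of _ "fst x n"])
           (auto simp: finite_lev mem_cyl_lev indicator_def intro!: sum.neutral)
    qed
    finally show ?thesis .
  qed
  then show ?thesis unfolding cker_def case_prod_beta by (rule borel_measurable_suminf_order)
qed

lemma cker_measurable [measurable]: "\<xi> \<in> boundary T \<Longrightarrow> cker b \<xi> \<in> borel_measurable \<mu>"
  using measurable_compose[OF measurable_Pair1' cker_measurable2] by (simp add: space_mu)

text \<open>\<open>symbol b L\<close>: the operator with kernel \<^term>\<open>cker b\<close> multiplies the martingale increments of
  level \<open>n\<close> by \<open>L (\<xi> n)\<close>, the tail sum of the weights; \<open>L\<close> is constant on siblings, so increments
  are mapped to increments.\<close>

definition symbol :: "('v \<Rightarrow> real) \<Rightarrow> ('v \<Rightarrow> real) \<Rightarrow> bool" where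
  "symbol b L \<longleftrightarrow> (\<forall>i\<in>sites T. 0 \<le> b i)
     \<and> (\<forall>\<xi>\<in>R. \<forall>n. (\<lambda>k. b (\<xi> (n + k)) * m (\<xi> (n + k))) sums L (\<xi> n))
     \<and> (\<forall>i\<in>sites T. \<forall>j\<in>succs T i. \<forall>k\<in>succs T i. L j = L k)"

lemma symbol_nonneg: "symbol b L \<Longrightarrow> i \<in> sites T \<Longrightarrow> 0 \<le> b i"
  and symbol_sums: "symbol b L \<Longrightarrow> \<xi> \<in> R \<Longrightarrow> (\<lambda>k. b (\<xi> (n + k)) * m (\<xi> (n + k))) sums L (\<xi> n)"
  and symbol_siblings: "symbol b L \<Longrightarrow> j \<in> succs T i \<Longrightarrow> k \<in> succs T i \<Longrightarrow> L j = L k"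
  unfolding symbol_def using succs_site by blast+

lemma symbol_sums_root: "symbol b L \<Longrightarrow> \<xi> \<in> R \<Longrightarrow> (\<lambda>k. b (\<xi> k) * m (\<xi> k)) sums L (root T)"
  using symbol_sums[of b L \<xi> 0] by (simp add: boundary_0 R_boundary)

lemma nn_integral_cyl_coord:
  "\<xi> \<in> boundary T \<Longrightarrow> (\<integral>\<^sup>+\<eta>. c * of_bool (\<xi> n = \<eta> n) \<partial>\<mu>) = c * ennreal (m (\<xi> n))"
proof -
  assume \<xi>: "\<xi> \<in> boundary T"
  have "(\<integral>\<^sup>+\<eta>. c * of_bool (\<xi> n = \<eta> n) \<partial>\<mu>) = (\<integral>\<^sup>+\<eta>. c * indicator (cyl T (\<xi> n)) \<eta> \<partial>\<mu>)"
    by (rule nn_integral_cong) (auto simp: space_mu mem_cyl_boundary[OF \<xi>] indicator_def)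
  then show ?thesis
    using cyl_mu[OF boundary_site[OF \<xi>]] by (simp add: nn_integral_cmult_indicator emeasure_eq_measure)
qed

lemma measurable_coord_eq [measurable]: "(\<lambda>\<eta>. of_bool (\<xi> n = \<eta> n) :: ennreal) \<in> borel_measurable \<mu>"
  using borel_coord[where \<phi> = "\<lambda>j. of_bool (\<xi> n = j)" and n = n] .

lemma mass_cker:
  assumes "symbol b L" "\<xi> \<in> R"
  shows "(\<integral>\<^sup>+\<eta>. cker b \<xi> \<eta> \<partial>\<mu>) = ennreal (L (root T))"
proof -
  have \<xi>: "\<xi> \<in> boundary T" using assms by (simp add: R_boundary)
  have nn: "0 \<le> b (\<xi> n)" for n using symbol_nonneg[OF assms(1) boundary_site[OF \<xi>]] .
  have "(\<integral>\<^sup>+\<eta>. cker b \<xi> \<eta> \<partial>\<mu>) = (\<Sum>n. ennreal (b (\<xi> n)) * ennreal (m (\<xi> n)))"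
    unfolding cker_def by (subst nn_integral_suminf) (auto simp: nn_integral_cyl_coord[OF \<xi>])
  also have "\<dots> = (\<Sum>n. ennreal (b (\<xi> n) * m (\<xi> n)))"
    using nn by (simp add: ennreal_mult)
  also have "\<dots> = ennreal (L (root T))"
    using nn by (intro suminf_ennreal_eq symbol_sums_root[OF assms]) simp
  finally show ?thesis .
qed

lemma R_nonempty: "R \<noteq> {}"
proof
  assume "R = {}"
  then have "AE \<xi> in \<mu>. False" using AE_R by simp
  then show False by simp
qed

lemma symbol_root_nonneg: "symbol b L \<Longrightarrow> 0 \<le> L (root T)"
proof -
  assume s: "symbol b L"
  obtain \<xi> where \<xi>: "\<xi> \<in> R" using R_nonempty by blast
  have "\<xi> \<in> boundary T" using \<xi> by (rule R_boundary)
  then show ?thesis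
    using symbol_nonneg[OF s boundary_site] by (intro sums_le[OF _ sums_zero symbol_sums_root[OF s \<xi>]]) simp
qed

lemma AE_cker_finite: "symbol b L \<Longrightarrow> \<xi> \<in> R \<Longrightarrow> AE \<eta> in \<mu>. cker b \<xi> \<eta> < \<infinity>"
  using nn_integral_PInf_AE[of "cker b \<xi>" \<mu>] mass_cker[of b L \<xi>] R_boundary[of \<xi>]
  by (auto simp: less_top[symmetric])

text \<open>Schur test with a constant test function: Cauchy-Schwarz for the measure with density
  \<open>cker b \<xi>\<close>, of total mass \<open>L (root T)\<close>, then Fubini and the symmetry
  of the kernel.\<close>

lemma schur:
  assumes b: "symbol b L" and [measurable]: "f \<in> borel_measurable \<mu>"
  shows "(\<integral>\<^sup>+\<xi>. (\<integral>\<^sup>+\<eta>. cker b \<xi> \<eta> * ennreal \<bar>f \<eta>\<bar> \<partial>\<mu>)\<^sup>2 \<partial>\<mu>) \<le> (ennreal (L (root T)))\<^sup>2 * (\<integral>\<^sup>+\<eta>. ennreal ((f \<eta>)\<^sup>2) \<partial>\<mu>)"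
proof -
  let ?C = "ennreal (L (root T))"
  have "(\<integral>\<^sup>+\<xi>. (\<integral>\<^sup>+\<eta>. cker b \<xi> \<eta> * ennreal \<bar>f \<eta>\<bar> \<partial>\<mu>)\<^sup>2 \<partial>\<mu>) \<le> (\<integral>\<^sup>+\<xi>. ?C * (\<integral>\<^sup>+\<eta>. cker b \<xi> \<eta> * ennreal ((f \<eta>)\<^sup>2) \<partial>\<mu>) \<partial>\<mu>)"
  proof (rule nn_integral_mono_AE)
    show "AE \<xi> in \<mu>. (\<integral>\<^sup>+\<eta>. cker b \<xi> \<eta> * ennreal \<bar>f \<eta>\<bar> \<partial>\<mu>)\<^sup>2 \<le> ?C * (\<integral>\<^sup>+\<eta>. cker b \<xi> \<eta> * ennreal ((f \<eta>)\<^sup>2) \<partial>\<mu>)"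
      using AE_R
    proof eventually_elim
      case (elim \<xi>)
      have [measurable]: "cker b \<xi> \<in> borel_measurable \<mu>" using elim R_boundary by measurable
      have sq: "(ennreal \<bar>f \<eta>\<bar>)\<^sup>2 = ennreal ((f \<eta>)\<^sup>2)" for \<eta> by (simp add: ennreal_power)
      have "(\<integral>\<^sup>+\<eta>. 1 * ennreal \<bar>f \<eta>\<bar> \<partial>density \<mu> (cker b \<xi>))\<^sup>2
          \<le> (\<integral>\<^sup>+\<eta>. 1\<^sup>2 \<partial>density \<mu> (cker b \<xi>)) * (\<integral>\<^sup>+\<eta>. (ennreal \<bar>f \<eta>\<bar>)\<^sup>2 \<partial>density \<mu> (cker b \<xi>))"
        by (rule Cauchy_Schwarz_nn_integral) auto
      then show ?case
        unfolding sq mult_1 power_one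
        by (simp add: nn_integral_density mass_cker[OF b elim] del: nn_integral_const)
    qed
  qed
  also have "\<dots> = ?C * (\<integral>\<^sup>+\<xi>. (\<integral>\<^sup>+\<eta>. cker b \<xi> \<eta> * ennreal ((f \<eta>)\<^sup>2) \<partial>\<mu>) \<partial>\<mu>)"
    by (rule nn_integral_cmult) measurable
  also have "(\<integral>\<^sup>+\<xi>. (\<integral>\<^sup>+\<eta>. cker b \<xi> \<eta> * ennreal ((f \<eta>)\<^sup>2) \<partial>\<mu>) \<partial>\<mu>)
      = (\<integral>\<^sup>+\<eta>. (\<integral>\<^sup>+\<xi>. cker b \<xi> \<eta> * ennreal ((f \<eta>)\<^sup>2) \<partial>\<mu>) \<partial>\<mu>)"
  proof -
    interpret pair_sigma_finite \<mu> \<mu> ..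
    show ?thesis by (rule Fubini'[symmetric]) measurable
  qed
  also have "\<dots> = (\<integral>\<^sup>+\<eta>. ?C * ennreal ((f \<eta>)\<^sup>2) \<partial>\<mu>)"
  proof (rule nn_integral_cong_AE)
    show "AE \<eta> in \<mu>. (\<integral>\<^sup>+\<xi>. cker b \<xi> \<eta> * ennreal ((f \<eta>)\<^sup>2) \<partial>\<mu>) = ?C * ennreal ((f \<eta>)\<^sup>2)"
      using AE_R
    proof eventually_elim
      case (elim \<eta>)
      have [measurable]: "cker b \<eta> \<in> borel_measurable \<mu>" using elim R_boundary by measurable
      show ?case
        unfolding cker_sym[of b _ \<eta>] by (simp add: nn_integral_multc mass_cker[OF b elim])
    qed
  qed
  also have "\<dots> = ?C * (\<integral>\<^sup>+\<eta>. ennreal ((f \<eta>)\<^sup>2) \<partial>\<mu>)"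
    by (rule nn_integral_cmult) measurable
  finally show ?thesis by (simp add: power2_eq_square mult.assoc)
qed

lemma Kop_measurable [measurable]:
  assumes [measurable]: "f \<in> borel_measurable \<mu>"
  shows "Kop b f \<in> borel_measurable \<mu>"
  unfolding Kop_def by measurable

lemma nn_square: "L2 \<mu> f \<Longrightarrow> (\<integral>\<^sup>+\<eta>. ennreal ((f \<eta>)\<^sup>2) \<partial>\<mu>) = ennreal (\<integral>\<eta>. (f \<eta>)\<^sup>2 \<partial>\<mu>)"
  by (intro nn_integral_eq_integral L2_square) auto

lemma AE_Kop_abs_finite:
  assumes b: "symbol b L" and f: "L2 \<mu> f"
  shows "AE \<xi> in \<mu>. (\<integral>\<^sup>+\<eta>. cker b \<xi> \<eta> * ennreal \<bar>f \<eta>\<bar> \<partial>\<mu>) < \<infinity>"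
proof -
  have [measurable]: "f \<in> borel_measurable \<mu>" using f by (rule L2_measurable)
  have "(\<integral>\<^sup>+\<xi>. (\<integral>\<^sup>+\<eta>. cker b \<xi> \<eta> * ennreal \<bar>f \<eta>\<bar> \<partial>\<mu>)\<^sup>2 \<partial>\<mu>) \<noteq> \<infinity>"
    using schur[OF b, of f] nn_square[OF f] by (auto simp: ennreal_mult_eq_top_iff top_unique power2_eq_square)
  then have "AE \<xi> in \<mu>. (\<integral>\<^sup>+\<eta>. cker b \<xi> \<eta> * ennreal \<bar>f \<eta>\<bar> \<partial>\<mu>)\<^sup>2 \<noteq> \<infinity>"
    by (intro nn_integral_PInf_AE) auto
  then show ?thesis by eventually_elim (auto simp: less_top[symmetric])
qed

lemma Kop_integrable:
  assumes "\<xi> \<in> boundary T" and [measurable]: "f \<in> borel_measurable \<mu>"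
    and "(\<integral>\<^sup>+\<eta>. cker b \<xi> \<eta> * ennreal \<bar>f \<eta>\<bar> \<partial>\<mu>) < \<infinity>"
  shows "integrable \<mu> (\<lambda>\<eta>. enn2real (cker b \<xi> \<eta>) * f \<eta>)"
proof (rule integrableI_bounded)
  have [measurable]: "cker b \<xi> \<in> borel_measurable \<mu>" using assms(1) by measurable
  show "(\<lambda>\<eta>. enn2real (cker b \<xi> \<eta>) * f \<eta>) \<in> borel_measurable \<mu>" by measurable
  have "ennreal (enn2real c) \<le> c" for c :: ennreal by (cases c) auto
  then have "(\<integral>\<^sup>+\<eta>. ennreal (norm (enn2real (cker b \<xi> \<eta>) * f \<eta>)) \<partial>\<mu>) \<le> (\<integral>\<^sup>+\<eta>. cker b \<xi> \<eta> * ennreal \<bar>f \<eta>\<bar> \<partial>\<mu>)"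
    by (intro nn_integral_mono) (auto simp: abs_mult ennreal_mult intro!: mult_right_mono)
  then show "(\<integral>\<^sup>+\<eta>. ennreal (norm (enn2real (cker b \<xi> \<eta>) * f \<eta>)) \<partial>\<mu>) < \<infinity>"
    using assms(3) by (rule le_less_trans)
qed

lemma AE_Kop_integrable:
  assumes "symbol b L" "L2 \<mu> f"
  shows "AE \<xi> in \<mu>. integrable \<mu> (\<lambda>\<eta>. enn2real (cker b \<xi> \<eta>) * f \<eta>)"
  using AE_Kop_abs_finite[OF assms] AE_R
  by eventually_elim (rule Kop_integrable[OF R_boundary L2_measurable[OF assms(2)]])

lemma Kop_abs_le: "ennreal \<bar>Kop b f \<xi>\<bar> \<le> (\<integral>\<^sup>+\<eta>. cker b \<xi> \<eta> * ennreal \<bar>f \<eta>\<bar> \<partial>\<mu>)"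
proof (cases "integrable \<mu> (\<lambda>\<eta>. enn2real (cker b \<xi> \<eta>) * f \<eta>)")
  case True
  have "ennreal (enn2real c) \<le> c" for c :: ennreal by (cases c) auto
  then have "(\<integral>\<^sup>+\<eta>. ennreal (norm (enn2real (cker b \<xi> \<eta>) * f \<eta>)) \<partial>\<mu>) \<le> (\<integral>\<^sup>+\<eta>. cker b \<xi> \<eta> * ennreal \<bar>f \<eta>\<bar> \<partial>\<mu>)"
    by (intro nn_integral_mono) (auto simp: abs_mult ennreal_mult intro!: mult_right_mono)
  then show ?thesis
    using integral_norm_bound_ennreal[OF True] by (simp add: Kop_def)
next
  \<comment> \<open>A divergent integral has the value 0 by convention, so the bound holds as
    well.\<close>
  case False
  then show ?thesis by (simp add: Kop_def not_integrable_integral_eq)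
qed

lemma Kop_L2:
  assumes b: "symbol b L" and f: "L2 \<mu> f"
  shows "L2 \<mu> (Kop b f)" and "(\<integral>\<xi>. (Kop b f \<xi>)\<^sup>2 \<partial>\<mu>) \<le> (L (root T))\<^sup>2 * (\<integral>\<eta>. (f \<eta>)\<^sup>2 \<partial>\<mu>)"
proof -
  have [measurable]: "f \<in> borel_measurable \<mu>" using f by (rule L2_measurable)
  have "ennreal ((Kop b f \<xi>)\<^sup>2) \<le> (\<integral>\<^sup>+\<eta>. cker b \<xi> \<eta> * ennreal \<bar>f \<eta>\<bar> \<partial>\<mu>)\<^sup>2" for \<xi>
    using power_mono[OF Kop_abs_le[of b f \<xi>], of 2] by (simp add: ennreal_power)
  then have "(\<integral>\<^sup>+\<xi>. ennreal ((Kop b f \<xi>)\<^sup>2) \<partial>\<mu>) \<le> (\<integral>\<^sup>+\<xi>. (\<integral>\<^sup>+\<eta>. cker b \<xi> \<eta> * ennreal \<bar>f \<eta>\<bar> \<partial>\<mu>)\<^sup>2 \<partial>\<mu>)"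
    by (intro nn_integral_mono)
  also have "\<dots> \<le> (ennreal (L (root T)))\<^sup>2 * ennreal (\<integral>\<eta>. (f \<eta>)\<^sup>2 \<partial>\<mu>)"
    using schur[OF b, of f] by (simp add: nn_square[OF f])
  also have "\<dots> = ennreal ((L (root T))\<^sup>2 * (\<integral>\<eta>. (f \<eta>)\<^sup>2 \<partial>\<mu>))"
    by (simp add: ennreal_power symbol_root_nonneg[OF b] ennreal_mult)
  finally have le: "(\<integral>\<^sup>+\<xi>. ennreal ((Kop b f \<xi>)\<^sup>2) \<partial>\<mu>) \<le> ennreal ((L (root T))\<^sup>2 * (\<integral>\<eta>. (f \<eta>)\<^sup>2 \<partial>\<mu>))" .
  then have "(\<integral>\<^sup>+\<xi>. ennreal ((Kop b f \<xi>)\<^sup>2) \<partial>\<mu>) < \<infinity>" by (rule le_less_trans) simp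
  then show l2: "L2 \<mu> (Kop b f)"
    unfolding L2_def by (intro conjI integrableI_bounded) auto
  show "(\<integral>\<xi>. (Kop b f \<xi>)\<^sup>2 \<partial>\<mu>) \<le> (L (root T))\<^sup>2 * (\<integral>\<eta>. (f \<eta>)\<^sup>2 \<partial>\<mu>)"
    using le unfolding nn_square[OF l2] by (subst (asm) ennreal_le_iff) auto
qed

lemma Kop_linear:
  assumes b: "symbol b L" and f: "L2 \<mu> f" "L2 \<mu> g"
  shows "AE \<xi> in \<mu>. Kop b (\<lambda>\<eta>. \<alpha> * f \<eta> + \<beta> * g \<eta>) \<xi> = \<alpha> * Kop b f \<xi> + \<beta> * Kop b g \<xi>"
  using AE_Kop_integrable[OF b f(1)] AE_Kop_integrable[OF b f(2)]
proof eventually_elim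
  case (elim \<xi>)
  then show ?case
    unfolding Kop_def by (simp add: distrib_left mult.left_commute[of _ \<alpha>] mult.left_commute[of _ \<beta>])
qed

lemma Kop_diff_le:
  assumes b: "symbol b L" and f: "L2 \<mu> f" "L2 \<mu> g"
  shows "(\<integral>\<xi>. (Kop b f \<xi> - Kop b g \<xi>)\<^sup>2 \<partial>\<mu>) \<le> (L (root T))\<^sup>2 * (\<integral>\<eta>. (f \<eta> - g \<eta>)\<^sup>2 \<partial>\<mu>)"
proof -
  have [measurable]: "f \<in> borel_measurable \<mu>" "g \<in> borel_measurable \<mu>"
    using f by (auto dest: L2_measurable)
  have "(\<integral>\<xi>. (Kop b f \<xi> - Kop b g \<xi>)\<^sup>2 \<partial>\<mu>) = (\<integral>\<xi>. (Kop b (\<lambda>\<eta>. f \<eta> - g \<eta>) \<xi>)\<^sup>2 \<partial>\<mu>)"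
  proof (rule integral_cong_AE)
    show "AE \<xi> in \<mu>. (Kop b f \<xi> - Kop b g \<xi>)\<^sup>2 = (Kop b (\<lambda>\<eta>. f \<eta> - g \<eta>) \<xi>)\<^sup>2"
      using Kop_linear[OF b f, of 1 "-1"] by eventually_elim simp
  qed measurable
  then show ?thesis using Kop_L2(2)[OF b L2_diff[OF f]] by simp
qed

lemma Kop_tendsto:
  assumes b: "symbol b L" and u: "L2_tendsto \<mu> u v F"
  shows "L2_tendsto \<mu> (\<lambda>t. Kop b (u t)) (Kop b v) F"
proof (rule L2_tendsto_le)
  note a = u[unfolded L2_tendsto_iff]
  show "\<forall>\<^sub>F t in F. L2 \<mu> (Kop b (u t))" "L2 \<mu> (Kop b v)"
    using a by (auto elim!: eventually_mono intro: Kop_L2[OF b])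
  show "\<forall>\<^sub>F t in F. (\<integral>\<xi>. (Kop b (u t) \<xi> - Kop b v \<xi>)\<^sup>2 \<partial>\<mu>) \<le> (L (root T))\<^sup>2 * (\<integral>\<eta>. (u t \<eta> - v \<eta>)\<^sup>2 \<partial>\<mu>)"
    using conjunct1[OF a]
  proof eventually_elim
    case (elim t)
    have v: "L2 \<mu> v" using a by simp
    from Kop_diff_le[OF b elim v] show ?case .
  qed
  show "((\<lambda>t. (L (root T))\<^sup>2 * (\<integral>\<eta>. (u t \<eta> - v \<eta>)\<^sup>2 \<partial>\<mu>)) \<longlongrightarrow> 0) F"
    using a by (auto intro!: tendsto_eq_intros)
qed

text \<open>\<open>Kop\<close> integrates its argument, so the images agree at every ray; this leads
  from almost everywhere statements back to pointwise ones.\<close>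

lemma Kop_cong_AE:
  assumes "AE \<eta> in \<mu>. f \<eta> = g \<eta>" and [measurable]: "f \<in> borel_measurable \<mu>" "g \<in> borel_measurable \<mu>" and "\<xi> \<in> boundary T"
  shows "Kop b f \<xi> = Kop b g \<xi>"
  unfolding Kop_def
proof (rule integral_cong_AE)
  have [measurable]: "cker b \<xi> \<in> borel_measurable \<mu>" using assms(4) by measurable
  show "(\<lambda>\<eta>. enn2real (cker b \<xi> \<eta>) * f \<eta>) \<in> borel_measurable \<mu>" "(\<lambda>\<eta>. enn2real (cker b \<xi> \<eta>) * g \<eta>) \<in> borel_measurable \<mu>"
    by measurable
  show "AE \<eta> in \<mu>. enn2real (cker b \<xi> \<eta>) * f \<eta> = enn2real (cker b \<xi> \<eta>) * g \<eta>"
    using assms(1) by eventually_elim simp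
qed

end

text \<open>A three-term estimate: the contraction property controls the two approximation errors
  uniformly in \<open>t\<close>, and the middle term tends to 0 for a fixed
  \<open>k\<close>.\<close>

lemma L2_tendsto_approx:
  assumes u: "L2_tendsto M u v sequentially"
    and A: "\<And>k. L2_tendsto M (\<lambda>t. A t (u k)) (u k) F"
    and contr: "\<forall>\<^sub>F t in F. \<forall>f g. L2 M f \<longrightarrow> L2 M g \<longrightarrow> L2 M (A t f) \<and>
      (\<integral>x. (A t f x - A t g x)\<^sup>2 \<partial>M) \<le> (\<integral>x. (f x - g x)\<^sup>2 \<partial>M)"
  shows "L2_tendsto M (\<lambda>t. A t v) v F"
  unfolding L2_tendsto_iff
proof (intro conjI)
  have v: "L2 M v" using u by (simp add: L2_tendsto_iff)
  show "L2 M v" by fact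
  show "\<forall>\<^sub>F t in F. L2 M (A t v)" using contr by eventually_elim (use v in blast)
  have uk: "\<forall>\<^sub>F k in sequentially. L2 M (u k)" and lim: "(\<lambda>k. \<integral>x. (u k x - v x)\<^sup>2 \<partial>M) \<longlonglongrightarrow> 0"
    using u by (auto simp: L2_tendsto_iff)
  show "((\<lambda>t. \<integral>x. (A t v x - v x)\<^sup>2 \<partial>M) \<longlongrightarrow> 0) F"
  proof (rule tendstoI)
    fix e :: real assume e: "0 < e"
    \<comment> \<open>The thresholds fit the final estimate,
      \<open>6 * (e / 12) + 4 * (e / 8) = e\<close>; the factors 6 and 4 come from two uses of
      \<open>integral_square_add_le\<close>.\<close>
    then have "\<forall>\<^sub>F k in sequentially. (\<integral>x. (u k x - v x)\<^sup>2 \<partial>M) < e / 12"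
      by (intro order_tendstoD(2)[OF lim]) simp
    with uk have "\<forall>\<^sub>F k in sequentially. L2 M (u k) \<and> (\<integral>x. (u k x - v x)\<^sup>2 \<partial>M) < e / 12"
      by (rule eventually_conj)
    then obtain k where k: "L2 M (u k)" "(\<integral>x. (u k x - v x)\<^sup>2 \<partial>M) < e / 12"
      unfolding eventually_sequentially by blast
    let ?a = "\<integral>x. (u k x - v x)\<^sup>2 \<partial>M"
    have "\<forall>\<^sub>F t in F. (\<integral>x. (A t (u k) x - u k x)\<^sup>2 \<partial>M) < e / 8"
      using A[of k] e unfolding L2_tendsto_iff by (intro order_tendstoD(2)) auto
    with contr show "\<forall>\<^sub>F t in F. dist (\<integral>x. (A t v x - v x)\<^sup>2 \<partial>M) 0 < e"
    proof eventually_elim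
      case (elim t)
      have Lv: "L2 M (A t v)" and Lu: "L2 M (A t (u k))" using elim v k by blast+
      have c: "(\<integral>x. (A t v x - A t (u k) x)\<^sup>2 \<partial>M) \<le> ?a"
        using elim(1)[rule_format, OF v k(1)] by (simp add: power2_commute)
      have "(\<integral>x. (A t v x - v x)\<^sup>2 \<partial>M) = (\<integral>x. ((A t v x - A t (u k) x) + (A t (u k) x - v x))\<^sup>2 \<partial>M)"
        by simp
      also have "\<dots> \<le> 2 * (\<integral>x. (A t v x - A t (u k) x)\<^sup>2 \<partial>M) + 2 * (\<integral>x. (A t (u k) x - v x)\<^sup>2 \<partial>M)"
        by (intro integral_square_add_le L2_diff Lv Lu v)
      finally have 1: "(\<integral>x. (A t v x - v x)\<^sup>2 \<partial>M) \<le> \<dots>" .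
      have "(\<integral>x. (A t (u k) x - v x)\<^sup>2 \<partial>M) = (\<integral>x. ((A t (u k) x - u k x) + (u k x - v x))\<^sup>2 \<partial>M)"
        by simp
      also have "\<dots> \<le> 2 * (\<integral>x. (A t (u k) x - u k x)\<^sup>2 \<partial>M) + 2 * ?a"
        by (intro integral_square_add_le L2_diff Lu v k)
      finally have "(\<integral>x. (A t (u k) x - v x)\<^sup>2 \<partial>M) \<le> \<dots>" .
      then have "(\<integral>x. (A t v x - v x)\<^sup>2 \<partial>M) \<le> 6 * ?a + 4 * (\<integral>x. (A t (u k) x - u k x)\<^sup>2 \<partial>M)"
        using c 1 by linarith
      then have "(\<integral>x. (A t v x - v x)\<^sup>2 \<partial>M) < e" using elim(2) k(2) by linarith
      then show ?case by simp
    qed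
  qed
qed

section \<open>The action of the kernels on functions of finitely many coordinates\<close>

context potential_tree
begin

lemma gam_boundary_pos: "\<xi> \<in> boundary T \<Longrightarrow> 0 < gam (\<xi> n)"
  by (simp add: gam_pos boundary_site)

lemma gam_Suc: "\<xi> \<in> boundary T \<Longrightarrow> gam (\<xi> n) - gam (\<xi> (Suc n)) = delta w (Suc n) * m (\<xi> (Suc n))"
  using gam_step[of "\<xi> (Suc n)"] boundary_site[of \<xi> "Suc n"] boundary_Suc_neq_root[of \<xi> n]
  by (simp add: boundary_parent boundary_level)

lemma m_mono: "\<xi> \<in> boundary T \<Longrightarrow> k \<le> n \<Longrightarrow> m (\<xi> n) \<le> m (\<xi> k)"
  using cyl_mu[OF boundary_site]
  by (intro finite_measure_mono) (auto simp: mem_cyl_boundary intro: boundary_eq_below)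

text \<open>Below a null cylinder \<open>gam\<close> would stay constant and positive along \<xi>,
  against its convergence to 0.\<close>

lemma m_pos:
  assumes "\<xi> \<in> R"
  shows "0 < m (\<xi> n)"
proof (rule ccontr)
  assume n: "\<not> 0 < m (\<xi> n)"
  have \<xi>: "\<xi> \<in> boundary T" and lim: "(\<lambda>n. gam (\<xi> n)) \<longlonglongrightarrow> 0" using assms by (auto simp: R_def)
  have "m (\<xi> k) = 0" if "n \<le> k" for k
    using m_mono[OF \<xi> that] n measure_nonneg[of \<mu> "cyl T (\<xi> k)"] by linarith
  then have eq: "gam (\<xi> (Suc k)) = gam (\<xi> k)" if "n \<le> k" for k
    using gam_Suc[OF \<xi>, of k] that by simp
  have "gam (\<xi> k) = gam (\<xi> n)" if "n \<le> k" for k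
    using that by (induction k rule: dec_induct) (auto simp: eq)
  then have "(\<lambda>k. gam (\<xi> k)) \<longlonglongrightarrow> gam (\<xi> n)"
    by (intro tendsto_eventually eventually_sequentiallyI[of n])
  then have "gam (\<xi> n) = 0" using lim LIMSEQ_unique by blast
  then show False using gam_boundary_pos[OF \<xi>, of n] by simp
qed

definition cint :: "((nat \<Rightarrow> 'v) \<Rightarrow> real) \<Rightarrow> 'v \<Rightarrow> real" where
  "cint f i = (\<integral>\<eta>. indicator (cyl T i) \<eta> * f \<eta> \<partial>\<mu>)"

lemma integrable_cyl: "integrable \<mu> f \<Longrightarrow> i \<in> sites T \<Longrightarrow> integrable \<mu> (\<lambda>\<eta>. indicator (cyl T i) \<eta> * f \<eta> :: real)"
  using integrable_mult_indicator[OF cyl_mu, of i f] by simp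

lemma cint_succs:
  assumes f: "integrable \<mu> f" and i: "i \<in> sites T"
  shows "(\<Sum>j\<in>succs T i. cint f j) = cint f i"
proof -
  have ind: "(\<Sum>j\<in>succs T i. indicator (cyl T j) \<eta>) = (indicator (cyl T i) \<eta> :: real)" for \<eta>
    unfolding cyl_succs[OF i]
    by (rule indicator_UN_disjoint[symmetric])
       (use level_succs in \<open>auto simp: finite_succs disjoint_family_on_def cyl_iff\<close>)
  have "(\<Sum>j\<in>succs T i. cint f j) = (\<integral>\<eta>. (\<Sum>j\<in>succs T i. indicator (cyl T j) \<eta> * f \<eta>) \<partial>\<mu>)"
    unfolding cint_def using integrable_cyl[OF f] succs_site
    by (intro Bochner_Integration.integral_sum[symmetric]) blast
  then show ?thesis by (simp add: cint_def sum_distrib_right[symmetric] ind)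
qed

text \<open>Makes the division by 0 in \<open>av\<close> harmless: \<open>av_mult_m\<close> holds on
  null cylinders too.\<close>

lemma cint_null: "i \<in> sites T \<Longrightarrow> m i = 0 \<Longrightarrow> cint f i = 0"
proof -
  assume i: "i \<in> sites T" "m i = 0"
  then have "AE \<eta> in \<mu>. \<eta> \<notin> cyl T i"
    using cyl_mu by (intro AE_not_in) (auto simp: null_sets_def emeasure_eq_measure)
  then have "AE \<eta> in \<mu>. indicator (cyl T i) \<eta> * f \<eta> = 0" by eventually_elim simp
  then show ?thesis unfolding cint_def by (simp add: integral_eq_zero_AE)
qed

text \<open>Says that \<xi> \<mapsto> \<open>\<phi> (\<xi> n)\<close> is a martingale increment for
  every \<open>n > 0\<close>. The value at the root is left free, since the increment of level 0 is
  a constant.\<close>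

definition zm :: "('v \<Rightarrow> real) \<Rightarrow> bool" where
  "zm \<phi> \<longleftrightarrow> (\<forall>i\<in>sites T. (\<Sum>j\<in>succs T i. \<phi> j * m j) = 0)"

lemma zm_mult_siblings:
  assumes "\<And>i j k. j \<in> succs T i \<Longrightarrow> k \<in> succs T i \<Longrightarrow> L j = L k" "zm \<phi>"
  shows "zm (\<lambda>i. L i * \<phi> i)"
  unfolding zm_def
proof
  fix i assume i: "i \<in> sites T"
  obtain k where k: "k \<in> succs T i" using succs_nonempty[OF i] by blast
  have "(\<Sum>j\<in>succs T i. L j * \<phi> j * m j) = (\<Sum>j\<in>succs T i. L k * (\<phi> j * m j))"
    using assms(1)[OF _ k] by (intro sum.cong) auto
  then show "(\<Sum>j\<in>succs T i. L j * \<phi> j * m j) = 0"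
    using assms(2) i by (simp add: zm_def sum_distrib_left[symmetric])
qed

lemma zm_mult: "symbol b L \<Longrightarrow> zm \<phi> \<Longrightarrow> zm (\<lambda>i. L i * \<phi> i)"
  by (rule zm_mult_siblings) (rule symbol_siblings)

lemma cint_coord:
  assumes "\<xi> \<in> boundary T" "n \<le> k"
  shows "cint (\<lambda>\<eta>. \<phi> (\<eta> n)) (\<xi> k) = \<phi> (\<xi> n) * m (\<xi> k)"
proof -
  have "cint (\<lambda>\<eta>. \<phi> (\<eta> n)) (\<xi> k) = (\<integral>\<eta>. \<phi> (\<xi> n) * indicator (cyl T (\<xi> k)) \<eta> \<partial>\<mu>)"
    unfolding cint_def
  proof (rule Bochner_Integration.integral_cong)
    fix \<eta> assume \<eta>: "\<eta> \<in> space \<mu>"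
    have "\<phi> (\<eta> n) = \<phi> (\<xi> n)" if "\<eta> \<in> cyl T (\<xi> k)"
      using that assms boundary_eq_below[of \<eta> \<xi> k n] by (simp add: mem_cyl_boundary)
    then show "indicator (cyl T (\<xi> k)) \<eta> * \<phi> (\<eta> n) = \<phi> (\<xi> n) * indicator (cyl T (\<xi> k)) \<eta>"
      by (auto simp: indicator_def)
  qed simp
  also have "\<dots> = \<phi> (\<xi> n) * m (\<xi> k)"
    using sets.sets_into_space[OF cyl_mu[OF boundary_site[OF assms(1)]]] by (simp add: Int_absorb2)
  finally show ?thesis .
qed

text \<open>At level \<open>n - 1\<close> this is the zero mean condition; it passes to smaller
  levels because \<open>cint\<close> is additive over successors.\<close>

lemma cint_coord_zm:
  assumes "zm \<phi>" "k < n" "i \<in> lev k"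
  shows "cint (\<lambda>\<eta>. \<phi> (\<eta> n)) i = 0"
proof -
  let ?f = "\<lambda>\<eta>. \<phi> (\<eta> n)"
  have f: "integrable \<mu> ?f" by (rule integrable_coord)
  have "k \<le> n - 1" using assms by simp
  then have "\<forall>i\<in>lev k. cint ?f i = 0"
  proof (induction k rule: inc_induct)
    case base
    show ?case
    proof
      fix i assume i: "i \<in> lev (n - 1)"
      then have ist: "i \<in> sites T" "level T i = n - 1" by (auto simp: lev_def)
      have "cint ?f j = \<phi> j * m j" if j: "j \<in> succs T i" for j
      proof -
        have l: "level T j = n" using level_succs[OF j] ist assms(2) by simp
        obtain \<xi> where \<xi>: "\<xi> \<in> boundary T" "\<xi> n = j"
          using ex_boundary[OF succs_site(1)[OF j]] l by (auto simp: cyl_iff)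
        show ?thesis using cint_coord[OF \<xi>(1), of n n \<phi>] \<xi>(2) by simp
      qed
      then have "cint ?f i = (\<Sum>j\<in>succs T i. \<phi> j * m j)"
        using cint_succs[OF f ist(1)] by simp
      then show "cint ?f i = 0" using assms(1) ist(1) by (simp add: zm_def)
    qed
  next
    case (step k)
    show ?case
    proof
      fix i assume i: "i \<in> lev k"
      then have "succs T i \<subseteq> lev (Suc k)" unfolding lev_Suc by blast
      then have "(\<Sum>j\<in>succs T i. cint ?f j) = 0" using step by (intro sum.neutral) auto
      then show "cint ?f i = 0" using cint_succs[OF f, of i] i by (simp add: lev_def)
    qed
  qed
  then show ?thesis using assms(3) by blast
qed

text \<open>Termwise integration, dominated by \<open>B\<close> times the mass series of the kernel.
  It holds at every regular \<xi>, as the Feller property requires.\<close>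

lemma Kop_series:
  assumes b: "symbol b L" and \<xi>: "\<xi> \<in> R" and f [measurable]: "f \<in> borel_measurable \<mu>"
    and B: "\<And>\<eta>. \<eta> \<in> boundary T \<Longrightarrow> \<bar>f \<eta>\<bar> \<le> B"
  shows "(\<lambda>k. b (\<xi> k) * cint f (\<xi> k)) sums Kop b f \<xi>"
proof -
  have \<xi>b: "\<xi> \<in> boundary T" using \<xi> by (rule R_boundary)
  have nn: "0 \<le> b (\<xi> k)" for k using symbol_nonneg[OF b boundary_site[OF \<xi>b]] .
  have B0: "0 \<le> B" using B[OF \<xi>b] by linarith
  have fi: "integrable \<mu> f"
    using B by (intro integrable_const_bound[of _ B]) (auto simp: space_mu)
  define F where "F = (\<lambda>k \<eta>. b (\<xi> k) * (indicator (cyl T (\<xi> k)) \<eta> * f \<eta>))"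
  have Fi: "integrable \<mu> (F k)" for k
    unfolding F_def using integrable_cyl[OF fi boundary_site[OF \<xi>b]] by simp
  have mi: "integrable \<mu> (\<lambda>\<eta>. B * b (\<xi> k) * indicator (cyl T (\<xi> k)) \<eta>)" for k
    using cyl_mu[OF boundary_site[OF \<xi>b]] by (intro integrable_mult_right) (simp add: emeasure_eq_measure)
  have le: "norm (F k \<eta>) \<le> B * b (\<xi> k) * indicator (cyl T (\<xi> k)) \<eta>" for k \<eta>
    using nn[of k] B[of \<eta>] cyl_subset[of "\<xi> k"]
    by (auto simp: F_def indicator_def abs_mult mult.commute[of B] intro!: mult_left_mono)
  have fin: "AE \<eta> in \<mu>. summable (\<lambda>k. b (\<xi> k) * of_bool (\<xi> k = \<eta> k)) \<and>
      cker b \<xi> \<eta> = ennreal (\<Sum>k. b (\<xi> k) * of_bool (\<xi> k = \<eta> k))"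
    using AE_cker_finite[OF b \<xi>]
  proof eventually_elim
    case (elim \<eta>)
    have eq: "cker b \<xi> \<eta> = (\<Sum>k. ennreal (b (\<xi> k) * of_bool (\<xi> k = \<eta> k)))"
      unfolding cker_def by (intro suminf_cong) (auto simp: of_bool_def)
    then have s: "summable (\<lambda>k. b (\<xi> k) * of_bool (\<xi> k = \<eta> k))"
      using elim nn by (intro summable_suminf_not_top) auto
    then show ?case unfolding eq using nn by (intro conjI suminf_ennreal2) auto
  qed
  have ind: "indicator (cyl T (\<xi> k)) \<eta> = (of_bool (\<xi> k = \<eta> k) :: real)" if "\<eta> \<in> space \<mu>" for k \<eta>
    using that by (auto simp: indicator_def mem_cyl_boundary[OF \<xi>b] space_mu)
  have "(\<lambda>k. integral\<^sup>L \<mu> (F k)) sums (\<integral>\<eta>. (\<Sum>k. F k \<eta>) \<partial>\<mu>)"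
  proof (rule sums_integral[OF Fi])
    show "AE \<eta> in \<mu>. summable (\<lambda>k. norm (F k \<eta>))"
      using fin AE_space
    proof eventually_elim
      case (elim \<eta>)
      have "summable (\<lambda>k. B * (b (\<xi> k) * of_bool (\<xi> k = \<eta> k)))"
        using elim by (intro summable_mult) simp
      then show ?case
        by (rule summable_comparison_test') (use le[of _ \<eta>] ind[OF elim(2)] in \<open>simp add: mult.assoc\<close>)
    qed
    have "summable (\<lambda>k. B * (b (\<xi> k) * m (\<xi> k)))"
      using sums_summable[OF symbol_sums_root[OF b \<xi>]] by (rule summable_mult)
    then show "summable (\<lambda>k. \<integral>\<eta>. norm (F k \<eta>) \<partial>\<mu>)"
    proof (rule summable_comparison_test')
      fix k :: nat
      have "(\<integral>\<eta>. norm (F k \<eta>) \<partial>\<mu>) \<le> (\<integral>\<eta>. B * b (\<xi> k) * indicator (cyl T (\<xi> k)) \<eta> \<partial>\<mu>)"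
        using Fi mi le by (intro integral_mono) auto
      also have "\<dots> = B * (b (\<xi> k) * m (\<xi> k))"
        using sets.sets_into_space[OF cyl_mu[OF boundary_site[OF \<xi>b]]] by (simp add: Int_absorb2 mult.assoc)
      finally show "norm (\<integral>\<eta>. norm (F k \<eta>) \<partial>\<mu>) \<le> B * (b (\<xi> k) * m (\<xi> k))" by simp
    qed
  qed
  moreover have "integral\<^sup>L \<mu> (F k) = b (\<xi> k) * cint f (\<xi> k)" for k
    by (simp add: F_def cint_def)
  moreover have "(\<integral>\<eta>. (\<Sum>k. F k \<eta>) \<partial>\<mu>) = Kop b f \<xi>"
    unfolding Kop_def
  proof (rule integral_cong_AE)
    have [measurable]: "cker b \<xi> \<in> borel_measurable \<mu>" using \<xi>b by measurable
    have [measurable]: "F k \<in> borel_measurable \<mu>" for k using Fi by auto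
    show "(\<lambda>\<eta>. \<Sum>k. F k \<eta>) \<in> borel_measurable \<mu>" by measurable
    show "(\<lambda>\<eta>. enn2real (cker b \<xi> \<eta>) * f \<eta>) \<in> borel_measurable \<mu>" by measurable
    show "AE \<eta> in \<mu>. (\<Sum>k. F k \<eta>) = enn2real (cker b \<xi> \<eta>) * f \<eta>"
      using fin AE_space
    proof eventually_elim
      case (elim \<eta>)
      have "(\<Sum>k. F k \<eta>) = (\<Sum>k. (b (\<xi> k) * of_bool (\<xi> k = \<eta> k)) * f \<eta>)"
        by (intro suminf_cong) (simp add: F_def ind[OF elim(2)])
      also have "\<dots> = (\<Sum>k. b (\<xi> k) * of_bool (\<xi> k = \<eta> k)) * f \<eta>"
        using elim by (intro suminf_mult2[symmetric]) simp
      finally show ?case using elim nn by (simp add: suminf_nonneg)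
    qed
  qed
  ultimately show ?thesis by simp
qed

lemma coord_bounded: "\<xi> \<in> boundary T \<Longrightarrow> \<bar>\<phi> (\<xi> n)\<bar> \<le> (\<Sum>i\<in>lev n. \<bar>\<phi> i :: real\<bar>)"
  by (intro member_le_sum[where f = "\<lambda>i. \<bar>\<phi> i\<bar>"] boundary_lev) (auto simp: finite_lev)

text \<open>Cylinders of level below \<open>n\<close> contribute 0 by the zero mean. On the others
  the function has the constant value \<open>\<phi> (\<xi> n)\<close>, and the tail sum
  \<open>L (\<xi> n)\<close> remains.\<close>

lemma Kop_coord:
  assumes b: "symbol b L" and \<xi>: "\<xi> \<in> R" and z: "zm \<phi>"
  shows "Kop b (\<lambda>\<eta>. \<phi> (\<eta> n)) \<xi> = L (\<xi> n) * \<phi> (\<xi> n)"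
proof -
  have \<xi>b: "\<xi> \<in> boundary T" using \<xi> by (rule R_boundary)
  let ?F = "\<lambda>k. b (\<xi> k) * cint (\<lambda>\<eta>. \<phi> (\<eta> n)) (\<xi> k)"
  have "(\<lambda>k. ?F (k + n)) sums (L (\<xi> n) * \<phi> (\<xi> n))"
    using sums_mult2[OF symbol_sums[OF b \<xi>, of n], of "\<phi> (\<xi> n)"]
    by (simp add: cint_coord[OF \<xi>b] add.commute mult.assoc mult.commute[of "\<phi> (\<xi> n)"])
  moreover have "(\<Sum>k<n. ?F k) = 0"
    using cint_coord_zm[OF z] boundary_lev[OF \<xi>b] by (intro sum.neutral) auto
  ultimately have "?F sums (L (\<xi> n) * \<phi> (\<xi> n))"
    using sums_iff_shift[of ?F n] by simp
  moreover have "?F sums Kop b (\<lambda>\<eta>. \<phi> (\<eta> n)) \<xi>"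
    using coord_bounded by (intro Kop_series[OF b \<xi>]) measurable
  ultimately show ?thesis by (simp add: sums_unique2)
qed

text \<open>For \<open>zm \<phi>\<close>, the martingale with increments \<phi>, observed at level
  \<open>N\<close>.\<close>

definition Sg :: "('v \<Rightarrow> real) \<Rightarrow> nat \<Rightarrow> (nat \<Rightarrow> 'v) \<Rightarrow> real" where
  "Sg \<phi> N \<xi> = (\<Sum>n\<le>N. \<phi> (\<xi> n))"

definition sup_bound :: "('v \<Rightarrow> real) \<Rightarrow> nat \<Rightarrow> real" where
  "sup_bound \<phi> N = (\<Sum>n\<le>N. \<Sum>i\<in>lev n. \<bar>\<phi> i\<bar>)"

lemma Sg_measurable [measurable]: "Sg \<phi> N \<in> borel_measurable \<mu>"
  unfolding Sg_def by measurable

lemma Sg_bounded: "\<xi> \<in> boundary T \<Longrightarrow> \<bar>Sg \<phi> N \<xi>\<bar> \<le> sup_bound \<phi> N"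
  unfolding Sg_def sup_bound_def
  by (rule order_trans[OF sum_abs]) (intro sum_mono coord_bounded)

lemma Sg_L2: "L2 \<mu> (Sg \<phi> N)"
  by (rule L2_bounded[OF finite_measure_axioms Sg_measurable]) (auto intro!: AE_I2 Sg_bounded simp: space_mu)

lemma Kop_bounded_integrable:
  assumes b: "symbol b L" and \<xi>: "\<xi> \<in> R" and f [measurable]: "f \<in> borel_measurable \<mu>"
    and B: "\<And>\<eta>. \<eta> \<in> boundary T \<Longrightarrow> \<bar>f \<eta>\<bar> \<le> B"
  shows "integrable \<mu> (\<lambda>\<eta>. enn2real (cker b \<xi> \<eta>) * f \<eta>)"
proof (rule Kop_integrable[OF R_boundary[OF \<xi>] f])
  have [measurable]: "cker b \<xi> \<in> borel_measurable \<mu>" using R_boundary[OF \<xi>] by measurable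
  have "(\<integral>\<^sup>+\<eta>. cker b \<xi> \<eta> * ennreal \<bar>f \<eta>\<bar> \<partial>\<mu>) \<le> (\<integral>\<^sup>+\<eta>. cker b \<xi> \<eta> * ennreal B \<partial>\<mu>)"
    using B by (intro nn_integral_mono mult_left_mono ennreal_leI) (auto simp: space_mu)
  also have "\<dots> = ennreal (L (root T)) * ennreal B"
    by (simp add: nn_integral_multc mass_cker[OF b \<xi>])
  also have "\<dots> < \<infinity>" by (simp add: ennreal_mult_less_top)
  finally show "(\<integral>\<^sup>+\<eta>. cker b \<xi> \<eta> * ennreal \<bar>f \<eta>\<bar> \<partial>\<mu>) < \<infinity>" .
qed

lemma Kop_Sg:
  assumes b: "symbol b L" and \<xi>: "\<xi> \<in> R" and z: "zm \<phi>"
  shows "Kop b (Sg \<phi> N) \<xi> = Sg (\<lambda>i. L i * \<phi> i) N \<xi>"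
proof -
  have i: "integrable \<mu> (\<lambda>\<eta>. enn2real (cker b \<xi> \<eta>) * \<phi> (\<eta> n))" for n
    using coord_bounded by (intro Kop_bounded_integrable[OF b \<xi>]) measurable
  have "Kop b (Sg \<phi> N) \<xi> = (\<Sum>n\<le>N. Kop b (\<lambda>\<eta>. \<phi> (\<eta> n)) \<xi>)"
    unfolding Kop_def Sg_def sum_distrib_left using i by (intro Bochner_Integration.integral_sum) auto
  then show ?thesis by (simp add: Kop_coord[OF b \<xi> z] Sg_def)
qed

section \<open>Averages over cylinders and martingale approximation in L2\<close>

definition av :: "((nat \<Rightarrow> 'v) \<Rightarrow> real) \<Rightarrow> 'v \<Rightarrow> real" where
  "av f i = cint f i / m i"

definition inc :: "((nat \<Rightarrow> 'v) \<Rightarrow> real) \<Rightarrow> 'v \<Rightarrow> real" where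
  "inc f i = av f i - (if i = root T then 0 else av f (parent T i))"

lemma av_mult_m: "i \<in> sites T \<Longrightarrow> av f i * m i = cint f i"
  using cint_null by (cases "m i = 0") (auto simp: av_def)

lemma zm_inc: "integrable \<mu> f \<Longrightarrow> zm (inc f)"
  unfolding zm_def
proof
  fix i assume f: "integrable \<mu> f" and i: "i \<in> sites T"
  have "(\<Sum>j\<in>succs T i. inc f j * m j) = (\<Sum>j\<in>succs T i. cint f j - av f i * m j)"
    by (rule sum.cong) (auto simp: inc_def succs_iff left_diff_distrib av_mult_m)
  also have "\<dots> = cint f i - av f i * m i"
    by (simp add: sum_subtractf cint_succs[OF f i] measure_succs[OF i] sum_distrib_left[symmetric])
  finally show "(\<Sum>j\<in>succs T i. inc f j * m j) = 0" by (simp add: av_mult_m[OF i])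
qed

lemma Sg_inc: "\<xi> \<in> boundary T \<Longrightarrow> Sg (inc f) N \<xi> = av f (\<xi> N)"
  unfolding Sg_def
  by (induction N) (simp_all add: inc_def boundary_0 boundary_Suc_neq_root boundary_parent)

text \<open>Weights of the conditional expectation given level \<open>N\<close>, which thus becomes
  a kernel operator of the same kind. Its multiplier \<open>LE N\<close> is 1 up to level
  \<open>N\<close> and 0 beyond, and \<open>Kop_L2\<close> makes it a contraction.\<close>

definition bE :: "nat \<Rightarrow> 'v \<Rightarrow> real" where
  "bE N i = of_bool (level T i = N) / m i"

definition LE :: "nat \<Rightarrow> 'v \<Rightarrow> real" where
  "LE N i = of_bool (level T i \<le> N)"

lemma symbol_E: "symbol (bE N) (LE N)"
  unfolding symbol_def
proof (intro conjI ballI allI)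
  fix \<xi> n assume \<xi>: "\<xi> \<in> R"
  then have \<xi>b: "\<xi> \<in> boundary T" by (rule R_boundary)
  have eq: "bE N (\<xi> (n + k)) * m (\<xi> (n + k)) = (if n \<le> N \<and> k = N - n then 1 else 0)" for k
    using m_pos[OF \<xi>, of "n + k"] by (auto simp: bE_def boundary_level[OF \<xi>b])
  show "(\<lambda>k. bE N (\<xi> (n + k)) * m (\<xi> (n + k))) sums LE N (\<xi> n)"
    unfolding eq using sums_single[of "N - n" "\<lambda>_. 1 :: real"] by (cases "n \<le> N") (simp_all add: LE_def boundary_level[OF \<xi>b])
qed (auto simp: bE_def LE_def level_succs)

lemma Kop_E:
  assumes \<xi>: "\<xi> \<in> R"
  shows "Kop (bE N) f \<xi> = av f (\<xi> N)"
proof -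
  have \<xi>b: "\<xi> \<in> boundary T" using \<xi> by (rule R_boundary)
  have ck: "cker (bE N) \<xi> \<eta> = ennreal (1 / m (\<xi> N)) * of_bool (\<xi> N = \<eta> N)" for \<eta>
  proof -
    have "cker (bE N) \<xi> \<eta> = (\<Sum>n\<in>{N}. ennreal (bE N (\<xi> n)) * of_bool (\<xi> n = \<eta> n))"
      unfolding cker_def by (rule suminf_finite) (auto simp: bE_def boundary_level[OF \<xi>b])
    then show ?thesis by (simp add: bE_def boundary_level[OF \<xi>b])
  qed
  have "Kop (bE N) f \<xi> = (\<integral>\<eta>. 1 / m (\<xi> N) * (indicator (cyl T (\<xi> N)) \<eta> * f \<eta>) \<partial>\<mu>)"
    unfolding Kop_def
    by (rule Bochner_Integration.integral_cong)
       (auto simp: ck space_mu mem_cyl_boundary[OF \<xi>b] indicator_def)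
  then show ?thesis by (simp add: av_def cint_def)
qed

lemma sets_mu_gen: "sets \<mu> = sigma_sets (space \<mu>) (insert {} (cyl T ` sites T))"
proof -
  have "sigma_sets (boundary T) (insert {} (cyl T ` sites T)) = sigma_sets (boundary T) (cyl T ` sites T)"
    by (intro antisym sigma_sets_mono sigma_sets_mono') (auto intro: sigma_sets.Empty)
  then show ?thesis by (simp add: sets_mu sets_boundary_sigma space_mu)
qed

text \<open>Martingale convergence by density: on the indicator of a cylinder the conditional
  expectation is eventually exact, and the contraction property carries the limit over to all of
  L2.\<close>

lemma Kop_E_tendsto: "L2 \<mu> f \<Longrightarrow> L2_tendsto \<mu> (\<lambda>N. Kop (bE N) f) f sequentially"
proof (erule L2_dense_induct[where Q = "\<lambda>f. L2_tendsto \<mu> (\<lambda>N. Kop (bE N) f) f sequentially", OF _ sets_mu_gen Int_stable_cyls])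
  show "insert {} (cyl T ` sites T) \<subseteq> Pow (space \<mu>)" using cyl_subset by (auto simp: space_mu)
  show "space \<mu> \<in> insert {} (cyl T ` sites T)"
    by (auto simp: space_mu intro!: image_eqI[of _ _ "root T"])
next
  fix A assume A: "A \<in> insert {} (cyl T ` sites T)"
  then have As: "A \<in> sets \<mu>" using cyl_mu by auto
  have l2: "L2 \<mu> (indicator A)"
    using As by (intro L2_bounded[where B = 1] finite_measure_axioms) (auto simp: indicator_def)
  \<comment> \<open>From the level of the cylinder \<open>A\<close> on, the level \<open>N\<close>
    cylinder around a ray lies inside \<open>A\<close> or misses it.\<close>
  obtain N0 where N0: "\<And>N \<xi>. N0 \<le> N \<Longrightarrow> \<xi> \<in> boundary T \<Longrightarrow> cyl T (\<xi> N) \<inter> A = (if \<xi> \<in> A then cyl T (\<xi> N) else {})"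
  proof (cases "A = {}")
    case False
    then obtain i where i: "i \<in> sites T" "A = cyl T i" using A by auto
    show ?thesis
    proof (rule that[of "level T i"])
      fix N \<xi> assume N: "level T i \<le> N" and \<xi>: "\<xi> \<in> boundary T"
      show "cyl T (\<xi> N) \<inter> A = (if \<xi> \<in> A then cyl T (\<xi> N) else {})"
      proof (rule set_eqI)
        fix \<eta>
        show "\<eta> \<in> cyl T (\<xi> N) \<inter> A \<longleftrightarrow> \<eta> \<in> (if \<xi> \<in> A then cyl T (\<xi> N) else {})"
        proof (cases "\<eta> \<in> boundary T \<and> \<eta> N = \<xi> N")
          case True
          then have "\<eta> (level T i) = \<xi> (level T i)"
            using boundary_eq_below[OF _ \<xi> _ N] by blast
          then show ?thesis using True \<xi> by (simp add: i(2) mem_cyl_boundary cyl_iff)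
        qed (use \<xi> in \<open>auto simp: mem_cyl_boundary\<close>)
      qed
    qed
  next
    case True
    show ?thesis by (rule that[of 0]) (simp add: True)
  qed
  show "L2_tendsto \<mu> (\<lambda>N. Kop (bE N) (indicator A)) (indicator A) sequentially"
  proof (rule L2_tendsto_cong_AE[OF L2_tendsto_const[OF l2]])
    show "\<forall>\<^sub>F N in sequentially. L2 \<mu> (Kop (bE N) (indicator A)) \<and> (AE \<xi> in \<mu>. indicator A \<xi> = Kop (bE N) (indicator A) \<xi>)"
      unfolding eventually_sequentially
    proof (intro exI[of _ N0] allI impI conjI)
      fix N assume N: "N0 \<le> N"
      show "L2 \<mu> (Kop (bE N) (indicator A))" by (rule Kop_L2[OF symbol_E l2])
      show "AE \<xi> in \<mu>. indicator A \<xi> = Kop (bE N) (indicator A) \<xi>"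
        using AE_R
      proof eventually_elim
        case (elim \<xi>)
        have \<xi>b: "\<xi> \<in> boundary T" using elim by (rule R_boundary)
        have "cint (indicator A) (\<xi> N) = measure \<mu> (cyl T (\<xi> N) \<inter> A)"
        proof -
          have "cyl T (\<xi> N) \<inter> A \<subseteq> space \<mu>" using sets.sets_into_space[OF As] by blast
          then show ?thesis
            unfolding cint_def indicator_inter_arith[symmetric] by (simp add: Int_absorb2)
        qed
        then show ?case
          using m_pos[OF elim, of N] by (simp add: Kop_E[OF elim] av_def N0[OF N \<xi>b])
      qed
    qed
  qed (auto simp: l2)
next
  fix u v :: "(nat \<Rightarrow> 'v) \<Rightarrow> real" and a c :: real
  assume l2: "L2 \<mu> u" "L2 \<mu> v"
    and t: "L2_tendsto \<mu> (\<lambda>N. Kop (bE N) u) u sequentially" "L2_tendsto \<mu> (\<lambda>N. Kop (bE N) v) v sequentially"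
  show "L2_tendsto \<mu> (\<lambda>N. Kop (bE N) (\<lambda>x. a * u x + c * v x)) (\<lambda>x. a * u x + c * v x) sequentially"
  proof (rule L2_tendsto_cong_AE[OF L2_tendsto_add[OF L2_tendsto_cmult[OF t(1)] L2_tendsto_cmult[OF t(2)]]])
    show "\<forall>\<^sub>F N in sequentially. L2 \<mu> (Kop (bE N) (\<lambda>x. a * u x + c * v x)) \<and>
      (AE x in \<mu>. a * Kop (bE N) u x + c * Kop (bE N) v x = Kop (bE N) (\<lambda>x. a * u x + c * v x) x)"
    proof -
      have ae: "AE x in \<mu>. a * Kop (bE N) u x + c * Kop (bE N) v x = Kop (bE N) (\<lambda>x. a * u x + c * v x) x" for N
        using Kop_linear[OF symbol_E l2, of N a c] by eventually_elim simp
      show ?thesis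
        by (rule always_eventually, intro allI conjI ae Kop_L2(1)[OF symbol_E L2_add[OF L2_cmult[OF l2(1)] L2_cmult[OF l2(2)]]])
    qed
  qed (auto intro!: L2_add L2_cmult l2)
next
  fix u v assume u: "L2_tendsto \<mu> u v sequentially"
    and A: "\<And>n. L2_tendsto \<mu> (\<lambda>N. Kop (bE N) (u n)) (u n) sequentially"
  show "L2_tendsto \<mu> (\<lambda>N. Kop (bE N) v) v sequentially"
    using u A
  proof (rule L2_tendsto_approx)
    show "\<forall>\<^sub>F N in sequentially. \<forall>f g. L2 \<mu> f \<longrightarrow> L2 \<mu> g \<longrightarrow> L2 \<mu> (Kop (bE N) f) \<and>
      (\<integral>x. (Kop (bE N) f x - Kop (bE N) g x)\<^sup>2 \<partial>\<mu>) \<le> (\<integral>x. (f x - g x)\<^sup>2 \<partial>\<mu>)"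
      using Kop_diff_le[OF symbol_E] by (intro always_eventually allI impI conjI Kop_L2[OF symbol_E]) (auto simp: LE_def)
  qed
qed

end

section \<open>Multipliers of the operators\<close>

context potential_tree
begin

lemma Sg_inc_tendsto:
  assumes f: "L2 \<mu> f"
  shows "L2_tendsto \<mu> (Sg (inc f)) f sequentially"
proof (rule L2_tendsto_cong_AE[OF Kop_E_tendsto[OF f]])
  show "\<forall>\<^sub>F N in sequentially. L2 \<mu> (Sg (inc f) N) \<and> (AE \<xi> in \<mu>. Kop (bE N) f \<xi> = Sg (inc f) N \<xi>)"
  proof (rule always_eventually, intro allI conjI Sg_L2)
    fix N
    show "AE \<xi> in \<mu>. Kop (bE N) f \<xi> = Sg (inc f) N \<xi>"
      using AE_R by eventually_elim (simp add: Kop_E Sg_inc R_boundary)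
  qed
qed (auto simp: f)

lemma zm_inc_L2: "L2 \<mu> f \<Longrightarrow> zm (inc f)"
  by (intro zm_inc L2_integrable)

lemma Kop_Sg_AE: "symbol b L \<Longrightarrow> zm \<phi> \<Longrightarrow> AE \<xi> in \<mu>. Kop b (Sg \<phi> N) \<xi> = Sg (\<lambda>i. L i * \<phi> i) N \<xi>"
  using AE_R by eventually_elim (rule Kop_Sg)

text \<open>A bounded operator may be applied to the martingale of \<open>f\<close> before passing
  to the limit.\<close>

lemma Kop_spectral:
  assumes b: "symbol b L" and f: "L2 \<mu> f"
  shows "L2_tendsto \<mu> (Sg (\<lambda>i. L i * inc f i)) (Kop b f) sequentially"
proof (rule L2_tendsto_cong_AE[OF Kop_tendsto[OF b Sg_inc_tendsto[OF f]]])
  show "\<forall>\<^sub>F N in sequentially. L2 \<mu> (Sg (\<lambda>i. L i * inc f i) N) \<and>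
      (AE \<xi> in \<mu>. Kop b (Sg (inc f) N) \<xi> = Sg (\<lambda>i. L i * inc f i) N \<xi>)"
    by (rule always_eventually, intro allI conjI Sg_L2 Kop_Sg_AE[OF b zm_inc_L2[OF f]])
qed (auto intro: Kop_L2[OF b f])

text \<open>Multipliers multiply under composition, because by \<open>zm_mult\<close> the first
  operator leaves increments of zero mean.\<close>

lemma Kop_comp_spectral:
  assumes b: "symbol b L" "symbol b' L'" and f: "L2 \<mu> f"
  shows "L2_tendsto \<mu> (Sg (\<lambda>i. L i * (L' i * inc f i))) (Kop b (Kop b' f)) sequentially"
proof (rule L2_tendsto_cong_AE[OF Kop_tendsto[OF b(1) Kop_spectral[OF b(2) f]]])
  show "\<forall>\<^sub>F N in sequentially. L2 \<mu> (Sg (\<lambda>i. L i * (L' i * inc f i)) N) \<and>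
      (AE \<xi> in \<mu>. Kop b (Sg (\<lambda>i. L' i * inc f i) N) \<xi> = Sg (\<lambda>i. L i * (L' i * inc f i)) N \<xi>)"
    by (rule always_eventually, intro allI conjI Sg_L2 Kop_Sg_AE[OF b(1) zm_mult[OF b(2) zm_inc_L2[OF f]]])
qed (auto intro: Kop_L2[OF b(1) Kop_L2(1)[OF b(2) f]])

lemma Sg_cong: "(\<And>i. i \<in> sites T \<Longrightarrow> \<phi> i = \<psi> i) \<Longrightarrow> \<xi> \<in> boundary T \<Longrightarrow> Sg \<phi> N \<xi> = Sg \<psi> N \<xi>"
  unfolding Sg_def by (intro sum.cong) (auto simp: boundary_site)

lemma Sg_diff: "Sg \<phi> N \<xi> - Sg \<psi> N \<xi> = Sg (\<lambda>i. \<phi> i - \<psi> i) N \<xi>"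
  by (simp add: Sg_def sum_subtractf)

lemma sup_bound_nonneg: "0 \<le> sup_bound \<phi> N"
  unfolding sup_bound_def by (intro sum_nonneg) auto

lemma sup_bound_tendsto:
  assumes "\<And>i. i \<in> sites T \<Longrightarrow> ((\<lambda>t. c t i) \<longlongrightarrow> c' i) F"
  shows "((\<lambda>t. sup_bound (\<lambda>i. c t i - c' i) N) \<longlongrightarrow> 0) F"
proof -
  have "((\<lambda>t. sup_bound (\<lambda>i. c t i - c' i) N) \<longlongrightarrow> (\<Sum>n\<le>N. \<Sum>i\<in>lev n. \<bar>c' i - c' i\<bar>)) F"
    unfolding sup_bound_def using assms by (intro tendsto_sum tendsto_rabs tendsto_diff tendsto_const) (auto simp: lev_def)
  then show ?thesis by simp
qed

text \<open>Only the finitely many sites up to level \<open>N\<close> enter, so convergence of the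
  coefficients is uniform.\<close>

lemma Sg_tendsto:
  assumes "\<And>i. i \<in> sites T \<Longrightarrow> ((\<lambda>t. c t i) \<longlongrightarrow> c' i) F"
  shows "L2_tendsto \<mu> (\<lambda>t. Sg (c t) N) (Sg c' N) F"
proof (rule L2_tendsto_le)
  show "\<forall>\<^sub>F t in F. (\<integral>\<xi>. (Sg (c t) N \<xi> - Sg c' N \<xi>)\<^sup>2 \<partial>\<mu>) \<le> (sup_bound (\<lambda>i. c t i - c' i) N)\<^sup>2"
  proof (intro always_eventually allI)
    fix t
    have "(\<integral>\<xi>. (Sg (c t) N \<xi> - Sg c' N \<xi>)\<^sup>2 \<partial>\<mu>) \<le> (\<integral>\<xi>. (sup_bound (\<lambda>i. c t i - c' i) N)\<^sup>2 \<partial>\<mu>)"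
    proof (rule integral_mono)
      show "integrable \<mu> (\<lambda>\<xi>. (Sg (c t) N \<xi> - Sg c' N \<xi>)\<^sup>2)"
        by (intro L2_square L2_diff Sg_L2)
      fix \<xi> assume "\<xi> \<in> space \<mu>"
      then have "\<bar>Sg (c t) N \<xi> - Sg c' N \<xi>\<bar> \<le> \<bar>sup_bound (\<lambda>i. c t i - c' i) N\<bar>"
        using Sg_bounded[of \<xi> "\<lambda>i. c t i - c' i" N] sup_bound_nonneg[of "\<lambda>i. c t i - c' i" N]
        by (simp add: Sg_diff space_mu)
      then show "(Sg (c t) N \<xi> - Sg c' N \<xi>)\<^sup>2 \<le> (sup_bound (\<lambda>i. c t i - c' i) N)\<^sup>2"
        by (simp only: abs_le_square_iff)
    qed simp
    then show "(\<integral>\<xi>. (Sg (c t) N \<xi> - Sg c' N \<xi>)\<^sup>2 \<partial>\<mu>) \<le> (sup_bound (\<lambda>i. c t i - c' i) N)\<^sup>2"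
      by (simp add: prob_space)
  qed
  show "((\<lambda>t. (sup_bound (\<lambda>i. c t i - c' i) N)\<^sup>2) \<longlongrightarrow> 0) F"
    using tendsto_power[OF sup_bound_tendsto[OF assms], where n = 2] by simp
qed (simp_all add: Sg_L2)

text \<open>The expectations on the levels commute with \<open>Kop b\<close>, because their
  multipliers do. So the image of the martingale of \<open>f\<close> vanishes at every level, and
  division by \<open>L\<close> shows that the increments of \<open>f\<close> are 0.\<close>

lemma Kop_injective:
  assumes "symbol b L" "AE \<xi> in \<mu>. Kop b f \<xi> = 0" and f: "L2 \<mu> f" and L: "\<And>i. i \<in> sites T \<Longrightarrow> L i \<noteq> 0"
  shows "AE \<xi> in \<mu>. f \<xi> = 0"
proof -
  have vanish: "AE \<xi> in \<mu>. Sg (\<lambda>i. L i * inc f i) N \<xi> = 0" for N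
  proof -
    note KE = Kop_comp_spectral[OF assms(1) symbol_E f, of N]
    have "L2_tendsto \<mu> (Sg (\<lambda>i. LE N i * (L i * inc f i))) (Kop (bE N) (Kop b f)) sequentially"
      by (rule Kop_comp_spectral[OF symbol_E assms(1) f])
    moreover have "(\<lambda>i. LE N i * (L i * inc f i)) = (\<lambda>i. L i * (LE N i * inc f i))"
      by (simp add: fun_eq_iff mult.left_commute)
    ultimately have "AE \<xi> in \<mu>. Kop b (Kop (bE N) f) \<xi> = Kop (bE N) (Kop b f) \<xi>"
      using KE by (intro L2_tendsto_unique[OF sequentially_bot]) auto
    moreover have "AE \<xi> in \<mu>. Kop (bE N) (Kop b f) \<xi> = 0"
    proof -
      have "Kop (bE N) (Kop b f) \<xi> = Kop (bE N) (\<lambda>_. 0) \<xi>" if "\<xi> \<in> boundary T" for \<xi>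
        using assms(2) Kop_L2(1)[OF assms(1) f] that by (intro Kop_cong_AE) (auto dest: L2_measurable)
      then show ?thesis by (intro AE_I2) (simp add: Kop_def space_mu)
    qed
    moreover have "AE \<xi> in \<mu>. Kop b (Kop (bE N) f) \<xi> = Sg (\<lambda>i. L i * inc f i) N \<xi>"
      using AE_R
    proof eventually_elim
      case (elim \<xi>)
      have ae: "AE \<eta> in \<mu>. Kop (bE N) f \<eta> = Sg (inc f) N \<eta>"
        using AE_R by eventually_elim (simp add: Kop_E Sg_inc R_boundary)
      have "Kop b (Kop (bE N) f) \<xi> = Kop b (Sg (inc f) N) \<xi>"
        using Kop_L2(1)[OF symbol_E f] by (intro Kop_cong_AE ae R_boundary elim) (auto dest: L2_measurable)
      then show ?case using Kop_Sg[OF assms(1) elim zm_inc_L2[OF f]] by simp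
    qed
    ultimately show ?thesis by eventually_elim simp
  qed
  have "AE \<xi> in \<mu>. \<forall>N. Sg (\<lambda>i. L i * inc f i) N \<xi> = 0"
    using vanish by (simp add: AE_all_countable)
  then have zero: "AE \<xi> in \<mu>. \<forall>N. Sg (inc f) N \<xi> = 0"
    using AE_R
  proof eventually_elim
    case (elim \<xi>)
    have "inc f (\<xi> n) = 0" for n
    proof -
      \<comment> \<open>The difference of two consecutive partial sums; for \<open>n = 0\<close>,
        the first partial sum itself.\<close>
      have "L (\<xi> n) * inc f (\<xi> n) = 0"
        using elim(1)[rule_format, of n] elim(1)[rule_format, of "n - 1"]
        by (cases n) (simp_all add: Sg_def)
      then show ?thesis using L[OF boundary_site[OF R_boundary[OF elim(2)]]] by simp
    qed
    then show ?case by (simp add: Sg_def)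
  qed
  have "L2_tendsto \<mu> (Sg (inc f)) (\<lambda>_. 0) sequentially"
  proof (rule L2_tendsto_cong_AE[OF L2_tendsto_const[OF L2_zero]])
    show "\<forall>\<^sub>F N in sequentially. L2 \<mu> (Sg (inc f) N) \<and> (AE \<xi> in \<mu>. 0 = Sg (inc f) N \<xi>)"
    proof (rule always_eventually, intro allI conjI Sg_L2)
      fix N show "AE \<xi> in \<mu>. 0 = Sg (inc f) N \<xi>" using zero by eventually_elim simp
    qed
  qed (auto intro: L2_zero)
  from L2_tendsto_unique[OF sequentially_bot Sg_inc_tendsto[OF f] this] show ?thesis .
qed

section \<open>Conditional expectations given the levels\<close>

lemma level_sets:
  assumes "A \<in> sets (level_sigma T n)"
  shows "\<exists>J\<subseteq>lev n. A = {\<xi> \<in> boundary T. \<xi> n \<in> J}"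
proof -
  have "sets (level_sigma T n) = sigma_sets (boundary T) (cyl T ` {i \<in> sites T. level T i = n})"
    unfolding level_sigma_def by (rule sets_measure_of) (use cyl_subset in blast)
  with assms have "A \<in> sigma_sets (boundary T) (cyl T ` {i \<in> sites T. level T i = n})" by simp
  then show ?thesis
  proof (induction rule: sigma_sets.induct)
    case (Basic A)
    then obtain i where "i \<in> lev n" "A = cyl T i" by (auto simp: lev_def)
    then show ?case by (intro exI[of _ "{i}"]) (auto simp: mem_cyl_lev)
  next
    case Empty
    then show ?case by (intro exI[of _ "{}"]) auto
  next
    case (Compl A)
    then obtain J where "J \<subseteq> lev n" "A = {\<xi> \<in> boundary T. \<xi> n \<in> J}" by blast
    then show ?case by (intro exI[of _ "lev n - J"]) (auto simp: boundary_lev)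
  next
    case (Union A)
    from Union(2) have "\<forall>k. \<exists>J. J \<subseteq> lev n \<and> A k = {\<xi> \<in> boundary T. \<xi> n \<in> J}" by blast
    from choice[OF this] obtain J where J: "\<forall>k. J k \<subseteq> lev n \<and> A k = {\<xi> \<in> boundary T. \<xi> n \<in> J k}" by blast
    then have "(\<Union>k. A k) = {\<xi> \<in> boundary T. \<xi> n \<in> (\<Union>k. J k)}" by auto
    moreover have "(\<Union>k. J k) \<subseteq> lev n" using J by blast
    ultimately show ?case by blast
  qed
qed

lemma coord_preimage:
  assumes "J \<subseteq> lev n"
  shows "{\<xi> \<in> boundary T. \<xi> n \<in> J} = (\<Union>i\<in>J. cyl T i)"
proof (intro set_eqI iffI)
  fix \<xi> assume "\<xi> \<in> {\<xi> \<in> boundary T. \<xi> n \<in> J}"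
  then have "\<xi> n \<in> J" "\<xi> \<in> cyl T (\<xi> n)" by (auto simp: mem_cyl_boundary)
  then show "\<xi> \<in> (\<Union>i\<in>J. cyl T i)" by blast
next
  fix \<xi> assume "\<xi> \<in> (\<Union>i\<in>J. cyl T i)"
  then show "\<xi> \<in> {\<xi> \<in> boundary T. \<xi> n \<in> J}"
    using assms by (auto simp: mem_cyl_lev subset_iff)
qed

lemma space_level_sigma: "space (level_sigma T n) = boundary T"
  unfolding level_sigma_def by (rule space_measure_of) (use cyl_subset in blast)

lemma subalgebra_level: "subalgebra \<mu> (level_sigma T n)"
  unfolding subalgebra_def
proof
  show "space (level_sigma T n) = space \<mu>" by (simp add: space_level_sigma space_mu)
  show "sets (level_sigma T n) \<subseteq> sets \<mu>"
  proof
    fix A assume "A \<in> sets (level_sigma T n)"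
    then obtain J where J: "J \<subseteq> lev n" "A = {\<xi> \<in> boundary T. \<xi> n \<in> J}" using level_sets by blast
    then have "A = (\<Union>i\<in>J. cyl T i)" using coord_preimage by simp
    then show "A \<in> sets \<mu>"
      using J finite_subset[OF J(1) finite_lev] cyl_mu by (auto intro!: sets.finite_UN simp: lev_def subset_iff)
  qed
qed

lemma level_coord_measurable: "(\<lambda>\<xi>. \<phi> (\<xi> n) :: real) \<in> borel_measurable (level_sigma T n)"
proof (rule measurableI)
  fix A :: "real set" assume "A \<in> sets borel"
  have cs: "cyl T i \<in> sets (level_sigma T n)" if "i \<in> lev n" for i
  proof -
    have "sets (level_sigma T n) = sigma_sets (boundary T) (cyl T ` {i \<in> sites T. level T i = n})"
      unfolding level_sigma_def by (rule sets_measure_of) (use cyl_subset in blast)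
    then show ?thesis using that by (auto simp: lev_def)
  qed
  have "(\<lambda>\<xi>. \<phi> (\<xi> n)) -` A \<inter> space (level_sigma T n) = (\<Union>i\<in>{i \<in> lev n. \<phi> i \<in> A}. cyl T i)"
    using coord_preimage[of "{i \<in> lev n. \<phi> i \<in> A}" n] by (auto simp: space_level_sigma boundary_lev)
  then show "(\<lambda>\<xi>. \<phi> (\<xi> n)) -` A \<inter> space (level_sigma T n) \<in> sets (level_sigma T n)"
    using cs finite_lev[of n] by (auto intro!: sets.finite_UN)
qed auto

text \<open>The set where \<open>f\<close> has the value \<open>f \<xi>\<close> belongs to the
  sigma-field of level \<open>n\<close>, so with \<xi> it contains all rays with the same
  \<open>n\<close>-th site.\<close>

lemma level_measurable_factor:
  assumes f: "(f :: _ \<Rightarrow> real) \<in> borel_measurable (level_sigma T n)"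
  shows "\<exists>\<psi>. \<forall>\<xi>\<in>boundary T. f \<xi> = \<psi> (\<xi> n)"
proof -
  have eq: "f \<eta> = f \<xi>" if \<xi>: "\<xi> \<in> boundary T" and \<eta>: "\<eta> \<in> boundary T" "\<eta> n = \<xi> n" for \<xi> \<eta>
  proof -
    have "f -` {f \<xi>} \<inter> space (level_sigma T n) \<in> sets (level_sigma T n)"
      by (rule measurable_sets[OF f]) simp
    from level_sets[OF this] obtain J where J: "f -` {f \<xi>} \<inter> boundary T = {\<xi> \<in> boundary T. \<xi> n \<in> J}"
      by (auto simp only: space_level_sigma)
    have "\<xi> \<in> f -` {f \<xi>} \<inter> boundary T" using \<xi> by simp
    then have "\<xi> n \<in> J" unfolding J by simp
    then have "\<eta> \<in> f -` {f \<xi>} \<inter> boundary T" unfolding J using \<eta> by simp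
    then show ?thesis by simp
  qed
  define \<psi> where "\<psi> i = f (SOME \<eta>. \<eta> \<in> boundary T \<and> \<eta> n = i)" for i
  have "f \<xi> = \<psi> (\<xi> n)" if "\<xi> \<in> boundary T" for \<xi>
  proof -
    have "(SOME \<eta>. \<eta> \<in> boundary T \<and> \<eta> n = \<xi> n) \<in> boundary T \<and> (SOME \<eta>. \<eta> \<in> boundary T \<and> \<eta> n = \<xi> n) n = \<xi> n"
      by (rule someI[of _ \<xi>]) (use that in simp)
    then show ?thesis unfolding \<psi>_def by (intro eq[OF that, symmetric]) auto
  qed
  then show ?thesis by blast
qed

lemma Sg_inc_level:
  assumes \<xi>: "\<xi> \<in> R" and f: "\<And>\<eta>. \<eta> \<in> boundary T \<Longrightarrow> f \<eta> = \<psi> (\<eta> n)"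
  shows "Sg (inc f) n \<xi> = f \<xi>"
proof -
  have \<xi>b: "\<xi> \<in> boundary T" using \<xi> by (rule R_boundary)
  have "cint f (\<xi> n) = cint (\<lambda>\<eta>. \<psi> (\<eta> n)) (\<xi> n)"
    unfolding cint_def using f by (intro Bochner_Integration.integral_cong) (auto simp: space_mu)
  also have "\<dots> = \<psi> (\<xi> n) * m (\<xi> n)" by (rule cint_coord[OF \<xi>b]) simp
  finally show ?thesis using m_pos[OF \<xi>, of n] by (simp add: Sg_inc[OF \<xi>b] av_def f[OF \<xi>b])
qed

text \<open>A set of this sigma-field is a finite disjoint union of cylinders, so the defining
  identity reduces to \<open>av f i * m i = cint f i\<close>.\<close>

lemma cond_exp_level:
  assumes f: "integrable \<mu> f"
  shows "AE \<xi> in \<mu>. real_cond_exp \<mu> (level_sigma T n) f \<xi> = av f (\<xi> n)"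
proof -
  interpret finite_measure_subalgebra \<mu> "level_sigma T n"
    by (intro finite_measure_subalgebra.intro finite_measure_subalgebra_axioms.intro finite_measure_axioms subalgebra_level)
  show ?thesis
  proof (rule real_cond_exp_charact)
    show "integrable \<mu> f" by fact
    show "integrable \<mu> (\<lambda>\<xi>. av f (\<xi> n))" by (rule integrable_coord)
    show "(\<lambda>\<xi>. av f (\<xi> n)) \<in> borel_measurable (level_sigma T n)" by (rule level_coord_measurable)
    fix A assume "A \<in> sets (level_sigma T n)"
    then obtain J where J: "J \<subseteq> lev n" "A = {\<xi> \<in> boundary T. \<xi> n \<in> J}" using level_sets by blast
    have fin: "finite J" using J finite_lev finite_subset by blast
    have Js: "i \<in> sites T" if "i \<in> J" for i using that J by (auto simp: lev_def)
    have ind: "indicator A \<xi> = (\<Sum>i\<in>J. indicator (cyl T i) \<xi> :: real)" for \<xi>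
    proof -
      have "A = (\<Union>i\<in>J. cyl T i)" using J coord_preimage by simp
      moreover have "disjoint_family_on (cyl T) J" using J(1) disjoint_cyl by (rule disjoint_family_on_mono)
      ultimately show ?thesis by (simp add: indicator_UN_disjoint fin)
    qed
    have split: "(\<integral>\<xi>\<in>A. g \<xi> \<partial>\<mu>) = (\<Sum>i\<in>J. cint g i)" if g: "integrable \<mu> g" for g
    proof -
      have "(\<integral>\<xi>\<in>A. g \<xi> \<partial>\<mu>) = (\<integral>\<xi>. (\<Sum>i\<in>J. indicator (cyl T i) \<xi> * g \<xi>) \<partial>\<mu>)"
        by (simp add: set_lebesgue_integral_def ind sum_distrib_right)
      then show ?thesis
        unfolding cint_def using integrable_cyl[OF g] Js by (simp add: Bochner_Integration.integral_sum)
    qed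
    have "cint (\<lambda>\<xi>. av f (\<xi> n)) i = cint f i" if i: "i \<in> J" for i
    proof -
      obtain \<xi> where \<xi>: "\<xi> \<in> boundary T" "\<xi> n = i"
        using ex_boundary[OF Js[OF i]] mem_cyl_lev[of i n] i J(1) by blast
      show ?thesis using cint_coord[OF \<xi>(1), of n n "av f"] \<xi>(2) av_mult_m[OF Js[OF i]] by simp
    qed
    then show "(\<integral>\<xi>\<in>A. f \<xi> \<partial>\<mu>) = (\<integral>\<xi>\<in>A. av f (\<xi> n) \<partial>\<mu>)"
      by (simp add: split f integrable_coord)
  qed
qed

end

text \<open>The square of index pairs is cut along the diagonal: pairs with \<open>n \<le> k\<close>
  are listed by \<open>l = n\<close>, pairs with \<open>k < n\<close> by \<open>l = k\<close>. The
  latter require an interchange of sums, free for nonnegative terms.\<close>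

lemma suminf_double_split:
  fixes F :: "nat \<Rightarrow> nat \<Rightarrow> ennreal"
  shows "(\<Sum>n. \<Sum>k. F n k) = (\<Sum>l. (\<Sum>k. F l (l + k)) + (\<Sum>n. F (Suc (l + n)) l))"
proof -
  have tail: "(\<Sum>k. if l \<le> k then f k else 0) = (\<Sum>k. f (l + k))" for f :: "nat \<Rightarrow> ennreal" and l
  proof -
    have "(\<Sum>k. if l \<le> k then f k else 0) = (\<Sum>k. if l \<le> k + l then f (k + l) else 0) + (\<Sum>k<l. if l \<le> k then f k else 0)"
      by (rule suminf_offset) simp
    then show ?thesis by (simp add: add.commute)
  qed
  have "(\<Sum>n. \<Sum>k. F n k) = (\<Sum>n. \<Sum>k. (if n \<le> k then F n k else 0) + (if Suc k \<le> n then F n k else 0))"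
    by (intro suminf_cong) auto
  also have "\<dots> = (\<Sum>n. (\<Sum>k. if n \<le> k then F n k else 0) + (\<Sum>k. if Suc k \<le> n then F n k else 0))"
    by (intro suminf_cong suminf_add[symmetric]) auto
  also have "\<dots> = (\<Sum>n. \<Sum>k. if n \<le> k then F n k else 0) + (\<Sum>n. \<Sum>k. if Suc k \<le> n then F n k else 0)"
    by (intro suminf_add[symmetric]) auto
  also have "(\<Sum>n. \<Sum>k. if Suc k \<le> n then F n k else 0) = (\<Sum>k. \<Sum>n. if Suc k \<le> n then F n k else 0)"
  proof -
    have "(\<integral>\<^sup>+n. (\<Sum>k. if Suc k \<le> n then F n k else 0) \<partial>count_space UNIV)
        = (\<Sum>k. (\<integral>\<^sup>+n. (if Suc k \<le> n then F n k else 0) \<partial>count_space UNIV))"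
      by (rule nn_integral_suminf) simp
    then show ?thesis by (simp add: nn_integral_count_space_nat)
  qed
  also have "(\<Sum>n. \<Sum>k. if n \<le> k then F n k else 0) + (\<Sum>k. \<Sum>n. if Suc k \<le> n then F n k else 0)
      = (\<Sum>l. (\<Sum>k. F l (l + k)) + (\<Sum>n. F (Suc (l + n)) l))"
    unfolding tail by (subst suminf_add) auto
  finally show ?thesis .
qed

lemma suminf_product: "(\<Sum>n. A n) * (\<Sum>k. B k) = (\<Sum>n. \<Sum>k. A n * (B k :: ennreal))"
proof -
  have "(\<Sum>n. A n) * (\<Sum>k. B k) = (\<Sum>n. A n * (\<Sum>k. B k))"
    by (rule ennreal_suminf_multc[symmetric])
  also have "\<dots> = (\<Sum>n. \<Sum>k. A n * B k)"
    by (intro suminf_cong ennreal_suminf_cmult[symmetric])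
  finally show ?thesis .
qed

text \<open>From \<open>x \<le> exp x\<close> with \<open>x = t / g n\<close> one gets the bound
  \<open>g n / t\<close>.\<close>

lemma exp_minus_inverse_tendsto_0:
  fixes g :: "nat \<Rightarrow> real"
  assumes "g \<longlonglongrightarrow> 0" "\<And>n. 0 < g n" "0 < t"
  shows "(\<lambda>n. exp (- t / g n)) \<longlonglongrightarrow> 0"
proof (rule tendsto_sandwich[OF _ _ tendsto_const])
  have "(\<lambda>n. g n / t) \<longlonglongrightarrow> 0 / t" by (intro tendsto_divide assms tendsto_const) (use assms in simp)
  then show "(\<lambda>n. g n / t) \<longlonglongrightarrow> 0" by simp
  show "\<forall>\<^sub>F n in sequentially. exp (- t / g n) \<le> g n / t"
  proof (rule always_eventually, rule allI)
    fix n
    have p: "0 < t / g n" using assms by simp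
    have "t / g n \<le> exp (t / g n)" using exp_ge_add_one_self[of "t / g n"] by linarith
    then have "inverse (exp (t / g n)) \<le> inverse (t / g n)" using p by (intro le_imp_inverse_le) auto
    then show "exp (- t / g n) \<le> g n / t" by (simp add: exp_minus)
  qed
qed auto

section \<open>The transition kernel and the Green kernel\<close>

context potential_tree
begin

text \<open>On regular rays, \<open>Gfun\<close> of index \<open>n\<close> as a function of the site
  \<open>\<xi> n\<close> (see \<open>Gfun_eq\<close>). At the root the summand \<open>w 0\<close> is
  \<open>delta w 0\<close> times the total mass 1.\<close>

definition gpre :: "'v \<Rightarrow> real" where
  "gpre i = (if i = root T then gam (root T) + w 0 else gam (parent T i))"

text \<open>The coefficients of \<open>pker\<close>, with \<open>gpre\<close> and \<open>gam\<close>
  in place of \<open>Gfun\<close> at two consecutive indices.\<close>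

definition bt :: "real \<Rightarrow> 'v \<Rightarrow> real" where
  "bt t i = (exp (- t / gpre i) - exp (- t / gam i)) / m i"

text \<open>These weights sum up to \<open>w n\<close> over the levels up to \<open>n\<close>, so
  \<open>cker bU\<close> is the tree matrix extended to the boundary.\<close>

definition bU :: "'v \<Rightarrow> real" where
  "bU i = delta w (level T i)"

lemma gpre_diff: "i \<in> sites T \<Longrightarrow> gpre i - gam i = delta w (level T i) * m i"
  using gam_step[of i] prob_space by (auto simp: gpre_def delta_def space_mu)

lemma gpre_pos: "i \<in> sites T \<Longrightarrow> 0 < gpre i"
  using gam_pos[of "root T"] w_pos gam_pos[OF parent_site] by (auto simp: gpre_def intro: add_pos_pos)

lemma gam_le_gpre: "i \<in> sites T \<Longrightarrow> gam i \<le> gpre i"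
  using gpre_diff[of i] delta_pos[of "level T i"] by (smt (verit) measure_nonneg mult_nonneg_nonneg)

lemma gpre_Suc: "\<xi> \<in> boundary T \<Longrightarrow> gpre (\<xi> (Suc n)) = gam (\<xi> n)"
  by (simp add: gpre_def boundary_Suc_neq_root boundary_parent)

lemma gpre_tendsto: "\<xi> \<in> R \<Longrightarrow> (\<lambda>k. gpre (\<xi> (n + k))) \<longlonglongrightarrow> 0"
proof -
  assume \<xi>: "\<xi> \<in> R"
  then have b: "\<xi> \<in> boundary T" and l: "(\<lambda>n. gam (\<xi> n)) \<longlonglongrightarrow> 0" by (auto simp: R_def)
  have "(\<lambda>k. gpre (\<xi> (Suc k))) \<longlonglongrightarrow> 0" using l by (simp add: gpre_Suc[OF b])
  then have "(\<lambda>k. gpre (\<xi> k)) \<longlonglongrightarrow> 0" by (rule LIMSEQ_imp_Suc)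
  from LIMSEQ_ignore_initial_segment[OF this, of n] show ?thesis by (simp add: add.commute)
qed

lemma siblings_gpre: "j \<in> succs T i \<Longrightarrow> k \<in> succs T i \<Longrightarrow> gpre j = gpre k"
  by (auto simp: gpre_def succs_iff)

text \<open>Telescoping: by \<open>gpre_diff\<close> weight times mass is a decrement of
  \<open>gpre\<close>, which tends to 0 along regular rays.\<close>

lemma symbol_U: "symbol bU gpre"
  unfolding symbol_def
proof (intro conjI ballI allI)
  fix \<xi> n assume \<xi>: "\<xi> \<in> R"
  then have b: "\<xi> \<in> boundary T" by (rule R_boundary)
  have "bU (\<xi> (n + k)) * m (\<xi> (n + k)) = gpre (\<xi> (n + k)) - gpre (\<xi> (n + Suc k))" for k
    using gpre_diff[OF boundary_site[OF b], of "n + k"] gpre_Suc[OF b, of "n + k"] by (simp add: bU_def)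
  then show "(\<lambda>k. bU (\<xi> (n + k)) * m (\<xi> (n + k))) sums gpre (\<xi> n)"
    using telescope_sums'[OF gpre_tendsto[OF \<xi>, of n]] by simp
qed (auto simp: bU_def less_imp_le[OF delta_pos] intro: siblings_gpre)

lemma exp_gam_le: "i \<in> sites T \<Longrightarrow> 0 < t \<Longrightarrow> exp (- t / gam i) \<le> exp (- t / gpre i)"
  using gam_le_gpre[of i] gam_pos[of i] by (simp add: frac_le)

text \<open>The masses cancel in \<open>bt\<close> and the sum telescopes; the limit is 0 because
  \<open>gpre\<close> tends to 0 along regular rays.\<close>

lemma symbol_bt:
  assumes t: "0 < t"
  shows "symbol (bt t) (\<lambda>i. exp (- t / gpre i))"
  unfolding symbol_def
proof (intro conjI ballI allI)
  fix i assume "i \<in> sites T"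
  then show "0 \<le> bt t i" using exp_gam_le[of i t] t by (simp add: bt_def)
next
  fix \<xi> n assume \<xi>: "\<xi> \<in> R"
  then have b: "\<xi> \<in> boundary T" by (rule R_boundary)
  have eq: "bt t (\<xi> (n + k)) * m (\<xi> (n + k)) = exp (- t / gpre (\<xi> (n + k))) - exp (- t / gpre (\<xi> (n + Suc k)))" for k
    using m_pos[OF \<xi>, of "n + k"] gpre_Suc[OF b, of "n + k"] by (simp add: bt_def)
  have "(\<lambda>k. exp (- t / gpre (\<xi> (n + k)))) \<longlonglongrightarrow> 0"
    by (intro exp_minus_inverse_tendsto_0 gpre_tendsto \<xi> gpre_pos boundary_site b t)
  from telescope_sums'[OF this]
  show "(\<lambda>k. bt t (\<xi> (n + k)) * m (\<xi> (n + k))) sums exp (- t / gpre (\<xi> n))"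
    unfolding eq by simp
qed (use siblings_gpre in metis)

lemma Gfun_eq: "\<xi> \<in> R \<Longrightarrow> Gfun T w \<mu> n \<xi> = gpre (\<xi> n)"
  using symbol_sums[OF symbol_U, of \<xi> n]
  by (simp add: Gfun_def bU_def boundary_level R_boundary sums_iff)

text \<open>Agreement of two rays is inherited by smaller levels, so off the diagonal the common
  levels form a finite initial segment, described by its maximum.\<close>

lemma meet_level_iff:
  assumes "\<xi> \<in> boundary T" "\<eta> \<in> boundary T"
  shows "enat n \<le> meet_level \<xi> \<eta> \<longleftrightarrow> \<xi> n = \<eta> n"
proof (cases "\<xi> = \<eta>")
  case False
  then obtain k where k: "\<xi> k \<noteq> \<eta> k" by blast
  let ?A = "{n. \<xi> n = \<eta> n}"
  have "?A \<subseteq> {..<k}"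
  proof
    fix n assume n: "n \<in> ?A"
    have "\<not> k \<le> n"
    proof
      assume "k \<le> n"
      then have "\<xi> k = \<eta> k" using boundary_eq_below[OF assms, of n k] n by simp
      then show False using k by simp
    qed
    then show "n \<in> {..<k}" by simp
  qed
  then have fin: "finite ?A" using finite_subset by blast
  have "0 \<in> ?A" using assms by (simp add: boundary_0)
  then have M: "Max ?A \<in> ?A" using Max_in[OF fin] by blast
  have "n \<le> Max ?A \<longleftrightarrow> n \<in> ?A"
    using boundary_eq_below[OF assms, of "Max ?A" n] M Max_ge[OF fin, of n] by blast
  then show ?thesis using False by (simp add: meet_level_def)
qed (simp add: meet_level_def)

lemma pker_eq:
  assumes \<xi>: "\<xi> \<in> R" and \<eta>: "\<eta> \<in> boundary T"
  shows "pker T w \<mu> t \<xi> \<eta> = cker (bt t) \<xi> \<eta>"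
proof -
  have b: "\<xi> \<in> boundary T" using \<xi> by (rule R_boundary)
  show ?thesis
    unfolding pker_def cker_def
    by (intro suminf_cong) (simp add: meet_level_iff[OF b \<eta>] Gfun_eq[OF \<xi>] gpre_Suc[OF b] bt_def)
qed

lemma sum_delta: "(\<Sum>k\<le>n. delta w k) = w n"
  by (induction n) (auto simp: delta_def)

lemma Ubd_eq:
  assumes \<xi>: "\<xi> \<in> boundary T" and \<eta>: "\<eta> \<in> boundary T"
  shows "Ubd w \<xi> \<eta> = cker bU \<xi> \<eta>"
proof -
  have dn: "0 \<le> delta w k" for k using delta_pos[of k] by simp
  have part: "(\<Sum>k\<le>n. ennreal (delta w k)) = ennreal (w n)" for n
    using dn by (simp add: sum_ennreal sum_delta)
  have ck: "cker bU \<xi> \<eta> = (\<Sum>k. ennreal (delta w k) * of_bool (\<xi> k = \<eta> k))"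
    by (simp add: cker_def bU_def boundary_level[OF \<xi>])
  show ?thesis
  proof (cases "\<xi> = \<eta>")
    case True
    have "(\<lambda>n. \<Sum>k\<le>n. ennreal (delta w k)) \<longlonglongrightarrow> (\<Sum>k. ennreal (delta w k))"
      by (rule summable_LIMSEQ') (rule summableI)
    then have "lim (\<lambda>n. ennreal (w n)) = (\<Sum>k. ennreal (delta w k))"
      unfolding part by (rule limI)
    then show ?thesis unfolding ck using True by (simp add: Ubd_def)
  next
    case False
    then obtain N where N: "meet_level \<xi> \<eta> = enat N" by (auto simp: meet_level_def)
    have eq: "\<xi> k = \<eta> k \<longleftrightarrow> k \<le> N" for k
      using meet_level_iff[OF assms, of k] by (simp add: N)
    have "cker bU \<xi> \<eta> = (\<Sum>k\<in>{..N}. ennreal (delta w k) * of_bool (\<xi> k = \<eta> k))"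
      unfolding ck by (rule suminf_finite) (auto simp: eq)
    also have "\<dots> = (\<Sum>k\<le>N. ennreal (delta w k))"
      by (intro sum.cong) (auto simp: eq)
    finally show ?thesis using False by (simp add: Ubd_def N part)
  qed
qed

lemma Wop_eq: "\<eta> \<in> boundary T \<Longrightarrow> Wop w \<mu> f \<eta> = Kop bU f \<eta>"
  unfolding Wop_def Kop_def
  by (rule Bochner_Integration.integral_cong) (auto simp: Ubd_eq space_mu)

lemma PW_eq:
  assumes \<xi>: "\<xi> \<in> R" and f [measurable]: "f \<in> borel_measurable \<mu>"
  shows "PW T w \<mu> R t f \<xi> = Kop (bt t) f \<xi>"
proof -
  have [measurable]: "cker (bt t) \<xi> \<in> borel_measurable \<mu>" using R_boundary[OF \<xi>] by measurable
  have "PW T w \<mu> R t f \<xi> = (\<integral>\<eta>. indicator R \<eta> * (enn2real (cker (bt t) \<xi> \<eta>) * f \<eta>) \<partial>\<mu>)"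
    unfolding PW_def set_lebesgue_integral_def using \<xi>
    by (auto simp: indicator_def pker_eq[OF \<xi>] R_boundary intro!: Bochner_Integration.integral_cong)
  also have "\<dots> = Kop (bt t) f \<xi>"
    unfolding Kop_def
  proof (rule integral_cong_AE)
    show "AE \<eta> in \<mu>. indicator R \<eta> * (enn2real (cker (bt t) \<xi> \<eta>) * f \<eta>) = enn2real (cker (bt t) \<xi> \<eta>) * f \<eta>"
      using AE_R by eventually_elim simp
  qed measurable
  finally show ?thesis .
qed

lemma nn_integral_R: "(\<integral>\<^sup>+\<eta>\<in>R. F \<eta> \<partial>\<mu>) = (\<integral>\<^sup>+\<eta>. F' \<eta> \<partial>\<mu>)"
  if "\<And>\<eta>. \<eta> \<in> R \<Longrightarrow> F \<eta> = F' \<eta>"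
proof (rule nn_integral_cong_AE)
  show "AE \<eta> in \<mu>. F \<eta> * indicator R \<eta> = F' \<eta>"
    using AE_R by eventually_elim (simp add: that)
qed

lemma mass_pker:
  assumes "\<xi> \<in> R" "0 < t"
  shows "(\<integral>\<^sup>+\<eta>\<in>R. pker T w \<mu> t \<xi> \<eta> \<partial>\<mu>) = ennreal (exp (- t / gpre (root T)))"
  using mass_cker[OF symbol_bt[OF assms(2)] assms(1)]
  by (subst nn_integral_R[where F' = "cker (bt t) \<xi>"]) (auto simp: pker_eq assms R_boundary)

lemma nn_integral_cyl_inter:
  assumes "\<xi> \<in> boundary T" "\<zeta> \<in> boundary T" "n \<le> k"
  shows "(\<integral>\<^sup>+\<eta>. of_bool (\<xi> n = \<eta> n) * of_bool (\<zeta> k = \<eta> k) \<partial>\<mu>) = of_bool (\<xi> n = \<zeta> n) * ennreal (m (\<zeta> k))"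
proof -
  have "of_bool (\<xi> n = \<eta> n) * of_bool (\<zeta> k = \<eta> k) = (of_bool (\<xi> n = \<zeta> n) * of_bool (\<zeta> k = \<eta> k) :: ennreal)"
    if "\<eta> \<in> boundary T" for \<eta>
    using boundary_eq_below[OF assms(2) that _ assms(3)] by auto
  then have "(\<integral>\<^sup>+\<eta>. of_bool (\<xi> n = \<eta> n) * of_bool (\<zeta> k = \<eta> k) \<partial>\<mu>)
      = (\<integral>\<^sup>+\<eta>. of_bool (\<xi> n = \<zeta> n) * of_bool (\<zeta> k = \<eta> k) \<partial>\<mu>)"
    by (intro nn_integral_cong) (simp add: space_mu)
  then show ?thesis by (simp only: nn_integral_cyl_coord[OF assms(2)])
qed

text \<open>The pairs of levels are grouped by their minimum \<open>l\<close>: the two groups at \<open>l\<close> sum to the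
  coefficient of the composed kernel.\<close>

lemma chapman_kolmogorov:
  assumes s: "0 < s" and t: "0 < t" and \<xi>: "\<xi> \<in> R" and \<zeta>: "\<zeta> \<in> R"
  shows "cker (bt (s + t)) \<xi> \<zeta> = (\<integral>\<^sup>+\<eta>. cker (bt s) \<xi> \<eta> * cker (bt t) \<eta> \<zeta> \<partial>\<mu>)"
proof -
  have \<xi>b: "\<xi> \<in> boundary T" and \<zeta>b: "\<zeta> \<in> boundary T" using \<xi> \<zeta> by (auto intro: R_boundary)
  have nn: "0 \<le> bt u (\<omega> n)" if "0 < u" "\<omega> \<in> boundary T" for u \<omega> n
    using symbol_nonneg[OF symbol_bt[OF that(1)] boundary_site[OF that(2)]] .
  let ?a = "\<lambda>n. ennreal (bt s (\<xi> n))" and ?b = "\<lambda>k. ennreal (bt t (\<zeta> k))"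
  let ?F = "\<lambda>n k. ?a n * (?b k * (\<integral>\<^sup>+\<eta>. of_bool (\<xi> n = \<eta> n) * of_bool (\<zeta> k = \<eta> k) \<partial>\<mu>))"
  have mt: "(\<lambda>\<eta>. of_bool (\<omega> n = \<eta> n) :: ennreal) \<in> borel_measurable \<mu>" for \<omega> n
    by (rule measurable_coord_eq)
  have "(\<integral>\<^sup>+\<eta>. cker (bt s) \<xi> \<eta> * cker (bt t) \<eta> \<zeta> \<partial>\<mu>) = (\<integral>\<^sup>+\<eta>. (\<Sum>n. \<Sum>k. ?a n * (?b k * (of_bool (\<xi> n = \<eta> n) * of_bool (\<zeta> k = \<eta> k)))) \<partial>\<mu>)"
    unfolding cker_sym[of "bt t" _ \<zeta>] unfolding cker_def
    by (intro nn_integral_cong) (simp add: suminf_product mult_ac)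
  also have "\<dots> = (\<Sum>n. \<Sum>k. ?F n k)"
    using mt by (simp add: nn_integral_suminf nn_integral_cmult)
  also have "\<dots> = (\<Sum>l. (\<Sum>k. ?F l (l + k)) + (\<Sum>n. ?F (Suc (l + n)) l))"
    by (rule suminf_double_split)
  also have "\<dots> = (\<Sum>l. ennreal (bt (s + t) (\<xi> l)) * of_bool (\<xi> l = \<zeta> l))"
  proof (rule suminf_cong)
    fix l
    have F1: "?F l (l + k) = ?a l * of_bool (\<xi> l = \<zeta> l) * ennreal (bt t (\<zeta> (l + k)) * m (\<zeta> (l + k)))" for k
      using nn[OF t \<zeta>b, of "l + k"]
      by (subst nn_integral_cyl_inter[OF \<xi>b \<zeta>b]) (auto simp: ennreal_mult mult_ac)
    have "(\<Sum>k. ?F l (l + k)) = ?a l * of_bool (\<xi> l = \<zeta> l) * (\<Sum>k. ennreal (bt t (\<zeta> (l + k)) * m (\<zeta> (l + k))))"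
      unfolding F1 by (rule ennreal_suminf_cmult)
    also have "(\<Sum>k. ennreal (bt t (\<zeta> (l + k)) * m (\<zeta> (l + k)))) = ennreal (exp (- t / gpre (\<zeta> l)))"
      using nn[OF t \<zeta>b] by (intro suminf_ennreal_eq symbol_sums[OF symbol_bt[OF t] \<zeta>]) simp
    finally have S1: "(\<Sum>k. ?F l (l + k)) = ?a l * of_bool (\<xi> l = \<zeta> l) * ennreal (exp (- t / gpre (\<zeta> l)))" .
    \<comment> \<open>Here the tail starts at \<open>Suc l\<close>, because the pair
      \<open>(l, l)\<close> belongs to the first group; its sum therefore involves
      \<open>gpre (\<xi> (Suc l))\<close>, which is \<open>gam (\<xi> l)\<close>.\<close>
    have F2: "?F (Suc (l + n)) l = ?b l * of_bool (\<xi> l = \<zeta> l) * ennreal (bt s (\<xi> (Suc l + n)) * m (\<xi> (Suc l + n)))" for n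
    proof -
      have "(\<integral>\<^sup>+\<eta>. of_bool (\<xi> (Suc (l + n)) = \<eta> (Suc (l + n))) * of_bool (\<zeta> l = \<eta> l) \<partial>\<mu>)
          = of_bool (\<zeta> l = \<xi> l) * ennreal (m (\<xi> (Suc (l + n))))"
        using nn_integral_cyl_inter[OF \<zeta>b \<xi>b, of l "Suc (l + n)"] by (simp add: mult.commute)
      then show ?thesis
        using nn[OF s \<xi>b, of "Suc (l + n)"] by (auto simp: ennreal_mult mult_ac)
    qed
    have "(\<Sum>n. ?F (Suc (l + n)) l) = ?b l * of_bool (\<xi> l = \<zeta> l) * (\<Sum>n. ennreal (bt s (\<xi> (Suc l + n)) * m (\<xi> (Suc l + n))))"
      unfolding F2 by (rule ennreal_suminf_cmult)
    also have "(\<Sum>n. ennreal (bt s (\<xi> (Suc l + n)) * m (\<xi> (Suc l + n)))) = ennreal (exp (- s / gpre (\<xi> (Suc l))))"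
      using nn[OF s \<xi>b] by (intro suminf_ennreal_eq symbol_sums[OF symbol_bt[OF s] \<xi>]) simp
    finally have S2: "(\<Sum>n. ?F (Suc (l + n)) l) = ?b l * of_bool (\<xi> l = \<zeta> l) * ennreal (exp (- s / gam (\<xi> l)))"
      by (simp add: gpre_Suc[OF \<xi>b])
    show "(\<Sum>k. ?F l (l + k)) + (\<Sum>n. ?F (Suc (l + n)) l) = ennreal (bt (s + t) (\<xi> l)) * of_bool (\<xi> l = \<zeta> l)"
    proof (cases "\<xi> l = \<zeta> l")
      case True
      have "- (s + t) / g = - s / g + - t / g" for g
        by (simp add: diff_divide_distrib)
      then have e: "exp (- (s + t) / g) = exp (- s / g) * exp (- t / g)" for g
        by (simp only: exp_add)
      \<comment> \<open>With \<open>A\<close> for the exponentials of \<open>gpre\<close> and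
        \<open>B\<close> for those of \<open>gam\<close>, this is
        \<open>(A_s - B_s) A_t + (A_t - B_t) B_s = A_s A_t - B_s B_t\<close>, divided by
        \<open>m (\<xi> l)\<close>.\<close>
      have "bt s (\<xi> l) * exp (- t / gpre (\<xi> l)) + bt t (\<xi> l) * exp (- s / gam (\<xi> l)) = bt (s + t) (\<xi> l)"
        unfolding bt_def e by (simp add: add_divide_distrib[symmetric] algebra_simps)
      then show ?thesis
        unfolding S1 S2 using True nn[OF s \<xi>b, of l] nn[OF t \<xi>b, of l]
        by (simp add: ennreal_mult[symmetric] ennreal_plus[symmetric] del: ennreal_plus)
    next
      case False
      then show ?thesis unfolding S1 S2 by simp
    qed
  qed
  finally show ?thesis by (simp add: cker_def)
qed

lemma sub_markov: "sub_markov_transition_kernel \<mu> R (pker T w \<mu>)"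
  unfolding sub_markov_transition_kernel_def
proof (intro conjI allI impI ballI)
  fix t :: real assume t: "0 < t"
  have "(\<lambda>x. (fst x, snd x)) \<in> measurable (restrict_space \<mu> R \<Otimes>\<^sub>M restrict_space \<mu> R) (\<mu> \<Otimes>\<^sub>M \<mu>)"
    by (intro measurable_Pair measurable_compose[OF measurable_fst measurable_restrict_space1[OF measurable_ident_sets[OF refl]]]
        measurable_compose[OF measurable_snd measurable_restrict_space1[OF measurable_ident_sets[OF refl]]])
  from measurable_compose[OF this cker_measurable2, of "bt t"]
  have "(\<lambda>(x, y). cker (bt t) x y) \<in> borel_measurable (restrict_space \<mu> R \<Otimes>\<^sub>M restrict_space \<mu> R)"
    by simp
  also have "?this \<longleftrightarrow> (\<lambda>(x, y). pker T w \<mu> t x y) \<in> borel_measurable (restrict_space \<mu> R \<Otimes>\<^sub>M restrict_space \<mu> R)"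
    by (rule measurable_cong) (auto simp: space_pair_measure space_restrict_space pker_eq R_boundary)
  finally show "(\<lambda>(x, y). pker T w \<mu> t x y) \<in> borel_measurable (restrict_space \<mu> R \<Otimes>\<^sub>M restrict_space \<mu> R)" .
next
  fix t :: real and x assume "0 < t" "x \<in> R"
  then show "(\<integral>\<^sup>+y\<in>R. pker T w \<mu> t x y \<partial>\<mu>) \<le> 1"
    using gpre_pos[of "root T"] by (subst mass_pker) (auto simp: ennreal_le_1)
next
  fix s t :: real and x z assume st: "0 < s" "0 < t" and xz: "x \<in> R" "z \<in> R"
  show "pker T w \<mu> (s + t) x z = (\<integral>\<^sup>+y\<in>R. pker T w \<mu> s x y * pker T w \<mu> t y z \<partial>\<mu>)"
    using chapman_kolmogorov[OF st xz]
    by (subst nn_integral_R[where F' = "\<lambda>y. cker (bt s) x y * cker (bt t) y z"]) (auto simp: pker_eq xz R_boundary)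
qed

end

section \<open>Integration over time: the Green kernel and the potential\<close>

context potential_tree
begin

lemma exp_neg_div_at_top: "0 < g \<Longrightarrow> ((\<lambda>t :: real. exp (- t / g)) \<longlongrightarrow> 0) at_top"
proof -
  assume g: "0 < g"
  have "filterlim (\<lambda>t. (- 1 / g) * t) at_bot at_top"
    using g by (intro filterlim_tendsto_neg_mult_at_bot[OF tendsto_const] filterlim_ident) simp
  from filterlim_compose[OF exp_at_bot this] show ?thesis by simp
qed

lemma bt_measurable [measurable]: "(\<lambda>t. bt t i) \<in> borel_measurable borel"
  unfolding bt_def by measurable

lemma integral_bt:
  assumes i: "i \<in> sites T" "0 < m i"
  shows "(\<integral>\<^sup>+t\<in>{0<..}. ennreal (bt t i) \<partial>lborel) = ennreal (bU i)"
proof -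
  \<comment> \<open>An antiderivative of \<open>bt t i\<close> that vanishes at infinity; its value
    at 0 is \<open>(gam i - gpre i) / m i\<close>, that is \<open>- bU i\<close> by
    \<open>gpre_diff\<close>.\<close>
  let ?F = "\<lambda>t. (gam i * exp (- t / gam i) - gpre i * exp (- t / gpre i)) / m i"
  have p: "0 < gam i" "0 < gpre i" using gam_pos gpre_pos i by auto
  have "(\<integral>\<^sup>+t\<in>{0<..}. ennreal (bt t i) \<partial>lborel) = (\<integral>\<^sup>+t. ennreal (bt t i) * indicator {0..} t \<partial>lborel)"
  proof (rule nn_integral_cong_AE)
    show "AE t in lborel. ennreal (bt t i) * indicator {0<..} t = ennreal (bt t i) * indicator {0..} t"
      using AE_lborel_singleton[of 0] by eventually_elim (auto simp: indicator_def)
  qed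
  also have "\<dots> = ennreal (0 - ?F 0)"
  proof (rule nn_integral_FTC_atLeast)
    fix t :: real assume t: "0 \<le> t"
    show "DERIV ?F t :> bt t i"
      using p i(2) unfolding bt_def by (auto intro!: derivative_eq_intros simp: field_simps)
    show "0 \<le> bt t i"
      using exp_gam_le[OF i(1), of t] t i(2) by (cases "t = 0") (auto simp: bt_def)
  next
    have "(?F \<longlongrightarrow> (gam i * 0 - gpre i * 0) / m i) at_top"
      by (intro tendsto_intros exp_neg_div_at_top p) (use i in simp)
    then show "(?F \<longlongrightarrow> 0) at_top" by simp
  qed simp
  also have "0 - ?F 0 = bU i"
    using gpre_diff[OF i(1)] i(2) by (simp add: bU_def field_simps)
  finally show ?thesis .
qed

text \<open>The terms are nonnegative and may be integrated one by one; \<open>integral_bt\<close>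
  turns each coefficient into \<open>bU\<close>. The value \<infinity> on the diagonal is
  included.\<close>

lemma green:
  assumes \<xi>: "\<xi> \<in> R"
  shows "(\<integral>\<^sup>+t\<in>{0<..}. cker (bt t) \<xi> \<eta> \<partial>lborel) = cker bU \<xi> \<eta>"
proof -
  have b: "\<xi> \<in> boundary T" using \<xi> by (rule R_boundary)
  have "(\<integral>\<^sup>+t\<in>{0<..}. cker (bt t) \<xi> \<eta> \<partial>lborel)
      = (\<integral>\<^sup>+t. (\<Sum>n. of_bool (\<xi> n = \<eta> n) * (ennreal (bt t (\<xi> n)) * indicator {0<..} t)) \<partial>lborel)"
    unfolding cker_def by (intro nn_integral_cong) (simp add: ennreal_suminf_multc[symmetric] mult_ac)
  also have "\<dots> = (\<Sum>n. of_bool (\<xi> n = \<eta> n) * (\<integral>\<^sup>+t\<in>{0<..}. ennreal (bt t (\<xi> n)) \<partial>lborel))"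
    by (simp add: nn_integral_suminf nn_integral_cmult)
  also have "\<dots> = cker bU \<xi> \<eta>"
    unfolding cker_def
    by (intro suminf_cong) (subst integral_bt[OF boundary_site[OF b] m_pos[OF \<xi>]], rule mult.commute)
  finally show ?thesis .
qed

lemma cker_bt_measurable2 [measurable]:
  assumes \<xi>: "\<xi> \<in> boundary T"
  shows "(\<lambda>(t, \<eta>). cker (bt t) \<xi> \<eta>) \<in> borel_measurable (lborel \<Otimes>\<^sub>M \<mu>)"
proof -
  have "(\<lambda>x. ennreal (bt (fst x) (\<xi> n)) * of_bool (\<xi> n = snd x n)) \<in> borel_measurable (lborel \<Otimes>\<^sub>M \<mu>)" for n
  proof -
    have [measurable]: "(\<lambda>x. of_bool (\<xi> n = snd x n) :: ennreal) \<in> borel_measurable (lborel \<Otimes>\<^sub>M \<mu>)"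
      by (rule measurable_compose[OF measurable_snd measurable_coord_eq])
    show ?thesis by measurable
  qed
  then show ?thesis
    unfolding cker_def case_prod_beta by (rule borel_measurable_suminf_order)
qed

text \<open>Fubini for time and boundary; by \<open>green\<close> the absolute integrability that it
  requires follows from \<open>fin\<close>.\<close>

lemma potential_pointwise:
  assumes \<xi>: "\<xi> \<in> R" and f [measurable]: "f \<in> borel_measurable \<mu>"
    and fin: "(\<integral>\<^sup>+\<eta>. cker bU \<xi> \<eta> * ennreal \<bar>f \<eta>\<bar> \<partial>\<mu>) < \<infinity>"
  shows "set_integrable lborel {0<..} (\<lambda>t. Kop (bt t) f \<xi>)"
    and "(LINT t:{0<..}|lborel. Kop (bt t) f \<xi>) = Kop bU f \<xi>"
proof -
  have b: "\<xi> \<in> boundary T" using \<xi> by (rule R_boundary)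
  note [measurable] = cker_bt_measurable2[OF b]
  interpret pair_sigma_finite lborel \<mu> ..
  define H where "H = (\<lambda>(t :: real, \<eta>). indicator {0<..} t * (enn2real (cker (bt t) \<xi> \<eta>) * f \<eta>))"
  have Hm [measurable]: "H \<in> borel_measurable (lborel \<Otimes>\<^sub>M \<mu>)"
  proof -
    have [measurable]: "(\<lambda>x. cker (bt (fst x)) \<xi> (snd x)) \<in> borel_measurable (lborel \<Otimes>\<^sub>M \<mu>)"
      using cker_bt_measurable2[OF b] by (simp add: case_prod_beta')
    show ?thesis unfolding H_def case_prod_beta by measurable
  qed
  have sec: "(\<lambda>t. cker (bt t) \<xi> \<eta>) \<in> borel_measurable lborel" if "\<eta> \<in> boundary T" for \<eta>
    using measurable_compose[OF measurable_Pair2'[of \<eta> \<mu> lborel] cker_bt_measurable2[OF b]] that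
    by (simp add: space_mu)
  have Hi: "integrable (lborel \<Otimes>\<^sub>M \<mu>) H"
  proof (rule integrableI_bounded[OF Hm])
    have "(\<integral>\<^sup>+z. ennreal (norm (H z)) \<partial>(lborel \<Otimes>\<^sub>M \<mu>)) = (\<integral>\<^sup>+\<eta>. (\<integral>\<^sup>+t. ennreal (norm (H (t, \<eta>))) \<partial>lborel) \<partial>\<mu>)"
      by (rule nn_integral_snd[symmetric]) measurable
    also have "\<dots> \<le> (\<integral>\<^sup>+\<eta>. cker bU \<xi> \<eta> * ennreal \<bar>f \<eta>\<bar> \<partial>\<mu>)"
    proof (rule nn_integral_mono)
      fix \<eta> assume "\<eta> \<in> space \<mu>"
      then have [measurable]: "(\<lambda>t. cker (bt t) \<xi> \<eta>) \<in> borel_measurable lborel"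
        using sec by (simp add: space_mu)
      have e: "ennreal (enn2real c) \<le> c" for c :: ennreal by (cases c) auto
      have "ennreal (norm (H (t, \<eta>))) \<le> cker (bt t) \<xi> \<eta> * indicator {0<..} t * ennreal \<bar>f \<eta>\<bar>" for t
        using e[of "cker (bt t) \<xi> \<eta>"]
        by (auto simp: H_def abs_mult ennreal_mult indicator_def intro!: mult_right_mono)
      then have "(\<integral>\<^sup>+t. ennreal (norm (H (t, \<eta>))) \<partial>lborel) \<le> (\<integral>\<^sup>+t. cker (bt t) \<xi> \<eta> * indicator {0<..} t * ennreal \<bar>f \<eta>\<bar> \<partial>lborel)"
        by (intro nn_integral_mono)
      also have "\<dots> = cker bU \<xi> \<eta> * ennreal \<bar>f \<eta>\<bar>"
        by (subst nn_integral_multc) (auto simp: green[OF \<xi>])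
      finally show "(\<integral>\<^sup>+t. ennreal (norm (H (t, \<eta>))) \<partial>lborel) \<le> cker bU \<xi> \<eta> * ennreal \<bar>f \<eta>\<bar>" .
    qed
    finally show "(\<integral>\<^sup>+z. ennreal (norm (H z)) \<partial>(lborel \<Otimes>\<^sub>M \<mu>)) < \<infinity>"
      using fin by (rule le_less_trans)
  qed
  have inner: "(\<integral>\<eta>. H (t, \<eta>) \<partial>\<mu>) = indicator {0<..} t * Kop (bt t) f \<xi>" for t
    by (simp add: H_def Kop_def)
  show "set_integrable lborel {0<..} (\<lambda>t. Kop (bt t) f \<xi>)"
    using integrable_fst'[OF Hi] by (simp add: set_integrable_def inner)
  have "(LINT t:{0<..}|lborel. Kop (bt t) f \<xi>) = (\<integral>t. (\<integral>\<eta>. H (t, \<eta>) \<partial>\<mu>) \<partial>lborel)"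
    by (simp add: set_lebesgue_integral_def inner)
  also have "\<dots> = (\<integral>\<eta>. (\<integral>t. H (t, \<eta>) \<partial>lborel) \<partial>\<mu>)"
    using Fubini_integral[of "\<lambda>t \<eta>. H (t, \<eta>)"] Hi by simp
  also have "\<dots> = Kop bU f \<xi>"
    unfolding Kop_def
  proof (rule integral_cong_AE)
    have [measurable]: "cker bU \<xi> \<in> borel_measurable \<mu>" using b by measurable
    show "(\<lambda>\<eta>. enn2real (cker bU \<xi> \<eta>) * f \<eta>) \<in> borel_measurable \<mu>" by measurable
    show "(\<lambda>\<eta>. \<integral>t. H (t, \<eta>) \<partial>lborel) \<in> borel_measurable \<mu>"
      using integrable_snd[of "\<lambda>t \<eta>. H (t, \<eta>)"] Hi by (simp add: borel_measurable_integrable)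
    show "AE \<eta> in \<mu>. (\<integral>t. H (t, \<eta>) \<partial>lborel) = enn2real (cker bU \<xi> \<eta>) * f \<eta>"
      using AE_cker_finite[OF symbol_U \<xi>] AE_space
    proof eventually_elim
      case (elim \<eta>)
      then have [measurable]: "(\<lambda>t. cker (bt t) \<xi> \<eta>) \<in> borel_measurable lborel"
        using sec by (simp add: space_mu)
      let ?g = "\<lambda>t. cker (bt t) \<xi> \<eta> * indicator {0<..} t"
      \<comment> \<open>A finite integral over time makes the kernel finite for almost every
        \<open>t\<close>, so \<open>enn2real\<close> commutes with the integration.\<close>
      have "AE t in lborel. ?g t \<noteq> \<infinity>"
        using elim(1) green[OF \<xi>, of \<eta>] by (intro nn_integral_PInf_AE) auto
      then have "AE t in lborel. ennreal (indicator {0<..} t * enn2real (cker (bt t) \<xi> \<eta>)) = ?g t"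
        by eventually_elim (auto simp: indicator_def ennreal_enn2real less_top[symmetric])
      then have "(\<integral>\<^sup>+t. ennreal (indicator {0<..} t * enn2real (cker (bt t) \<xi> \<eta>)) \<partial>lborel) = cker bU \<xi> \<eta>"
        using green[OF \<xi>, of \<eta>] by (simp cong: nn_integral_cong_AE)
      then have "(\<integral>t. indicator {0<..} t * enn2real (cker (bt t) \<xi> \<eta>) \<partial>lborel) = enn2real (cker bU \<xi> \<eta>)"
        by (subst integral_eq_nn_integral) auto
      moreover have "(\<integral>t. H (t, \<eta>) \<partial>lborel) = (\<integral>t. (indicator {0<..} t * enn2real (cker (bt t) \<xi> \<eta>)) * f \<eta> \<partial>lborel)"
        by (simp add: H_def mult.assoc)
      ultimately show ?case by simp
    qed
  qed
  finally show "(LINT t:{0<..}|lborel. Kop (bt t) f \<xi>) = Kop bU f \<xi>" .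
qed

lemma potential:
  assumes f: "L2 \<mu> f"
  shows "AE \<xi> in \<mu>. set_integrable lborel {0<..} (\<lambda>t. PW T w \<mu> R t f \<xi>)
    \<and> (LINT t:{0<..}|lborel. PW T w \<mu> R t f \<xi>) = Wop w \<mu> f \<xi>"
  using AE_Kop_abs_finite[OF symbol_U f] AE_R
proof eventually_elim
  case (elim \<xi>)
  have fm: "f \<in> borel_measurable \<mu>" using f by (rule L2_measurable)
  show ?case
    using potential_pointwise[OF elim(2) fm elim(1)]
    by (simp add: PW_eq[OF elim(2) fm] Wop_eq R_boundary[OF elim(2)])
qed

end

section \<open>Continuous functions on the boundary\<close>

context rooted_tree
begin

text \<open>Uniform continuity for the ultrametric of rays. It is stated on a subset because the set
  of regular points may fail to be closed, so that continuity on it would not ensure an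
  extension.\<close>

definition coord_uniform :: "(nat \<Rightarrow> 'v) set \<Rightarrow> ((nat \<Rightarrow> 'v) \<Rightarrow> real) \<Rightarrow> bool" where
  "coord_uniform A f \<longleftrightarrow> (\<forall>e>0. \<exists>N. \<forall>\<xi>\<in>A. \<forall>\<eta>\<in>A. \<xi> N = \<eta> N \<longrightarrow> \<bar>f \<xi> - f \<eta>\<bar> < e)"

lemma topspace_boundary_top: "topspace (boundary_top T) = boundary T"
proof -
  have "\<Union>(cyl T ` sites T) = boundary T"
    using cyl_subset cyl_root root_site by blast
  then show ?thesis by (simp add: boundary_top_def)
qed

text \<open>The cylinders along a ray are nested, so finite intersections of generators reduce to
  the deepest one.\<close>

lemma openin_boundary_top_cyl:
  assumes "openin (boundary_top T) U" "\<zeta> \<in> U" "\<zeta> \<in> boundary T"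
  shows "\<exists>n. cyl T (\<zeta> n) \<subseteq> U"
proof -
  have "generate_topology_on (cyl T ` sites T) U"
    using assms(1) by (simp add: boundary_top_def openin_topology_generated_by_iff)
  then show ?thesis using assms(2)
  proof (induction)
    case (Int a b)
    then obtain n k where "cyl T (\<zeta> n) \<subseteq> a" "cyl T (\<zeta> k) \<subseteq> b" by blast
    moreover have "cyl T (\<zeta> (max n k)) \<subseteq> cyl T (\<zeta> l)" if "l \<le> max n k" for l
    proof
      fix \<xi> assume "\<xi> \<in> cyl T (\<zeta> (max n k))"
      then have x: "\<xi> \<in> boundary T" "\<xi> (max n k) = \<zeta> (max n k)" by (auto simp: mem_cyl_boundary[OF assms(3)])
      then show "\<xi> \<in> cyl T (\<zeta> l)"
        using boundary_eq_below[OF x(1) assms(3) x(2) that] by (simp add: mem_cyl_boundary[OF assms(3)])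
    qed
    from this[of n] this[of k] have "cyl T (\<zeta> (max n k)) \<subseteq> cyl T (\<zeta> n)" "cyl T (\<zeta> (max n k)) \<subseteq> cyl T (\<zeta> k)" by auto
    ultimately show ?case by blast
  next
    case (UN K)
    then show ?case by blast
  next
    case (Basis s)
    then obtain i where i: "i \<in> sites T" "s = cyl T i" by blast
    then have "\<zeta> (level T i) = i" using Basis by (simp add: cyl_iff)
    then show ?case using i by (metis order_refl)
  qed simp
qed

lemma openin_cyl: "i \<in> sites T \<Longrightarrow> openin (boundary_top T) (cyl T i)"
  by (simp add: boundary_top_def openin_topology_generated_by_iff generate_topology_on.Basis)

text \<open>Uniform continuity from Koenig's lemma: a violation would propagate along a ray, and
  continuity at that ray excludes it.\<close>

lemma continuous_imp_coord_uniform: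
  assumes g: "continuous_map (boundary_top T) euclideanreal g"
  shows "coord_uniform (boundary T) g"
  unfolding coord_uniform_def
proof (intro allI impI)
  fix e :: real assume e: "0 < e"
  define good where "good i \<longleftrightarrow> (\<exists>N. \<forall>\<xi>\<in>cyl T i. \<forall>\<eta>\<in>cyl T i. \<xi> N = \<eta> N \<longrightarrow> \<bar>g \<xi> - g \<eta>\<bar> < e)" for i
  have step: "good i" if i: "i \<in> sites T" and ch: "\<And>j. j \<in> succs T i \<Longrightarrow> good j" for i
  proof -
    have "\<forall>j\<in>succs T i. \<exists>N. \<forall>\<xi>\<in>cyl T j. \<forall>\<eta>\<in>cyl T j. \<xi> N = \<eta> N \<longrightarrow> \<bar>g \<xi> - g \<eta>\<bar> < e"
      using ch by (simp add: good_def)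
    from bchoice[OF this] obtain N where
      N: "\<forall>j\<in>succs T i. \<forall>\<xi>\<in>cyl T j. \<forall>\<eta>\<in>cyl T j. \<xi> (N j) = \<eta> (N j) \<longrightarrow> \<bar>g \<xi> - g \<eta>\<bar> < e" by blast
    define K where "K = Suc (level T i) + (\<Sum>j\<in>succs T i. N j)"
    have "\<bar>g \<xi> - g \<eta>\<bar> < e" if x: "\<xi> \<in> cyl T i" "\<eta> \<in> cyl T i" "\<xi> K = \<eta> K" for \<xi> \<eta>
    proof -
      have b: "\<xi> \<in> boundary T" "\<eta> \<in> boundary T" using x cyl_subset by auto
      define j where "j = \<xi> (Suc (level T i))"
      have "\<xi> (level T i) = i" using x by (simp add: cyl_iff)
      then have j: "j \<in> succs T i" using boundary_succ[OF b(1), of "level T i"] by (simp add: j_def)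
      have "\<xi> (Suc (level T i)) = \<eta> (Suc (level T i))"
        by (rule boundary_eq_below[OF b x(3)]) (simp add: K_def)
      then have "\<xi> \<in> cyl T j" "\<eta> \<in> cyl T j"
        using b level_succs[OF j] by (auto simp: cyl_iff j_def)
      moreover have "N j \<le> K"
        using member_le_sum[OF j, of N] finite_succs by (simp add: K_def)
      then have "\<xi> (N j) = \<eta> (N j)" by (rule boundary_eq_below[OF b x(3)])
      ultimately show ?thesis using N j by blast
    qed
    then show ?thesis unfolding good_def by blast
  qed
  have "good (root T)"
  proof (rule ccontr)
    assume bad: "\<not> good (root T)"
    have nxt: "\<exists>j. j \<in> succs T i \<and> \<not> good j" if "i \<in> sites T" "\<not> good i" for i
      using step[OF that(1)] that(2) by blast
    define \<zeta> where "\<zeta> n = rec_nat (root T) (\<lambda>_ i. SOME j. j \<in> succs T i \<and> \<not> good j) n" for n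
    have z: "\<zeta> n \<in> sites T \<and> \<not> good (\<zeta> n) \<and> \<zeta> (Suc n) \<in> succs T (\<zeta> n)" for n
    proof (induction n)
      case 0
      then show ?case using bad someI_ex[OF nxt[OF root_site bad]] by (simp add: \<zeta>_def)
    next
      case (Suc n)
      have s: "\<zeta> (Suc n) \<in> sites T" using Suc succs_site by blast
      have "\<zeta> (Suc n) \<in> succs T (\<zeta> n) \<and> \<not> good (\<zeta> (Suc n))"
        using someI_ex[OF nxt[of "\<zeta> n"]] Suc by (simp add: \<zeta>_def)
      then show ?case using someI_ex[OF nxt[OF s]] s by (simp add: \<zeta>_def)
    qed
    then have zb: "\<zeta> \<in> boundary T" by (simp add: boundary_def \<zeta>_def)
    have "openin (boundary_top T) {\<xi> \<in> topspace (boundary_top T). g \<xi> \<in> ball (g \<zeta>) (e / 2)}"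
      using g by (rule openin_continuous_map_preimage) simp
    moreover have "\<zeta> \<in> {\<xi> \<in> topspace (boundary_top T). g \<xi> \<in> ball (g \<zeta>) (e / 2)}"
      using e zb by (simp add: topspace_boundary_top)
    ultimately have "\<exists>n. cyl T (\<zeta> n) \<subseteq> {\<xi> \<in> topspace (boundary_top T). g \<xi> \<in> ball (g \<zeta>) (e / 2)}"
      using zb by (rule openin_boundary_top_cyl)
    then obtain n where n: "cyl T (\<zeta> n) \<subseteq> {\<xi> \<in> topspace (boundary_top T). g \<xi> \<in> ball (g \<zeta>) (e / 2)}" ..
    have "\<bar>g \<xi> - g \<eta>\<bar> < e" if "\<xi> \<in> cyl T (\<zeta> n)" "\<eta> \<in> cyl T (\<zeta> n)" for \<xi> \<eta>
    proof -
      have "dist (g \<zeta>) (g \<xi>) < e / 2" "dist (g \<zeta>) (g \<eta>) < e / 2" using n that by auto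
      then show ?thesis unfolding dist_real_def by linarith
    qed
    then have "good (\<zeta> n)" unfolding good_def by blast
    then show False using z by blast
  qed
  then show "\<exists>N. \<forall>\<xi>\<in>boundary T. \<forall>\<eta>\<in>boundary T. \<xi> N = \<eta> N \<longrightarrow> \<bar>g \<xi> - g \<eta>\<bar> < e"
    by (simp add: good_def)
qed

lemma coord_uniform_imp_continuous:
  assumes "coord_uniform (boundary T) g"
  shows "continuous_map (boundary_top T) euclideanreal g"
  unfolding continuous_map_def
proof (intro conjI allI impI)
  fix U :: "real set" assume U: "openin euclideanreal U"
  show "openin (boundary_top T) {\<xi> \<in> topspace (boundary_top T). g \<xi> \<in> U}"
  proof (subst openin_subopen, intro ballI)
    fix \<xi> assume x: "\<xi> \<in> {\<xi> \<in> topspace (boundary_top T). g \<xi> \<in> U}"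
    then have xb: "\<xi> \<in> boundary T" by (simp add: topspace_boundary_top)
    obtain e where e: "0 < e" "ball (g \<xi>) e \<subseteq> U" using U x open_contains_ball[of U] by auto
    obtain N where N: "\<forall>\<xi>\<in>boundary T. \<forall>\<eta>\<in>boundary T. \<xi> N = \<eta> N \<longrightarrow> \<bar>g \<xi> - g \<eta>\<bar> < e"
      using assms e(1) unfolding coord_uniform_def by blast
    have "cyl T (\<xi> N) \<subseteq> {\<xi> \<in> topspace (boundary_top T). g \<xi> \<in> U}"
    proof
      fix \<eta> assume "\<eta> \<in> cyl T (\<xi> N)"
      then have "\<eta> \<in> boundary T" "\<xi> N = \<eta> N" using xb by (auto simp: mem_cyl_boundary)
      then have "\<bar>g \<xi> - g \<eta>\<bar> < e" using N xb by blast
      then show "\<eta> \<in> {\<xi> \<in> topspace (boundary_top T). g \<xi> \<in> U}"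
        using e(2) \<open>\<eta> \<in> boundary T\<close> by (auto simp: topspace_boundary_top dist_real_def)
    qed
    moreover have "\<xi> \<in> cyl T (\<xi> N)" using xb by (simp add: mem_cyl_boundary)
    ultimately show "\<exists>V. openin (boundary_top T) V \<and> \<xi> \<in> V \<and> V \<subseteq> {\<xi> \<in> topspace (boundary_top T). g \<xi> \<in> U}"
      using openin_cyl[OF boundary_site[OF xb]] by blast
  qed
qed auto

text \<open>The extension follows a ray as long as its cylinders meet \<open>A\<close>: \<open>approach A \<xi> n\<close> is a point
  of \<open>A\<close> that shares with \<open>\<xi>\<close> as many of its first \<open>n\<close> coordinates as possible.\<close>

primrec approach :: "(nat \<Rightarrow> 'v) set \<Rightarrow> (nat \<Rightarrow> 'v) \<Rightarrow> nat \<Rightarrow> (nat \<Rightarrow> 'v)" where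
  "approach A \<xi> 0 = (SOME \<eta>. \<eta> \<in> A)"
| "approach A \<xi> (Suc n) = (if \<exists>\<eta>\<in>A. \<eta> (Suc n) = \<xi> (Suc n) then SOME \<eta>. \<eta> \<in> A \<and> \<eta> (Suc n) = \<xi> (Suc n)
     else approach A \<xi> n)"

lemma approach_mem: "A \<noteq> {} \<Longrightarrow> approach A \<xi> n \<in> A"
proof (induction n)
  case 0
  then show ?case by (simp add: some_in_eq)
next
  case (Suc n)
  show ?case
  proof (cases "\<exists>\<eta>\<in>A. \<eta> (Suc n) = \<xi> (Suc n)")
    case True
    then have "\<exists>\<eta>. \<eta> \<in> A \<and> \<eta> (Suc n) = \<xi> (Suc n)" by blast
    from someI_ex[OF this] show ?thesis using True by simp
  next
    case False
    then show ?thesis using Suc by simp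
  qed
qed

lemma approach_hit:
  assumes A: "A \<noteq> {}" "A \<subseteq> boundary T" and \<xi>: "\<xi> \<in> boundary T" and hit: "\<exists>\<eta>\<in>A. \<eta> n = \<xi> n" and "n \<le> k"
  shows "approach A \<xi> k n = \<xi> n"
  using assms(5)
proof (induction k rule: dec_induct)
  case base
  show ?case
  proof (cases n)
    case 0
    have "approach A \<xi> 0 \<in> boundary T" using approach_mem[OF A(1), of \<xi> 0] A(2) by blast
    then show ?thesis using 0 \<xi> by (simp add: boundary_0 del: approach.simps)
  next
    case (Suc n')
    then have "\<exists>\<eta>. \<eta> \<in> A \<and> \<eta> (Suc n') = \<xi> (Suc n')" using hit by blast
    from someI_ex[OF this] show ?thesis using Suc hit by simp
  qed
next
  case (step k)
  show ?case
  proof (cases "\<exists>\<eta>\<in>A. \<eta> (Suc k) = \<xi> (Suc k)")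
    case True
    then have "\<exists>\<eta>. \<eta> \<in> A \<and> \<eta> (Suc k) = \<xi> (Suc k)" by blast
    from someI_ex[OF this] have s: "approach A \<xi> (Suc k) (Suc k) = \<xi> (Suc k)" using True by simp
    have b: "approach A \<xi> (Suc k) \<in> boundary T" using approach_mem[OF A(1)] A(2) by blast
    have "n \<le> Suc k" using step(1) by simp
    then show ?thesis by (rule boundary_eq_below[OF b \<xi> s])
  next
    case False
    then show ?thesis using step by simp
  qed
qed

text \<open>Once a cylinder along \<xi> misses \<open>A\<close>, all deeper ones do, and the
  approximating point no longer changes.\<close>

lemma approach_miss:
  assumes A: "A \<subseteq> boundary T" and \<xi>: "\<xi> \<in> boundary T" and miss: "\<not> (\<exists>\<eta>\<in>A. \<eta> n = \<xi> n)" and "n \<le> k"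
  shows "approach A \<xi> k = approach A \<xi> n"
  using assms(4)
proof (induction k rule: dec_induct)
  case (step k)
  have "\<not> (\<exists>\<eta>\<in>A. \<eta> (Suc k) = \<xi> (Suc k))"
  proof
    assume "\<exists>\<eta>\<in>A. \<eta> (Suc k) = \<xi> (Suc k)"
    then obtain \<eta> where h: "\<eta> \<in> A" "\<eta> (Suc k) = \<xi> (Suc k)" by blast
    have "\<eta> n = \<xi> n"
    proof (rule boundary_eq_below[OF _ \<xi>, where n = "Suc k"])
      show "\<eta> \<in> boundary T" using A h by blast
      show "\<eta> (Suc k) = \<xi> (Suc k)" by (rule h)
      show "n \<le> Suc k" using step(1) by simp
    qed
    then show False using miss h by blast
  qed
  then show ?case using step by simp
qed simp

lemma approach_cong: "(\<And>k. k \<le> n \<Longrightarrow> \<xi> k = \<eta> k) \<Longrightarrow> approach A \<xi> n = approach A \<eta> n"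
  by (induction n) auto

text \<open>The values of \<open>f\<close> along \<open>approach A \<xi>\<close> are Cauchy with a
  modulus that does not depend on \<xi>, so their limit is again uniformly continuous. At rays
  outside the closure of \<open>A\<close> the sequence becomes constant.\<close>

lemma coord_uniform_extend:
  assumes u: "coord_uniform A f" and A: "A \<noteq> {}" "A \<subseteq> boundary T"
  shows "\<exists>g. coord_uniform (boundary T) g \<and> (\<forall>\<xi>\<in>A. g \<xi> = f \<xi>)"
proof -
  have close: "\<bar>f (approach A \<xi> k) - f (approach A \<xi> n)\<bar> < e"
    if N: "\<forall>\<xi>\<in>A. \<forall>\<eta>\<in>A. \<xi> N = \<eta> N \<longrightarrow> \<bar>f \<xi> - f \<eta>\<bar> < e" and "0 < e" "\<xi> \<in> boundary T" "N \<le> k" "N \<le> n" for e N \<xi> k n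
  proof (cases "\<exists>\<eta>\<in>A. \<eta> N = \<xi> N")
    case True
    then show ?thesis
      using N approach_mem[OF A(1)] approach_hit[OF A that(3) True] that(4,5) by simp
  next
    case False
    have "approach A \<xi> k = approach A \<xi> n"
      using approach_miss[OF A(2) that(3) False that(4)] approach_miss[OF A(2) that(3) False that(5)] by (rule trans[OF _ sym])
    then show ?thesis using that(2) by simp
  qed
  have uN: "\<exists>N. \<forall>\<xi>\<in>A. \<forall>\<eta>\<in>A. \<xi> N = \<eta> N \<longrightarrow> \<bar>f \<xi> - f \<eta>\<bar> < e" if "0 < e" for e
    using u that unfolding coord_uniform_def by blast
  define g where "g \<xi> = lim (\<lambda>k. f (approach A \<xi> k))" for \<xi>
  have conv: "(\<lambda>k. f (approach A \<xi> k)) \<longlonglongrightarrow> g \<xi>" if \<xi>: "\<xi> \<in> boundary T" for \<xi>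
  proof -
    have "Cauchy (\<lambda>k. f (approach A \<xi> k))"
    proof (rule CauchyI)
      fix e :: real assume e: "0 < e"
      obtain N where "\<forall>\<xi>\<in>A. \<forall>\<eta>\<in>A. \<xi> N = \<eta> N \<longrightarrow> \<bar>f \<xi> - f \<eta>\<bar> < e" using uN[OF e] by blast
      from close[OF this e \<xi>]
      show "\<exists>M. \<forall>m\<ge>M. \<forall>n\<ge>M. norm (f (approach A \<xi> m) - f (approach A \<xi> n)) < e" by auto
    qed
    then show ?thesis by (simp add: g_def Cauchy_convergent_iff convergent_LIMSEQ_iff)
  qed
  have near: "\<bar>g \<xi> - f (approach A \<xi> N)\<bar> \<le> e"
    if "\<forall>\<xi>\<in>A. \<forall>\<eta>\<in>A. \<xi> N = \<eta> N \<longrightarrow> \<bar>f \<xi> - f \<eta>\<bar> < e" "0 < e" "\<xi> \<in> boundary T" for e N \<xi>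
  proof (rule LIMSEQ_le_const2)
    show "(\<lambda>k. \<bar>f (approach A \<xi> k) - f (approach A \<xi> N)\<bar>) \<longlonglongrightarrow> \<bar>g \<xi> - f (approach A \<xi> N)\<bar>"
      by (intro tendsto_rabs tendsto_diff conv that tendsto_const)
    show "\<exists>M. \<forall>k\<ge>M. \<bar>f (approach A \<xi> k) - f (approach A \<xi> N)\<bar> \<le> e"
      using close[OF that] by (intro exI[of _ N]) (auto intro: less_imp_le)
  qed
  have "coord_uniform (boundary T) g"
    unfolding coord_uniform_def
  proof (intro allI impI)
    fix e :: real assume e: "0 < e"
    obtain N where N: "\<forall>\<xi>\<in>A. \<forall>\<eta>\<in>A. \<xi> N = \<eta> N \<longrightarrow> \<bar>f \<xi> - f \<eta>\<bar> < e / 3" using uN[of "e / 3"] e by auto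
    have "\<bar>g \<xi> - g \<eta>\<bar> < e" if x: "\<xi> \<in> boundary T" "\<eta> \<in> boundary T" "\<xi> N = \<eta> N" for \<xi> \<eta>
    proof -
      have "approach A \<xi> N = approach A \<eta> N"
        using boundary_eq_below[OF x] by (intro approach_cong)
      then show ?thesis
        using near[OF N _ x(1)] near[OF N _ x(2)] e by (simp add: abs_if split: if_splits)
    qed
    then show "\<exists>N. \<forall>\<xi>\<in>boundary T. \<forall>\<eta>\<in>boundary T. \<xi> N = \<eta> N \<longrightarrow> \<bar>g \<xi> - g \<eta>\<bar> < e" by blast
  qed
  moreover have "g \<xi> = f \<xi>" if \<xi>: "\<xi> \<in> A" for \<xi>
  proof -
    have b: "\<xi> \<in> boundary T" using \<xi> A by blast
    have le: "\<bar>g \<xi> - f \<xi>\<bar> \<le> e" if e: "0 < e" for e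
    proof -
      obtain N where N: "\<forall>\<xi>\<in>A. \<forall>\<eta>\<in>A. \<xi> N = \<eta> N \<longrightarrow> \<bar>f \<xi> - f \<eta>\<bar> < e / 2" using uN[of "e / 2"] e by auto
      have "approach A \<xi> N N = \<xi> N" using \<xi> by (intro approach_hit[OF A b]) auto
      then have "\<bar>f (approach A \<xi> N) - f \<xi>\<bar> < e / 2" using N \<xi> approach_mem[OF A(1)] by blast
      moreover have "\<bar>g \<xi> - f (approach A \<xi> N)\<bar> \<le> e / 2" using near[OF N _ b] e by simp
      ultimately show ?thesis by linarith
    qed
    have "\<bar>g \<xi> - f \<xi>\<bar> \<le> 0"
    proof (rule field_le_epsilon)
      fix e :: real assume "0 < e"
      from le[OF this] show "\<bar>g \<xi> - f \<xi>\<bar> \<le> 0 + e" by simp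
    qed
    then show ?thesis by simp
  qed
  ultimately show ?thesis by blast
qed

lemma continuous_restrictions_iff:
  assumes "A \<noteq> {}" "A \<subseteq> boundary T"
  shows "f \<in> continuous_restrictions T A \<longleftrightarrow> coord_uniform A f"
proof
  assume "f \<in> continuous_restrictions T A"
  then obtain g where g: "coord_uniform (boundary T) g" "\<forall>\<xi>\<in>A. f \<xi> = g \<xi>"
    using continuous_imp_coord_uniform by (auto simp: continuous_restrictions_def)
  show "coord_uniform A f"
    unfolding coord_uniform_def
  proof (intro allI impI)
    fix e :: real assume "0 < e"
    then obtain N where N: "\<forall>\<xi>\<in>boundary T. \<forall>\<eta>\<in>boundary T. \<xi> N = \<eta> N \<longrightarrow> \<bar>g \<xi> - g \<eta>\<bar> < e"
      using g(1) unfolding coord_uniform_def by blast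
    have "\<bar>f \<xi> - f \<eta>\<bar> < e" if "\<xi> \<in> A" "\<eta> \<in> A" "\<xi> N = \<eta> N" for \<xi> \<eta>
      using N g(2) assms(2) that by (metis subsetD)
    then show "\<exists>N. \<forall>\<xi>\<in>A. \<forall>\<eta>\<in>A. \<xi> N = \<eta> N \<longrightarrow> \<bar>f \<xi> - f \<eta>\<bar> < e" by blast
  qed
next
  assume "coord_uniform A f"
  from coord_uniform_extend[OF this assms] obtain g where
    "coord_uniform (boundary T) g" "\<forall>\<xi>\<in>A. g \<xi> = f \<xi>" by blast
  then show "f \<in> continuous_restrictions T A"
    using coord_uniform_imp_continuous unfolding continuous_restrictions_def by (auto intro!: exI[of _ g])
qed

lemma coord_uniform_level:
  assumes "coord_uniform (boundary T) g" "0 < e"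
  shows "\<exists>N \<psi>. \<forall>\<xi>\<in>boundary T. \<bar>g \<xi> - \<psi> (\<xi> N)\<bar> < e"
proof -
  obtain N where N: "\<forall>\<xi>\<in>boundary T. \<forall>\<eta>\<in>boundary T. \<xi> N = \<eta> N \<longrightarrow> \<bar>g \<xi> - g \<eta>\<bar> < e"
    using assms unfolding coord_uniform_def by blast
  define rep where "rep i = (SOME \<eta>. \<eta> \<in> boundary T \<and> \<eta> N = i)" for i
  have "\<bar>g \<xi> - g (rep (\<xi> N))\<bar> < e" if "\<xi> \<in> boundary T" for \<xi>
  proof -
    have "rep (\<xi> N) \<in> boundary T \<and> rep (\<xi> N) N = \<xi> N"
      unfolding rep_def by (rule someI[of _ \<xi>]) (use that in simp)
    then show ?thesis using N that by simp
  qed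
  then show ?thesis by (intro exI[of _ N] exI[of _ "\<lambda>i. g (rep i)"]) blast
qed

end

section \<open>The Feller property\<close>

context potential_tree
begin

lemma coord_uniform_measurable:
  assumes "coord_uniform (boundary T) g"
  shows "g \<in> borel_measurable \<mu>"
proof -
  have "\<forall>k. \<exists>N \<psi>. \<forall>\<xi>\<in>boundary T. \<bar>g \<xi> - \<psi> (\<xi> N)\<bar> < 1 / real (Suc k)"
    using coord_uniform_level[OF assms] by simp
  then obtain N \<psi> where N: "\<And>k \<xi>. \<xi> \<in> boundary T \<Longrightarrow> \<bar>g \<xi> - \<psi> k (\<xi> (N k))\<bar> < 1 / real (Suc k)" by metis
  show ?thesis
  proof (rule borel_measurable_LIMSEQ_real)
    show "(\<lambda>\<xi>. \<psi> k (\<xi> (N k))) \<in> borel_measurable \<mu>" for k by measurable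
    fix \<xi> assume "\<xi> \<in> space \<mu>"
    then have b: "\<xi> \<in> boundary T" by (simp add: space_mu)
    have "(\<lambda>k. \<psi> k (\<xi> (N k)) - g \<xi>) \<longlonglongrightarrow> 0"
    proof (rule Lim_null_comparison[OF always_eventually LIMSEQ_inverse_real_of_nat], rule allI)
      show "norm (\<psi> k (\<xi> (N k)) - g \<xi>) \<le> inverse (real (Suc k))" for k
        using N[OF b, of k] by (simp add: inverse_eq_divide abs_minus_commute)
    qed
    then show "(\<lambda>k. \<psi> k (\<xi> (N k))) \<longlonglongrightarrow> g \<xi>" by (rule LIM_zero_cancel)
  qed
qed

lemma Kop_bound:
  assumes b: "symbol b L" and \<xi>: "\<xi> \<in> R" and B: "\<And>\<eta>. \<eta> \<in> boundary T \<Longrightarrow> \<bar>h \<eta>\<bar> \<le> B"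
  shows "\<bar>Kop b h \<xi>\<bar> \<le> B * L (root T)"
proof -
  have [measurable]: "cker b \<xi> \<in> borel_measurable \<mu>" using R_boundary[OF \<xi>] by measurable
  have B0: "0 \<le> B" using B[OF R_boundary[OF \<xi>]] by linarith
  have "ennreal \<bar>Kop b h \<xi>\<bar> \<le> (\<integral>\<^sup>+\<eta>. cker b \<xi> \<eta> * ennreal \<bar>h \<eta>\<bar> \<partial>\<mu>)" by (rule Kop_abs_le)
  also have "\<dots> \<le> (\<integral>\<^sup>+\<eta>. cker b \<xi> \<eta> * ennreal B \<partial>\<mu>)"
    using B by (intro nn_integral_mono mult_left_mono ennreal_leI) (auto simp: space_mu)
  also have "\<dots> = ennreal (B * L (root T))"
    using B0 symbol_root_nonneg[OF b]
    by (subst nn_integral_multc) (auto simp: mass_cker[OF b \<xi>] ennreal_mult mult.commute)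
  finally show ?thesis using B0 symbol_root_nonneg[OF b] by (subst (asm) ennreal_le_iff) auto
qed

text \<open>The operator does not increase sup-norm errors, and by \<open>Kop_Sg\<close> it maps
  functions of the first \<open>N\<close> coordinates to such functions. So the image of
  \<open>g\<close> is uniformly close to one of them.\<close>

lemma Kop_near_level:
  assumes t: "0 < t" and g [measurable]: "g \<in> borel_measurable \<mu>"
    and \<psi>: "\<And>\<xi>. \<xi> \<in> boundary T \<Longrightarrow> \<bar>g \<xi> - \<psi> (\<xi> N)\<bar> \<le> e" and \<xi>: "\<xi> \<in> R"
  shows "\<bar>Kop (bt t) g \<xi> - Sg (\<lambda>i. exp (- t / gpre i) * inc (\<lambda>\<eta>. \<psi> (\<eta> N)) i) N \<xi>\<bar> \<le> e"
proof -
  let ?h = "\<lambda>\<eta>. \<psi> (\<eta> N)"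
  have b: "\<xi> \<in> boundary T" using \<xi> by (rule R_boundary)
  have s: "symbol (bt t) (\<lambda>i. exp (- t / gpre i))" by (rule symbol_bt[OF t])
  have h: "integrable \<mu> ?h" by (rule integrable_coord)
  have e0: "0 \<le> e" using \<psi>[OF b] by linarith
  have gb: "\<bar>g \<eta>\<bar> \<le> e + (\<Sum>i\<in>lev N. \<bar>\<psi> i\<bar>)" if "\<eta> \<in> boundary T" for \<eta>
    using \<psi>[OF that] coord_bounded[OF that, of \<psi> N] by linarith
  \<comment> \<open>The identity holds almost everywhere, and \<open>Kop_cong_AE\<close> turns it
    into equality of the images at \<xi> itself.\<close>
  have "AE \<eta> in \<mu>. ?h \<eta> = Sg (inc ?h) N \<eta>"
    using AE_R by eventually_elim (simp add: Sg_inc_level[where \<psi> = \<psi>])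
  then have "Kop (bt t) ?h \<xi> = Kop (bt t) (Sg (inc ?h) N) \<xi>"
    using b by (intro Kop_cong_AE) measurable
  then have 1: "Kop (bt t) ?h \<xi> = Sg (\<lambda>i. exp (- t / gpre i) * inc ?h i) N \<xi>"
    using Kop_Sg[OF s \<xi> zm_inc[OF h]] by simp
  have "integrable \<mu> (\<lambda>\<eta>. enn2real (cker (bt t) \<xi> \<eta>) * g \<eta>)" "integrable \<mu> (\<lambda>\<eta>. enn2real (cker (bt t) \<xi> \<eta>) * ?h \<eta>)"
    using gb coord_bounded by (auto intro!: Kop_bounded_integrable[OF s \<xi>])
  then have "Kop (bt t) g \<xi> - Kop (bt t) ?h \<xi> = Kop (bt t) (\<lambda>\<eta>. g \<eta> - ?h \<eta>) \<xi>"
    by (simp add: Kop_def right_diff_distrib)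
  also have "\<bar>\<dots>\<bar> \<le> e * exp (- t / gpre (root T))"
    using \<psi> by (intro Kop_bound[OF s \<xi>])
  also have "\<dots> \<le> e * 1"
    using e0 t gpre_pos[of "root T"] by (intro mult_left_mono) auto
  finally show ?thesis unfolding 1 by simp
qed

lemma Sg_eq_of_coord_eq:
  assumes "\<xi> \<in> boundary T" "\<eta> \<in> boundary T" "\<xi> N = \<eta> N"
  shows "Sg \<phi> N \<xi> = Sg \<phi> N \<eta>"
  unfolding Sg_def using boundary_eq_below[OF assms] by (intro sum.cong) auto

text \<open>\<open>Kop_near_level\<close> reduces both claims to a fixed level \<open>N\<close>:
  there the image depends on the \<open>N\<close>-th site alone, and its finitely many coefficients
  converge as \<open>t\<close> tends to 0.\<close>

lemma feller: "feller T R (PW T w \<mu> R)"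
  unfolding feller_def
proof
  have Rb: "R \<noteq> {}" "R \<subseteq> boundary T" using R_nonempty R_boundary by auto
  fix f assume "f \<in> continuous_restrictions T R"
  then obtain g where g: "coord_uniform (boundary T) g" "\<forall>\<xi>\<in>R. f \<xi> = g \<xi>"
    using continuous_imp_coord_uniform by (auto simp: continuous_restrictions_def)
  have gm: "g \<in> borel_measurable \<mu>" using g(1) by (rule coord_uniform_measurable)
  \<comment> \<open>\<open>f\<close> agrees with the continuous \<open>g\<close> on
    \<open>R\<close>, and \<open>PW\<close> integrates over \<open>R\<close>.\<close>
  have PWf: "PW T w \<mu> R t f \<xi> = Kop (bt t) g \<xi>" if "\<xi> \<in> R" for t \<xi>
  proof -
    have "PW T w \<mu> R t f \<xi> = PW T w \<mu> R t g \<xi>"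
      unfolding PW_def set_lebesgue_integral_def using g(2)
      by (auto simp: indicator_def intro!: Bochner_Integration.integral_cong)
    then show ?thesis using PW_eq[OF that gm] by simp
  qed
  show "(\<forall>t>0. PW T w \<mu> R t f \<in> continuous_restrictions T R) \<and>
    uniform_limit R (\<lambda>t. PW T w \<mu> R t f) f (at_right 0)"
  proof (intro conjI allI impI)
    fix t :: real assume t: "0 < t"
    show "PW T w \<mu> R t f \<in> continuous_restrictions T R"
      unfolding continuous_restrictions_iff[OF Rb] coord_uniform_def
    proof (intro allI impI)
      fix e :: real assume e: "0 < e"
      then obtain N \<psi> where N: "\<forall>\<xi>\<in>boundary T. \<bar>g \<xi> - \<psi> (\<xi> N)\<bar> < e / 3"
        using coord_uniform_level[OF g(1), of "e / 3"] by auto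
      let ?S = "Sg (\<lambda>i. exp (- t / gpre i) * inc (\<lambda>\<eta>. \<psi> (\<eta> N)) i) N"
      have near: "\<bar>Kop (bt t) g \<xi> - ?S \<xi>\<bar> \<le> e / 3" if "\<xi> \<in> R" for \<xi>
        using N by (intro Kop_near_level[OF t gm _ that]) (auto intro: less_imp_le)
      have "\<bar>PW T w \<mu> R t f \<xi> - PW T w \<mu> R t f \<eta>\<bar> < e" if "\<xi> \<in> R" "\<eta> \<in> R" "\<xi> N = \<eta> N" for \<xi> \<eta>
      proof -
        have "?S \<xi> = ?S \<eta>"
          by (rule Sg_eq_of_coord_eq[OF R_boundary[OF that(1)] R_boundary[OF that(2)] that(3)])
        then show ?thesis
          using near[OF that(1)] near[OF that(2)] e unfolding PWf[OF that(1)] PWf[OF that(2)] by linarith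
      qed
      then show "\<exists>N. \<forall>\<xi>\<in>R. \<forall>\<eta>\<in>R. \<xi> N = \<eta> N \<longrightarrow> \<bar>PW T w \<mu> R t f \<xi> - PW T w \<mu> R t f \<eta>\<bar> < e" by blast
    qed
  next
    show "uniform_limit R (\<lambda>t. PW T w \<mu> R t f) f (at_right 0)"
    proof (rule uniform_limitI)
      fix e :: real assume e: "0 < e"
      then obtain N \<psi> where N: "\<forall>\<xi>\<in>boundary T. \<bar>g \<xi> - \<psi> (\<xi> N)\<bar> < e / 3"
        using coord_uniform_level[OF g(1), of "e / 3"] by auto
      let ?h = "\<lambda>\<eta>. \<psi> (\<eta> N)"
      let ?c = "\<lambda>t i. exp (- t / gpre i) * inc ?h i"
      have "((\<lambda>t. ?c t i) \<longlongrightarrow> inc ?h i) (at_right 0)" if "i \<in> sites T" for i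
        using gpre_pos[OF that] by (auto intro!: tendsto_eq_intros)
      then have "((\<lambda>t. sup_bound (\<lambda>i. ?c t i - inc ?h i) N) \<longlongrightarrow> 0) (at_right 0)"
        by (rule sup_bound_tendsto)
      then have "\<forall>\<^sub>F t in at_right 0. sup_bound (\<lambda>i. ?c t i - inc ?h i) N < e / 3"
        using e by (intro order_tendstoD(2)) auto
      moreover have "\<forall>\<^sub>F t :: real in at_right 0. 0 < t" by (rule eventually_at_right_less)
      ultimately show "\<forall>\<^sub>F t in at_right 0. \<forall>\<xi>\<in>R. dist (PW T w \<mu> R t f \<xi>) (f \<xi>) < e"
      proof eventually_elim
        case (elim t)
        show ?case
        proof
          fix \<xi> assume \<xi>: "\<xi> \<in> R"
          then have b: "\<xi> \<in> boundary T" by (rule R_boundary)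
          have 1: "\<bar>Kop (bt t) g \<xi> - Sg (?c t) N \<xi>\<bar> \<le> e / 3"
            using N by (intro Kop_near_level[OF elim(2) gm _ \<xi>]) (auto intro: less_imp_le)
          have 2: "\<bar>Sg (?c t) N \<xi> - Sg (inc ?h) N \<xi>\<bar> < e / 3"
            using Sg_bounded[OF b, of "\<lambda>i. ?c t i - inc ?h i" N] elim(1) unfolding Sg_diff by linarith
          have 3: "Sg (inc ?h) N \<xi> = ?h \<xi>" by (rule Sg_inc_level[OF \<xi>, where \<psi> = \<psi>]) simp
          have 4: "\<bar>g \<xi> - ?h \<xi>\<bar> < e / 3" using N b by blast
          show "dist (PW T w \<mu> R t f \<xi>) (f \<xi>) < e"
            using 1 2 3 4 g(2) \<xi> unfolding PWf[OF \<xi>] dist_real_def by (simp add: abs_if split: if_splits)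
        qed
      qed
    qed
  qed
qed

end

section \<open>The semigroup and its generator\<close>

context potential_tree
begin

lemma PW_indicator:
  "f \<in> borel_measurable \<mu> \<Longrightarrow> PW T w \<mu> R t f = (\<lambda>\<xi>. indicator R \<xi> * Kop (bt t) f \<xi>)"
proof
  fix \<xi> assume "f \<in> borel_measurable \<mu>"
  then show "PW T w \<mu> R t f \<xi> = indicator R \<xi> * Kop (bt t) f \<xi>"
    using PW_eq[of \<xi> f t] by (cases "\<xi> \<in> R") (auto simp: PW_def)
qed

lemma PW_measurable: "f \<in> borel_measurable \<mu> \<Longrightarrow> PW T w \<mu> R t f \<in> borel_measurable \<mu>"
  by (simp add: PW_indicator)

lemma PW_AE: "f \<in> borel_measurable \<mu> \<Longrightarrow> AE \<xi> in \<mu>. Kop (bt t) f \<xi> = PW T w \<mu> R t f \<xi>"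
  using AE_R by eventually_elim (simp add: PW_eq)

lemma PW_L2:
  assumes "0 < t" "L2 \<mu> f"
  shows "L2 \<mu> (PW T w \<mu> R t f)"
  using Kop_L2(1)[OF symbol_bt[OF assms(1)] assms(2)] PW_measurable[OF L2_measurable[OF assms(2)]]
    PW_AE[OF L2_measurable[OF assms(2)]] by (rule L2_cong_AE)

lemma exp_root_le_1: "0 < t \<Longrightarrow> exp (- t / gpre (root T)) \<le> 1"
  using gpre_pos[of "root T"] by simp

lemma exp_root_square_le_1: "0 < t \<Longrightarrow> (exp (- t / gpre (root T)))\<^sup>2 \<le> 1"
  using exp_root_le_1[of t] by (intro power_le_one) auto

lemma PW_contraction:
  assumes t: "0 < t" and f: "L2 \<mu> f"
  shows "L2_norm \<mu> (PW T w \<mu> R t f) \<le> L2_norm \<mu> f"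
proof -
  have [measurable]: "f \<in> borel_measurable \<mu>" "PW T w \<mu> R t f \<in> borel_measurable \<mu>"
    using f PW_measurable by (auto dest: L2_measurable)
  have "(\<integral>\<xi>. (PW T w \<mu> R t f \<xi>)\<^sup>2 \<partial>\<mu>) = (\<integral>\<xi>. (Kop (bt t) f \<xi>)\<^sup>2 \<partial>\<mu>)"
  proof (rule integral_cong_AE)
    have "AE \<xi> in \<mu>. Kop (bt t) f \<xi> = PW T w \<mu> R t f \<xi>" by (rule PW_AE) measurable
    then show "AE \<xi> in \<mu>. (PW T w \<mu> R t f \<xi>)\<^sup>2 = (Kop (bt t) f \<xi>)\<^sup>2" by eventually_elim simp
  qed measurable
  also have "\<dots> \<le> (exp (- t / gpre (root T)))\<^sup>2 * (\<integral>\<xi>. (f \<xi>)\<^sup>2 \<partial>\<mu>)"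
    by (rule Kop_L2(2)[OF symbol_bt[OF t] f])
  also have "\<dots> \<le> 1 * (\<integral>\<xi>. (f \<xi>)\<^sup>2 \<partial>\<mu>)"
    using exp_root_square_le_1[OF t] by (intro mult_right_mono) auto
  finally show ?thesis by (simp add: L2_norm_def)
qed

text \<open>The multipliers are exponentials in time, and limits in L2 are unique, so operators with
  the same multiplier coincide.\<close>

lemma PW_comp:
  assumes st: "0 < s" "0 < t" and f: "L2 \<mu> f"
  shows "AE \<xi> in \<mu>. PW T w \<mu> R (s + t) f \<xi> = PW T w \<mu> R s (PW T w \<mu> R t f) \<xi>"
proof -
  have fm: "f \<in> borel_measurable \<mu>" using f by (rule L2_measurable)
  have "exp (- (s + t) / g) = exp (- s / g) * exp (- t / g)" for g :: real
  proof -
    have "- (s + t) / g = - s / g + - t / g" by (simp add: diff_divide_distrib)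
    then show ?thesis by (simp only: exp_add)
  qed
  then have "(\<lambda>i. exp (- (s + t) / gpre i) * inc f i) = (\<lambda>i. exp (- s / gpre i) * (exp (- t / gpre i) * inc f i))"
    by (simp add: fun_eq_iff)
  moreover have "L2_tendsto \<mu> (Sg (\<lambda>i. exp (- (s + t) / gpre i) * inc f i)) (Kop (bt (s + t)) f) sequentially"
    using st by (intro Kop_spectral symbol_bt f) simp
  ultimately have "L2_tendsto \<mu> (Sg (\<lambda>i. exp (- s / gpre i) * (exp (- t / gpre i) * inc f i))) (Kop (bt (s + t)) f) sequentially"
    by simp
  from L2_tendsto_unique[OF sequentially_bot this Kop_comp_spectral[OF symbol_bt[OF st(1)] symbol_bt[OF st(2)] f]]
  have "AE \<xi> in \<mu>. Kop (bt (s + t)) f \<xi> = Kop (bt s) (Kop (bt t) f) \<xi>" .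
  then show ?thesis
    using AE_R
  proof eventually_elim
    case (elim \<xi>)
    have "Kop (bt s) (Kop (bt t) f) \<xi> = Kop (bt s) (PW T w \<mu> R t f) \<xi>"
      by (intro Kop_cong_AE PW_AE PW_measurable Kop_measurable fm R_boundary elim)
    then show ?case using elim by (simp add: PW_eq fm PW_measurable)
  qed
qed

lemma PW_sub_markov:
  assumes t: "0 < t" and f: "L2 \<mu> f" and b: "AE \<xi> in \<mu>. 0 \<le> f \<xi> \<and> f \<xi> \<le> 1"
  shows "AE \<xi> in \<mu>. 0 \<le> PW T w \<mu> R t f \<xi> \<and> PW T w \<mu> R t f \<xi> \<le> 1"
  using AE_R
proof eventually_elim
  case (elim \<xi>)
  have fm [measurable]: "f \<in> borel_measurable \<mu>" using f by (rule L2_measurable)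
  have [measurable]: "cker (bt t) \<xi> \<in> borel_measurable \<mu>" using R_boundary[OF elim] by measurable
  have "0 \<le> Kop (bt t) f \<xi>"
    unfolding Kop_def
  proof (rule integral_nonneg_AE)
    show "AE \<eta> in \<mu>. 0 \<le> enn2real (cker (bt t) \<xi> \<eta>) * f \<eta>"
      using b by eventually_elim simp
  qed
  moreover have "ennreal \<bar>Kop (bt t) f \<xi>\<bar> \<le> ennreal (exp (- t / gpre (root T)))"
  proof -
    have "ennreal \<bar>Kop (bt t) f \<xi>\<bar> \<le> (\<integral>\<^sup>+\<eta>. cker (bt t) \<xi> \<eta> * ennreal \<bar>f \<eta>\<bar> \<partial>\<mu>)" by (rule Kop_abs_le)
    also have "\<dots> \<le> (\<integral>\<^sup>+\<eta>. cker (bt t) \<xi> \<eta> * 1 \<partial>\<mu>)"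
    proof (rule nn_integral_mono_AE)
      show "AE \<eta> in \<mu>. cker (bt t) \<xi> \<eta> * ennreal \<bar>f \<eta>\<bar> \<le> cker (bt t) \<xi> \<eta> * 1"
        using b
      proof eventually_elim
        case (elim \<eta>)
        then have "ennreal \<bar>f \<eta>\<bar> \<le> 1" by (simp add: ennreal_le_1)
        then show ?case by (rule mult_left_mono) simp
      qed
    qed
    also have "\<dots> = ennreal (exp (- t / gpre (root T)))"
      using mass_cker[OF symbol_bt[OF t] elim] by simp
    finally show ?thesis .
  qed
  then have "\<bar>Kop (bt t) f \<xi>\<bar> \<le> exp (- t / gpre (root T))" by (subst (asm) ennreal_le_iff) auto
  ultimately show ?case using exp_root_le_1[OF t] unfolding PW_eq[OF elim fm] by linarith
qed

lemma exp_tendsto_1: "i \<in> sites T \<Longrightarrow> ((\<lambda>t. exp (- t / gpre i) * c) \<longlongrightarrow> c) (at_right 0)"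
  using gpre_pos[of i] by (auto intro!: tendsto_eq_intros)

text \<open>\<open>L2_tendsto_approx\<close> along the martingale of \<open>f\<close>: up to a fixed
  level finitely many multipliers occur, and each tends to 1.\<close>

lemma PW_strongly_continuous:
  assumes f: "L2 \<mu> f"
  shows "L2_tendsto \<mu> (\<lambda>t. PW T w \<mu> R t f) f (at_right 0)"
proof -
  have pos: "\<forall>\<^sub>F t :: real in at_right 0. 0 < t" by (rule eventually_at_right_less)
  have "L2_tendsto \<mu> (\<lambda>t. Kop (bt t) f) f (at_right 0)"
  proof (rule L2_tendsto_approx[OF Sg_inc_tendsto[OF f]])
    fix k
    have l: "L2_tendsto \<mu> (\<lambda>t. Sg (\<lambda>i. exp (- t / gpre i) * inc f i) k) (Sg (inc f) k) (at_right 0)"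
      by (intro Sg_tendsto exp_tendsto_1)
    show "L2_tendsto \<mu> (\<lambda>t. Kop (bt t) (Sg (inc f) k)) (Sg (inc f) k) (at_right 0)"
    proof (rule L2_tendsto_cong_AE[OF l])
      show "\<forall>\<^sub>F t in at_right 0. L2 \<mu> (Kop (bt t) (Sg (inc f) k)) \<and>
          (AE \<xi> in \<mu>. Sg (\<lambda>i. exp (- t / gpre i) * inc f i) k \<xi> = Kop (bt t) (Sg (inc f) k) \<xi>)"
        using pos
      proof (rule eventually_mono, intro conjI)
        fix t :: real assume t: "0 < t"
        show "L2 \<mu> (Kop (bt t) (Sg (inc f) k))" by (rule Kop_L2[OF symbol_bt[OF t] Sg_L2])
        show "AE \<xi> in \<mu>. Sg (\<lambda>i. exp (- t / gpre i) * inc f i) k \<xi> = Kop (bt t) (Sg (inc f) k) \<xi>"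
          using Kop_Sg_AE[OF symbol_bt[OF t] zm_inc_L2[OF f], where N = k] by eventually_elim simp
      qed
    qed (auto intro: Sg_L2)
  next
    show "\<forall>\<^sub>F t in at_right 0. \<forall>f g. L2 \<mu> f \<longrightarrow> L2 \<mu> g \<longrightarrow> L2 \<mu> (Kop (bt t) f) \<and>
      (\<integral>x. (Kop (bt t) f x - Kop (bt t) g x)\<^sup>2 \<partial>\<mu>) \<le> (\<integral>x. (f x - g x)\<^sup>2 \<partial>\<mu>)"
      using pos
    proof (rule eventually_mono, intro allI impI conjI)
      fix t :: real and f g assume t: "0 < t" and fg: "L2 \<mu> f" "L2 \<mu> g"
      show "L2 \<mu> (Kop (bt t) f)" by (rule Kop_L2[OF symbol_bt[OF t] fg(1)])
      have "(\<integral>x. (Kop (bt t) f x - Kop (bt t) g x)\<^sup>2 \<partial>\<mu>) \<le> (exp (- t / gpre (root T)))\<^sup>2 * (\<integral>x. (f x - g x)\<^sup>2 \<partial>\<mu>)"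
        by (rule Kop_diff_le[OF symbol_bt[OF t] fg])
      also have "\<dots> \<le> 1 * (\<integral>x. (f x - g x)\<^sup>2 \<partial>\<mu>)"
        using exp_root_square_le_1[OF t] by (intro mult_right_mono) auto
      finally show "(\<integral>x. (Kop (bt t) f x - Kop (bt t) g x)\<^sup>2 \<partial>\<mu>) \<le> (\<integral>x. (f x - g x)\<^sup>2 \<partial>\<mu>)" by simp
    qed
  qed
  then show ?thesis
  proof (rule L2_tendsto_cong_AE)
    show "\<forall>\<^sub>F t in at_right 0. L2 \<mu> (PW T w \<mu> R t f) \<and> (AE \<xi> in \<mu>. Kop (bt t) f \<xi> = PW T w \<mu> R t f \<xi>)"
      using pos by (rule eventually_mono) (intro conjI PW_L2 f PW_AE L2_measurable)
  qed (use f in auto)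
qed

lemma semigroup: "L2_sub_markov_semigroup \<mu> (PW T w \<mu> R)"
  unfolding L2_sub_markov_semigroup_def
proof (intro conjI allI impI)
  fix t :: real and f g a b assume t: "0 < t" and fg: "L2 \<mu> f \<and> L2 \<mu> g"
  then have f: "L2 \<mu> f" and g: "L2 \<mu> g" by auto
  have m: "f \<in> borel_measurable \<mu>" "g \<in> borel_measurable \<mu>" "(\<lambda>y. a * f y + b * g y) \<in> borel_measurable \<mu>"
    by (rule L2_measurable[OF f], rule L2_measurable[OF g],
        rule L2_measurable[OF L2_add[OF L2_cmult[OF f, of a] L2_cmult[OF g, of b]]])
  show "AE x in \<mu>. PW T w \<mu> R t (\<lambda>y. a * f y + b * g y) x = a * PW T w \<mu> R t f x + b * PW T w \<mu> R t g x"
    using Kop_linear[OF symbol_bt[OF t] f g, of a b] AE_R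
    by eventually_elim (simp add: PW_eq m)
qed (use PW_L2 PW_contraction PW_comp PW_sub_markov PW_strongly_continuous in blast)+

section \<open>The martingale expansion and the generator\<close>

lemma cond_increment_AE:
  assumes f: "L2 \<mu> f"
  shows "AE \<xi> in \<mu>. cond_increment T \<mu> n f \<xi> = inc f (\<xi> n)"
  using cond_exp_level[OF L2_integrable[OF f], of n] cond_exp_level[OF L2_integrable[OF f], of "n - 1"] AE_space
proof eventually_elim
  case (elim \<xi>)
  then have "\<xi> \<in> boundary T" by (simp add: space_mu)
  then show ?case
    using elim(1,2) by (cases n) (simp_all add: cond_increment_def inc_def boundary_0 boundary_Suc_neq_root boundary_parent)
qed

lemma spectral:
  assumes t: "0 < t" and f: "L2 \<mu> f"
  shows "L2_tendsto \<mu> (\<lambda>N \<xi>. \<Sum>n\<le>N. exp (- t / Gfun T w \<mu> n \<xi>) * cond_increment T \<mu> n f \<xi>)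
    (PW T w \<mu> R t f) sequentially"
proof (rule L2_tendsto_cong_AE[OF Kop_spectral[OF symbol_bt[OF t] f]])
  have fm [measurable]: "f \<in> borel_measurable \<mu>" using f by (rule L2_measurable)
  have [measurable]: "Gfun T w \<mu> n \<in> borel_measurable \<mu>" for n
    unfolding Gfun_def by (intro borel_measurable_suminf borel_measurable_times borel_coord borel_measurable_const)
  have [measurable]: "cond_increment T \<mu> n f \<in> borel_measurable \<mu>" for n
  proof -
    have "real_cond_exp \<mu> (level_sigma T k) f \<in> borel_measurable \<mu>" for k
      using measurable_from_subalg[OF subalgebra_level borel_measurable_cond_exp] .
    then show ?thesis unfolding cond_increment_def by measurable
  qed
  show "\<forall>\<^sub>F N in sequentially. L2 \<mu> (\<lambda>\<xi>. \<Sum>n\<le>N. exp (- t / Gfun T w \<mu> n \<xi>) * cond_increment T \<mu> n f \<xi>) \<and>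
      (AE \<xi> in \<mu>. Sg (\<lambda>i. exp (- t / gpre i) * inc f i) N \<xi> = (\<Sum>n\<le>N. exp (- t / Gfun T w \<mu> n \<xi>) * cond_increment T \<mu> n f \<xi>))"
  proof (rule always_eventually, rule allI)
    fix N
    have "AE \<xi> in \<mu>. \<forall>n. cond_increment T \<mu> n f \<xi> = inc f (\<xi> n)"
      using cond_increment_AE[OF f] by (simp add: AE_all_countable)
    then have ae: "AE \<xi> in \<mu>. Sg (\<lambda>i. exp (- t / gpre i) * inc f i) N \<xi> = (\<Sum>n\<le>N. exp (- t / Gfun T w \<mu> n \<xi>) * cond_increment T \<mu> n f \<xi>)"
      using AE_R by eventually_elim (simp add: Sg_def Gfun_eq)
    then show "L2 \<mu> (\<lambda>\<xi>. \<Sum>n\<le>N. exp (- t / Gfun T w \<mu> n \<xi>) * cond_increment T \<mu> n f \<xi>) \<and>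
      (AE \<xi> in \<mu>. Sg (\<lambda>i. exp (- t / gpre i) * inc f i) N \<xi> = (\<Sum>n\<le>N. exp (- t / Gfun T w \<mu> n \<xi>) * cond_increment T \<mu> n f \<xi>))"
      by (intro conjI L2_cong_AE[OF Sg_L2 _ ae]) measurable
  qed
  show "L2 \<mu> (PW T w \<mu> R t f)" by (rule PW_L2[OF t f])
  show "AE \<xi> in \<mu>. Kop (bt t) f \<xi> = PW T w \<mu> R t f \<xi>" by (rule PW_AE[OF fm])
qed

lemma difference_quotient_exp:
  "0 < a \<Longrightarrow> ((\<lambda>t. (exp (- t / a) - 1) / t) \<longlongrightarrow> - 1 / a) (at_right (0 :: real))"
proof -
  assume "0 < a"
  then have "DERIV (\<lambda>t. exp (- t / a)) 0 :> - 1 / a"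
    by (auto intro!: derivative_eq_intros)
  then have "((\<lambda>t. (exp (- t / a) - 1) / t) \<longlongrightarrow> - 1 / a) (at 0)"
    by (simp add: DERIV_def)
  then show ?thesis by (rule tendsto_mono[rotated]) (simp add: at_within_le_at)
qed

text \<open>The martingale of a function of the \<open>n\<close>-th site stops at level
  \<open>n\<close>. So \<open>W\<close> is inverted by dividing finitely many increments by
  \<open>gpre\<close>, and the difference quotient is a finite sum whose coefficients are
  differentiated at 0.\<close>

lemma cylinder_generator:
  assumes "f \<in> cylinder_functions T \<mu>"
  shows "\<exists>g. Wop_inverse w \<mu> f g"
    and "\<And>g. Wop_inverse w \<mu> f g \<Longrightarrow> L2_generator \<mu> (PW T w \<mu> R) f (\<lambda>\<xi>. - g \<xi>)"
proof -
  from assms obtain n where f: "L2 \<mu> f" and fn: "f \<in> borel_measurable (level_sigma T n)"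
    by (auto simp: cylinder_functions_def)
  have fm: "f \<in> borel_measurable \<mu>" using f by (rule L2_measurable)
  obtain \<psi> where \<psi>: "\<forall>\<xi>\<in>boundary T. f \<xi> = \<psi> (\<xi> n)" using level_measurable_factor[OF fn] by blast
  have fS: "Sg (inc f) n \<xi> = f \<xi>" if "\<xi> \<in> R" for \<xi>
    using \<psi> by (intro Sg_inc_level[OF that, where \<psi> = \<psi>]) blast
  let ?\<phi> = "\<lambda>i. 1 / gpre i * inc f i"
  let ?g = "Sg ?\<phi> n"
  have z: "zm ?\<phi>"
  proof (rule zm_mult_siblings[where L = "\<lambda>i. 1 / gpre i"])
    fix i j k assume "j \<in> succs T i" "k \<in> succs T i"
    then have "gpre j = gpre k" by (rule siblings_gpre)
    then show "1 / gpre j = 1 / gpre k" by simp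
  qed (rule zm_inc_L2[OF f])
  have Wg: "AE \<xi> in \<mu>. Kop bU ?g \<xi> = f \<xi>"
    using AE_R
  proof eventually_elim
    case (elim \<xi>)
    have "Kop bU ?g \<xi> = Sg (\<lambda>i. gpre i * ?\<phi> i) n \<xi>" by (rule Kop_Sg[OF symbol_U elim z])
    also have "\<dots> = Sg (inc f) n \<xi>"
      using gpre_pos by (intro Sg_cong R_boundary elim) (simp add: less_imp_neq[symmetric])
    finally show ?case using fS[OF elim] by simp
  qed
  have WK: "AE \<eta> in \<mu>. Wop w \<mu> u \<eta> = Kop bU u \<eta>" for u
    by (intro AE_I2) (simp add: Wop_eq space_mu)
  have "AE \<eta> in \<mu>. Wop w \<mu> ?g \<eta> = f \<eta>"
    using WK[of ?g] Wg by eventually_elim simp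
  then show "\<exists>g. Wop_inverse w \<mu> f g"
    unfolding Wop_inverse_def using f Sg_L2 by blast
  fix g assume "Wop_inverse w \<mu> f g"
  then have g: "L2 \<mu> g" and Wf: "AE \<eta> in \<mu>. Wop w \<mu> g \<eta> = f \<eta>" by (auto simp: Wop_inverse_def)
  \<comment> \<open>Injectivity of \<open>W\<close> identifies an arbitrary preimage
    \<open>g\<close> with the explicit one.\<close>
  have "AE \<xi> in \<mu>. Kop bU (\<lambda>\<eta>. g \<eta> - ?g \<eta>) \<xi> = 0"
    using Kop_linear[OF symbol_U g Sg_L2, of 1 "-1" ?\<phi> n] Wg WK[of g] Wf by eventually_elim simp
  then have "AE \<xi> in \<mu>. g \<xi> - ?g \<xi> = 0"
    by (rule Kop_injective[OF symbol_U _ L2_diff[OF g Sg_L2]]) (use gpre_pos in force)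
  then have gS: "AE \<xi> in \<mu>. Sg (\<lambda>i. - 1 / gpre i * inc f i) n \<xi> = - g \<xi>"
    by eventually_elim (simp add: Sg_def sum_negf)
  let ?c = "\<lambda>t i. (exp (- t / gpre i) - 1) / t * inc f i"
  have "L2_tendsto \<mu> (\<lambda>t. Sg (?c t) n) (Sg (\<lambda>i. - 1 / gpre i * inc f i) n) (at_right 0)"
    by (intro Sg_tendsto tendsto_mult tendsto_const difference_quotient_exp gpre_pos)
  then have "L2_tendsto \<mu> (\<lambda>t \<xi>. (PW T w \<mu> R t f \<xi> - f \<xi>) / t) (\<lambda>\<xi>. - g \<xi>) (at_right 0)"
  proof (rule L2_tendsto_cong_AE[OF _ _ _ gS])
    show "L2 \<mu> (\<lambda>\<xi>. - g \<xi>)" using L2_cmult[OF g, of "-1"] by simp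
    have "\<forall>\<^sub>F t :: real in at_right 0. 0 < t" by (rule eventually_at_right_less)
    then show "\<forall>\<^sub>F t in at_right 0. L2 \<mu> (\<lambda>\<xi>. (PW T w \<mu> R t f \<xi> - f \<xi>) / t) \<and>
        (AE \<xi> in \<mu>. Sg (?c t) n \<xi> = (PW T w \<mu> R t f \<xi> - f \<xi>) / t)"
    proof (rule eventually_mono, intro conjI)
      fix t :: real assume t: "0 < t"
      show "L2 \<mu> (\<lambda>\<xi>. (PW T w \<mu> R t f \<xi> - f \<xi>) / t)"
        using L2_cmult[OF L2_diff[OF PW_L2[OF t f] f], of "1 / t"] by simp
      have ae: "AE \<eta> in \<mu>. f \<eta> = Sg (inc f) n \<eta>" using AE_R by eventually_elim (simp add: fS)
      show "AE \<xi> in \<mu>. Sg (?c t) n \<xi> = (PW T w \<mu> R t f \<xi> - f \<xi>) / t"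
        using AE_R
      proof eventually_elim
        case (elim \<xi>)
        have "PW T w \<mu> R t f \<xi> = Kop (bt t) f \<xi>" by (rule PW_eq[OF elim fm])
        also have "\<dots> = Kop (bt t) (Sg (inc f) n) \<xi>"
          by (intro Kop_cong_AE ae fm Sg_measurable R_boundary elim)
        also have "\<dots> = Sg (\<lambda>i. exp (- t / gpre i) * inc f i) n \<xi>"
          by (rule Kop_Sg[OF symbol_bt[OF t] elim zm_inc_L2[OF f]])
        finally have "PW T w \<mu> R t f \<xi> - f \<xi> = Sg (\<lambda>i. exp (- t / gpre i) * inc f i - inc f i) n \<xi>"
          by (simp add: fS[OF elim, symmetric] Sg_diff)
        then show ?case by (simp add: Sg_def sum_divide_distrib left_diff_distrib)
      qed
    qed
  qed
  then show "L2_generator \<mu> (PW T w \<mu> R) f (\<lambda>\<xi>. - g \<xi>)"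
    using f by (simp add: L2_generator_def)
qed

lemma semigroup_properties:
  "(\<forall>t>0. \<forall>\<xi>\<in>R. \<forall>\<eta>\<in>R. pker T w \<mu> t \<xi> \<eta> = pker T w \<mu> t \<eta> \<xi>)
     \<and> sub_markov_transition_kernel \<mu> R (pker T w \<mu>)
     \<and> (\<forall>t>0. \<forall>\<xi>\<in>R. (\<integral>\<^sup>+\<eta>\<in>R. pker T w \<mu> t \<xi> \<eta> \<partial>\<mu>) = ennreal (exp (- t / Gfun T w \<mu> 0 \<xi>)))
     \<and> feller T R (PW T w \<mu> R)
     \<and> L2_sub_markov_semigroup \<mu> (PW T w \<mu> R)
     \<and> (\<forall>t>0. \<forall>f. L2 \<mu> f \<longrightarrow>
          L2_tendsto \<mu>
            (\<lambda>N \<xi>. \<Sum>n\<le>N. exp (- t / Gfun T w \<mu> n \<xi>) * cond_increment T \<mu> n f \<xi>)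
            (PW T w \<mu> R t f) sequentially)
     \<and> (\<forall>f\<in>cylinder_functions T \<mu>.
          (\<exists>g. Wop_inverse w \<mu> f g)
          \<and> (\<forall>g. Wop_inverse w \<mu> f g \<longrightarrow> L2_generator \<mu> (PW T w \<mu> R) f (\<lambda>\<xi>. - g \<xi>)))
     \<and> (\<forall>f. L2 \<mu> f \<longrightarrow>
          (AE \<xi> in \<mu>. set_integrable lborel {0<..} (\<lambda>t. PW T w \<mu> R t f \<xi>)
             \<and> (LINT t:{0<..}|lborel. PW T w \<mu> R t f \<xi>) = Wop w \<mu> f \<xi>))
     \<and> (\<forall>\<xi>\<in>R. \<forall>\<eta>\<in>R. Ubd w \<xi> \<eta> = (\<integral>\<^sup>+t\<in>{0<..}. pker T w \<mu> t \<xi> \<eta> \<partial>lborel))"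
proof (intro conjI)
  show "\<forall>t>0. \<forall>\<xi>\<in>R. \<forall>\<eta>\<in>R. pker T w \<mu> t \<xi> \<eta> = pker T w \<mu> t \<eta> \<xi>"
    by (simp add: pker_eq R_boundary cker_sym)
  show "\<forall>t>0. \<forall>\<xi>\<in>R. (\<integral>\<^sup>+\<eta>\<in>R. pker T w \<mu> t \<xi> \<eta> \<partial>\<mu>) = ennreal (exp (- t / Gfun T w \<mu> 0 \<xi>))"
    by (simp add: mass_pker Gfun_eq boundary_0 R_boundary)
  show "\<forall>\<xi>\<in>R. \<forall>\<eta>\<in>R. Ubd w \<xi> \<eta> = (\<integral>\<^sup>+t\<in>{0<..}. pker T w \<mu> t \<xi> \<eta> \<partial>lborel)"
    by (simp add: pker_eq green Ubd_eq R_boundary)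
qed (use sub_markov feller semigroup spectral cylinder_generator potential in blast)+

end

section \<open>From the chain to the analytic setting\<close>

lemma (in tree_chain) ex_potential_tree:
  "\<exists>gam. potential_tree T (exit_law T P X) w gam (regular_points T P X)"
proof
  define h where "h i = habs (Site i)" for i
  \<comment> \<open>The factor in front of the flow in \<open>measure_cyl\<close>; with it the drop
    of \<open>c * h\<close> across an edge is \<open>delta w\<close> times the mass below, as
    \<open>gam_step\<close> demands.\<close>
  define c where "c = w 0 / (1 - h (root T))"
  have c: "0 < c" using w_pos habs_root_less_1 by (simp add: c_def h_def)
  have lim: "(\<lambda>n. c * h (\<xi> n)) \<longlonglongrightarrow> 0 \<longleftrightarrow> (\<lambda>n. habs (Site (\<xi> n))) \<longlonglongrightarrow> 0" for \<xi>
    using tendsto_mult_left_iff[of c "\<lambda>n. h (\<xi> n)" 0 sequentially] c by (simp add: h_def)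
  show "potential_tree T (exit_law T P X) w (\<lambda>i. c * h i) (regular_points T P X)"
  proof (intro potential_tree.intro potential_tree_axioms.intro bd.boundary_measure_axioms weighted_tree_axioms)
    show "0 < c * h i" if "i \<in> sites T" for i using c habs_pos[OF that] by (simp add: h_def)
    show "c * h (parent T i) - c * h i = delta w (level T i) * measure (exit_law T P X) (cyl T i)"
      if "i \<in> sites T" "i \<noteq> root T" for i
    proof -
      have "delta w (level T i) * flow habs i = h (parent T i) - h i"
        using that delta_pos[of "level T i"] by (simp add: flow_def cond_def up_def h_def)
      then have "c * (h (parent T i) - h i) = delta w (level T i) * (w 0 * flow habs i / (1 - h (root T)))"
        by (simp add: c_def mult_ac)
      then show ?thesis by (simp add: measure_cyl[OF that(1)] h_def right_diff_distrib)
    qed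
    show "regular_points T P X = {\<xi> \<in> boundary T. (\<lambda>n. c * h (\<xi> n)) \<longlonglongrightarrow> 0}"
      by (simp add: lim regular_points_eq)
    show "AE \<xi> in exit_law T P X. (\<lambda>n. c * h (\<xi> n)) \<longlonglongrightarrow> 0"
      unfolding lim by (rule AE_habs_tendsto_0)
  qed
qed

theorem theorem6p1:
  fixes T :: "'v rtree" and w :: "nat \<Rightarrow> real"
    and P :: "'v \<Rightarrow> 'o measure" and X :: "real \<Rightarrow> 'o \<Rightarrow> 'v state"
    and \<mu> :: "(nat \<Rightarrow> 'v) measure" and R :: "(nat \<Rightarrow> 'v) set"
  assumes tree: "infinite_tree T"
    and w_mono: "strict_mono w" and w_pos: "\<forall>n. 0 < w n"
    and chain: "minimal_chain T w P X"
    and transient: "transient T P X"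
    and mu: "\<mu> = exit_law T P X"
    and R: "R = regular_points T P X"
  shows
    "(\<forall>t>0. \<forall>\<xi>\<in>R. \<forall>\<eta>\<in>R. pker T w \<mu> t \<xi> \<eta> = pker T w \<mu> t \<eta> \<xi>)
     \<and> sub_markov_transition_kernel \<mu> R (pker T w \<mu>)
     \<and> (\<forall>t>0. \<forall>\<xi>\<in>R. (\<integral>\<^sup>+\<eta>\<in>R. pker T w \<mu> t \<xi> \<eta> \<partial>\<mu>) = ennreal (exp (- t / Gfun T w \<mu> 0 \<xi>)))
     \<and> feller T R (PW T w \<mu> R)
     \<and> L2_sub_markov_semigroup \<mu> (PW T w \<mu> R)
     \<and> (\<forall>t>0. \<forall>f. L2 \<mu> f \<longrightarrow>
          L2_tendsto \<mu>
            (\<lambda>N \<xi>. \<Sum>n\<le>N. exp (- t / Gfun T w \<mu> n \<xi>) * cond_increment T \<mu> n f \<xi>)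
            (PW T w \<mu> R t f) sequentially)
     \<and> (\<forall>f\<in>cylinder_functions T \<mu>.
          (\<exists>g. Wop_inverse w \<mu> f g)
          \<and> (\<forall>g. Wop_inverse w \<mu> f g \<longrightarrow> L2_generator \<mu> (PW T w \<mu> R) f (\<lambda>\<xi>. - g \<xi>)))
     \<and> (\<forall>f. L2 \<mu> f \<longrightarrow>
          (AE \<xi> in \<mu>. set_integrable lborel {0<..} (\<lambda>t. PW T w \<mu> R t f \<xi>)
             \<and> (LINT t:{0<..}|lborel. PW T w \<mu> R t f \<xi>) = Wop w \<mu> f \<xi>))
     \<and> (\<forall>\<xi>\<in>R. \<forall>\<eta>\<in>R. Ubd w \<xi> \<eta> = (\<integral>\<^sup>+t\<in>{0<..}. pker T w \<mu> t \<xi> \<eta> \<partial>lborel))"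
  proof -
  obtain Y S where "tree_chain T w P X Y S"
    using tree_chain_exists[OF tree w_mono w_pos chain transient] by blast
  then obtain gam where "potential_tree T \<mu> w gam R"
    using tree_chain.ex_potential_tree unfolding mu R by blast
  then show ?thesis by (rule potential_tree.semigroup_properties)
qed

end
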